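(* Let $d\ge 1$, $H_0\in[1/2,1]$ and $H=(H_1,\dots,H_d)\in(0,1)^d$, and write $|H|:=H_1+\cdots+H_d$. Consider the stochastic wave equation $$\frac{\partial^2 u}{\partial t^2}(t,x)=\Delta u(t,x)+\dot W(t,x),\quad t\ge0,\ x\in\mathbb{R}^d,\qquad u(0,x)=0,\ \frac{\partial u}{\partial t}(0,x)=0,$$ driven by the fractional Gaussian noise $\dot W$ described in the context. Then this equation is solvable (in the sense defined in the context) if and only if $$\begin{cases} |H|>d-1 & \text{if } H_0=1/2,\\ |H|>d-2 & \text{if } H_0=1,\\ |H|+H_0>d-\tfrac12 & \text{if } 1/2<H_0<1.\end{cases}$$
   Context: For $a\in(0,1]$ and $\xi,\eta\in\mathbb{R}$ let $R_a(\xi,\eta)=\frac12(|\xi|^{2a}+|\eta|^{2a}-|\xi-\eta|^{2a})$ (so $R_{1/2}(t,s)=s\wedge t$ for $s,t\ge0$). $W=\{W(t,x): t\ge0,x\in\mathbb{R}^d\}$ is a centered Gaussian random field with covariance $\mathbb{E}[W(t,x)W(s,y)]=R_{H_0}(t,s)\prod_{i=1}^d R_{H_i}(x_i,y_i)$, and formally $\dot W=\frac{\partial^{d+1}W}{\partial t\partial x_1\cdots\partial x_d}$; stochastic integrals of deterministic integrands with respect to $W$ are Wiener integrals (for elementary integrands $\mathbf 1_{(a,b]}(t)\mathbf 1_{(c,e]}(x)$ they are the rectangular increments of $W$, extended by $L^2(\Omega)$-isometry). $G_t$ denotes the fundamental solution of the wave operator on $\mathbb{R}^d$, characterized by its Fourier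 transform $\hat G_t(\xi)=\sin(t|\xi|)/|\xi|$. For $\varepsilon>0$ let $p_\varepsilon(x)=(2\pi\varepsilon)^{-d/2}e^{-|x|^2/(2\varepsilon)}$ and let $\dot W_\varepsilon(t,x)=\int_{\mathbb{R}^d}p_\varepsilon(x-y)\dot W(t,y)\,dy$ be the spatially mollified noise, with associated field $W_\varepsilon$. For every $H_0\ge1/2$, $H\in(0,1)^d$ the Wiener integral $u_\varepsilon(t,x)=\int_0^t\int_{\mathbb{R}^d}G_{t-s}(x-y)\,W_\varepsilon(ds,dy)$ exists as a finite-variance Gaussian random variable. The equation is called solvable if for every $(t,x)\in\mathbb{R}_+\times\mathbb{R}^d$ the family $\{u_\varepsilon(t,x)\}$ is Cauchy in $L^2(\Omega)$ as $\varepsilon\to0$; the limit is then the solution $u(t,x)=\int_0^t\int_{\mathbb{R}^d}G_{t-s}(x-y)W(ds,dy)$. *)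

theory Defs
  imports "HOL-Probability.Probability"
begin

definition Rcov :: "real \<Rightarrow> real \<Rightarrow> real \<Rightarrow> real" where
  "Rcov a \<xi> \<eta> = (\<bar>\<xi>\<bar> powr (2*a) + \<bar>\<eta>\<bar> powr (2*a) - \<bar>\<xi> - \<eta>\<bar> powr (2*a)) / 2"

definition gaussian_rv :: "'w measure \<Rightarrow> ('w \<Rightarrow> real) \<Rightarrow> bool" where
  "gaussian_rv M X \<longleftrightarrow> X \<in> borel_measurable M \<and>
     ((\<exists>\<sigma>>0. distributed M lborel X (normal_density 0 \<sigma>)) \<or> (AE \<omega> in M. X \<omega> = 0))"

definition frac_noise ::
  "'w measure \<Rightarrow> real \<Rightarrow> real^'d \<Rightarrow> (real \<Rightarrow> real^'d \<Rightarrow> 'w \<Rightarrow> real) \<Rightarrow> bool" where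
  "frac_noise M H0 H W \<longleftrightarrow> prob_space M \<and>
     (\<forall>t x. 0 \<le> t \<longrightarrow> W t x \<in> borel_measurable M) \<and>
     (\<forall>ps :: (real \<times> (real^'d) \<times> real) list.
        (\<forall>(t, x, c) \<in> set ps. 0 \<le> t) \<longrightarrow>
        gaussian_rv M (\<lambda>\<omega>. sum_list (map (\<lambda>(t, x, c). c * W t x \<omega>) ps))) \<and>
     (\<forall>t s x y. 0 \<le> t \<longrightarrow> 0 \<le> s \<longrightarrow>
        (\<integral>\<omega>. W t x \<omega> * W s y \<omega> \<partial>M) =
          Rcov H0 t s * (\<Prod>i\<in>UNIV. Rcov (H$i) (x$i) (y$i)))"

definition rect_ind :: "real \<Rightarrow> real \<Rightarrow> real^'d \<Rightarrow> real^'d \<Rightarrow> (real \<times> (real^'d)) \<Rightarrow> real" where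
  "rect_ind a b lo hi = (\<lambda>(s, y).
     if a < s \<and> s \<le> b \<and> (\<forall>i. lo$i < y$i \<and> y$i \<le> hi$i) then 1 else 0)"

definition rect_incr ::
  "(real \<Rightarrow> real^'d \<Rightarrow> 'w \<Rightarrow> real) \<Rightarrow> real \<Rightarrow> real \<Rightarrow> real^'d \<Rightarrow> real^'d \<Rightarrow> 'w \<Rightarrow> real" where
  "rect_incr W a b lo hi \<omega> =
     (\<Sum>S\<in>Pow (UNIV :: 'd set). (-1) ^ card (UNIV - S) *
        (W b (\<chi> i. if i \<in> S then hi$i else lo$i) \<omega> - W a (\<chi> i. if i \<in> S then hi$i else lo$i) \<omega>))"

type_synonym 'd elem = "(real \<times> real \<times> real \<times> (real^'d) \<times> (real^'d)) list"

definition valid_elem :: "('d::finite) elem \<Rightarrow> bool" where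
  "valid_elem E \<longleftrightarrow> (\<forall>(c, a, b, lo, hi) \<in> set E. 0 \<le> a \<and> a \<le> b \<and> (\<forall>i. lo$i \<le> hi$i))"

definition elem_fun :: "('d::finite) elem \<Rightarrow> (real \<times> (real^'d)) \<Rightarrow> real" where
  "elem_fun E z = sum_list (map (\<lambda>(c, a, b, lo, hi). c * rect_ind a b lo hi z) E)"

definition elem_int :: "(real \<Rightarrow> real^'d \<Rightarrow> 'w \<Rightarrow> real) \<Rightarrow> ('d::finite) elem \<Rightarrow> 'w \<Rightarrow> real" where
  "elem_int W E \<omega> = sum_list (map (\<lambda>(c, a, b, lo, hi). c * rect_incr W a b lo hi \<omega>) E)"

text \<open>X is the Wiener integral of the deterministic integrand f with respect to W:
  X is the L^2(M)-limit of the integrals of elementary integrands converging to f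
  (in L^1(dt dx), which makes the extension well defined).\<close>
definition wiener_integral ::
  "'w measure \<Rightarrow> (real \<Rightarrow> real^'d \<Rightarrow> 'w \<Rightarrow> real) \<Rightarrow> ((real \<times> (real^'d)) \<Rightarrow> real) \<Rightarrow> ('w \<Rightarrow> real) \<Rightarrow> bool" where
  "wiener_integral M W f X \<longleftrightarrow> X \<in> borel_measurable M \<and> integrable M (\<lambda>\<omega>. (X \<omega>)^2) \<and>
     (\<exists>E :: nat \<Rightarrow> ('d::finite) elem. (\<forall>n. valid_elem (E n)) \<and>
        ((\<lambda>n. \<integral>\<^sup>+ z. ennreal \<bar>f z - elem_fun (E n) z\<bar> \<partial>lborel) \<longlonglongrightarrow> 0) \<and>
        ((\<lambda>n. \<integral>\<omega>. (X \<omega> - elem_int W (E n) \<omega>)^2 \<partial>M) \<longlonglongrightarrow> 0))"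

definition heat_kernel :: "real \<Rightarrow> real^'d \<Rightarrow> real" where
  "heat_kernel \<epsilon> x = (2*pi*\<epsilon>) powr (- real CARD('d) / 2) * exp (- (norm x ^ 2) / (2 * \<epsilon>))"

definition heat_kernel_ft :: "real \<Rightarrow> real^'d \<Rightarrow> real" where
  "heat_kernel_ft \<epsilon> \<xi> = (\<integral>y. heat_kernel \<epsilon> y * cos (y \<bullet> \<xi>) \<partial>lborel)"

text \<open>Fourier transform of the fundamental solution G_t of the wave operator.\<close>
definition wave_ft :: "real \<Rightarrow> real^'d \<Rightarrow> real" where
  "wave_ft t \<xi> = sin (t * norm \<xi>) / norm \<xi>"

text \<open>(G_t * p_eps)(x), defined by Fourier inversion of hat G_t * hat p_eps
  (the product is even in xi, so only the cosine part survives).\<close>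
definition moll_wave_kernel :: "real \<Rightarrow> real \<Rightarrow> real^'d \<Rightarrow> real" where
  "moll_wave_kernel \<epsilon> t x =
     (1 / (2*pi) ^ CARD('d)) * (\<integral>\<xi>. cos (x \<bullet> \<xi>) * wave_ft t \<xi> * heat_kernel_ft \<epsilon> \<xi> \<partial>lborel)"

definition wave_solvable :: "'w measure \<Rightarrow> (real \<Rightarrow> real^'d \<Rightarrow> 'w \<Rightarrow> real) \<Rightarrow> bool" where
  "wave_solvable M W \<longleftrightarrow>
     (\<forall>t\<ge>0. \<forall>x :: real^'d. \<exists>U :: real \<Rightarrow> 'w \<Rightarrow> real.
        (\<forall>\<epsilon>>0. wiener_integral M W
           (\<lambda>(s, y). if 0 \<le> s \<and> s \<le> t then moll_wave_kernel \<epsilon> (t - s) (x - y) else 0) (U \<epsilon>)) \<and>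
        (\<forall>\<delta>>0. \<exists>\<eta>>0. \<forall>\<epsilon>1 \<epsilon>2. 0 < \<epsilon>1 \<longrightarrow> \<epsilon>1 < \<eta> \<longrightarrow> 0 < \<epsilon>2 \<longrightarrow> \<epsilon>2 < \<eta> \<longrightarrow>
           (\<integral>\<omega>. (U \<epsilon>1 \<omega> - U \<epsilon>2 \<omega>)^2 \<partial>M) < \<delta>))"

end

theory Submission
  imports Defs "HOL-Complex_Analysis.Conformal_Mappings"
begin

text \<open>The isometry turns the noise into the spectral measure with density proportional to
  \<open>\<bar>\<tau>\<bar> powr (1 - 2 * H0) * (\<Prod>i\<in>UNIV. \<bar>\<xi> $ i\<bar> powr (1 - 2 * H $ i))\<close>, and the second moment of
  \<open>u\<^sub>\<epsilon> (t, x)\<close> into the integral of \<open>exp (- \<epsilon> * (norm \<xi>)\<^sup>2) * (norm (g (\<tau>, \<xi>)))\<^sup>2\<close> against it, where \<open>g\<close>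
  is the Fourier transform in time of \<open>sin ((t - s) * norm \<xi>) / norm \<xi>\<close> on \<open>{0..t}\<close>. By
  dominated convergence and Fatou, solvability amounts to integrability of \<open>(norm g)\<^sup>2\<close>. Integrating
  over \<open>\<tau>\<close> first, the resonance at \<open>\<tau> = \<plusminus> norm \<xi>\<close> gives the exact order \<open>r powr (- 1 - 2 * H0)\<close> in
  \<open>r = norm \<xi>\<close> for \<open>H0 < 1\<close>, whereas for \<open>H0 = 1\<close> only \<open>\<tau> = 0\<close> is charged and the result is
  \<open>((1 - cos (t * r)) / r\<^sup>2)\<^sup>2\<close>. The spatial spectral measure is homogeneous, hence its radial part is
  proportional to \<open>r powr (2 * d - 2 * \<bar>H\<bar> - 1)\<close>, and the thresholds are those of a one-dimensional power integral.

  That the Wiener integrals exist needs step functions converging to the mollified kernel both in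
  \<open>L\<^sup>1\<close> and in the spectral norm. The kernel is a superposition of complex Gaussians, which are
  products over the coordinates; in one coordinate, summation by parts bounds the Fourier transform
  of a sampled function of bounded variation by \<open>1 / \<bar>\<xi>\<bar>\<close> uniformly in the mesh, and the product of these
  bounds is square integrable for the spectral measure.\<close>

section \<open>Spectral representation of the covariances\<close>

text \<open>Grid cells and the spectral density factor over the coordinates, whereas the symbol
  \<open>sin (\<sigma> * r) / r\<close> is radial and does not. Gaussians are radial and factor at
  the same time; this is why the kernel is rewritten as a mixture of them, and the circle of complex
  parameters lets the sine series be produced term by term. The two directions use the definition of
  the Wiener integral differently. For necessity the integrals come with arbitrary approximating
  sequences; L1 convergence gives only pointwise convergence of the transforms, so Fatou's lemma
  yields a one-sided bound. For sufficiency the integrals may be chosen along grid approximations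
  that share an envelope, and dominated convergence applies. The envelope is the product of the
  factors 1 / (1 + \<tau>^2) and 1 / (1 + \<xi>_i^2), integrable for all admissible Hurst parameters
  at once. Necessity is tested only at t = 1, x = 0 and at high frequencies. Low frequencies always
  carry finite energy, because the integrand mollified at \<epsilon> = 1 already obeys the envelope
  and its mollifier is bounded below there.\<close>

lemma borel_measurable_cnj [measurable (raw)]:
  "f \<in> borel_measurable M \<Longrightarrow> (\<lambda>x. cnj (f x)) \<in> borel_measurable M"
  using measurable_compose[of f M borel cnj borel]
  by (simp add: borel_measurable_continuous_onI continuous_on_cnj)

lemma one_minus_cos_le: "1 - cos x \<le> x\<^sup>2 / 2" for x :: real
proof -
  have "1 - cos x = 2 * (sin (x/2))\<^sup>2"
    using cos_double_sin[of "x/2"] by simp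
  also have "\<dots> \<le> 2 * (x/2)\<^sup>2"
    using abs_sin_x_le_abs_x[of "x/2"] by (intro mult_left_mono) (auto simp flip: abs_le_square_iff)
  finally show ?thesis by (simp add: power2_eq_square)
qed

lemma norm_cis_diff_le: "norm (cis u - cis v) \<le> \<bar>u - v\<bar>"
proof -
  have "(norm (cis u - cis v))\<^sup>2 = 2 * (1 - cos (u - v))"
    using sin_cos_squared_add[of u] sin_cos_squared_add[of v]
    by (simp add: cmod_power2 cos_diff) (simp add: power2_eq_square algebra_simps)
  also have "\<dots> \<le> (u - v)\<^sup>2" using one_minus_cos_le[of "u - v"] by simp
  finally show ?thesis by (metis abs_ge_zero abs_le_square_iff abs_norm_cancel)
qed

text \<open>The Fourier transform of the indicator of \<open>{a<..b}\<close>; at \<open>\<tau> = 0\<close> the quotient would be the junk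
  value 0.\<close>
definition interval_ft :: "real \<Rightarrow> real \<Rightarrow> real \<Rightarrow> complex" where
  "interval_ft a b \<tau> =
     (if \<tau> = 0 then of_real (b - a) else (cis (\<tau> * b) - cis (\<tau> * a)) / (\<i> * of_real \<tau>))"

lemma interval_ft_measurable [measurable]: "interval_ft a b \<in> borel_measurable borel"
  unfolding interval_ft_def cis_conv_exp by measurable

lemma interval_ft_diff: "interval_ft a b \<tau> = interval_ft 0 b \<tau> - interval_ft 0 a \<tau>"
  by (auto simp: interval_ft_def diff_divide_distrib)

lemma interval_ft_uminus: "interval_ft a b (-\<tau>) = cnj (interval_ft a b \<tau>)"
  by (auto simp: interval_ft_def cis_cnj field_simps)

lemma norm_interval_ft_le_length: "norm (interval_ft a b \<tau>) \<le> \<bar>b - a\<bar>"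
proof (cases "\<tau> = 0")
  case False
  have "norm (cis (\<tau> * b) - cis (\<tau> * a)) \<le> \<bar>\<tau>\<bar> * \<bar>b - a\<bar>"
    using norm_cis_diff_le[of "\<tau>*b" "\<tau>*a"] by (simp add: abs_mult right_diff_distrib [symmetric])
  with False show ?thesis by (simp add: interval_ft_def norm_divide norm_mult field_simps)
qed (simp add: interval_ft_def flip: of_real_diff)

lemma norm_interval_ft_le_inverse: "norm (interval_ft a b \<tau>) * \<bar>\<tau>\<bar> \<le> 2"
proof (cases "\<tau> = 0")
  case False
  have "norm (cis (\<tau> * b) - cis (\<tau> * a)) \<le> 2"
    using norm_triangle_ineq4[of "cis (\<tau> * b)" "cis (\<tau> * a)"] by simp
  with False show ?thesis by (simp add: interval_ft_def norm_divide norm_mult)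
qed simp

text \<open>The length bound handles small \<tau> and the 1 / |\<tau>| bound large \<tau>. Squared
  and added they give the weight 1 / (1 + \<tau>^2), which is the common dominating function of the
  whole proof.\<close>

lemma norm_sq_interval_ft_le: "(norm (interval_ft a b \<tau>))\<^sup>2 \<le> ((b - a)\<^sup>2 + 4) / (1 + \<tau>\<^sup>2)"
proof -
  have 1: "(norm (interval_ft a b \<tau>))\<^sup>2 \<le> (b - a)\<^sup>2"
    using norm_interval_ft_le_length[of a b \<tau>] by (metis abs_le_square_iff abs_norm_cancel)
  have "(norm (interval_ft a b \<tau>) * \<bar>\<tau>\<bar>)\<^sup>2 \<le> 2\<^sup>2"
    using norm_interval_ft_le_inverse[of a b \<tau>] by (intro power_mono) auto
  hence "(norm (interval_ft a b \<tau>))\<^sup>2 * (1 + \<tau>\<^sup>2) \<le> (b - a)\<^sup>2 + 4"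
    using 1 by (simp add: power_mult_distrib algebra_simps)
  thus ?thesis by (simp add: field_simps add_pos_nonneg)
qed

lemma has_bochner_integral_interval_ft:
  assumes "a \<le> b"
  shows "has_bochner_integral lborel (\<lambda>s. indicator {a<..b} s *\<^sub>R cis (\<tau> * s)) (interval_ft a b \<tau>)"
proof -
  have "has_bochner_integral lborel (\<lambda>s. indicator {a..b} s *\<^sub>R cis (\<tau> * s)) (interval_ft a b \<tau>)"
  proof (cases "\<tau> = 0")
    case True
    have "has_bochner_integral lborel (\<lambda>s. indicator {a..b} s *\<^sub>R (1::complex)) (of_real b - of_real a)"
      by (rule has_bochner_integral_FTC_Icc)
         (use assms in \<open>auto intro!: derivative_eq_intros has_vector_derivative_of_real\<close>)
    thus ?thesis using True by (simp add: interval_ft_def)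
  next
    case False
    have "has_bochner_integral lborel (\<lambda>s. indicator {a..b} s *\<^sub>R cis (\<tau> * s))
      (cis (\<tau> * b) / (\<i> * of_real \<tau>) - cis (\<tau> * a) / (\<i> * of_real \<tau>))"
    proof (rule has_bochner_integral_FTC_Icc[OF assms])
      show "((\<lambda>s. cis (\<tau> * s) / (\<i> * of_real \<tau>)) has_vector_derivative cis (\<tau> * s)) (at s within {a..b})" for s
        unfolding cis_conv_exp using False
        by (auto intro!: derivative_eq_intros has_vector_derivative_real_field simp: field_simps)
      show "continuous_on {a..b} (\<lambda>s. cis (\<tau> * s))"
        unfolding cis_conv_exp by (intro continuous_intros)
    qed
    thus ?thesis using False by (simp add: interval_ft_def diff_divide_distrib)
  qed
  thus ?thesis
  \<comment> \<open>The fundamental theorem works on the closed interval, while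
    \<open>rect_ind\<close> is half-open; the endpoint a is a null set.\<close>
  proof (rule has_bochner_integralI_AE)
    show "AE s in lborel. indicator {a..b} s *\<^sub>R cis (\<tau> * s) = indicator {a<..b} s *\<^sub>R cis (\<tau> * s)"
      using AE_lborel_singleton[of a] by eventually_elim (auto simp: indicator_def)
  qed (auto simp: cis_conv_exp)
qed

text \<open>Compare with u powr p near 0, which needs p > -1, and with u powr (p - 2) at infinity,
  which needs p < 1. For p = 1 - 2 * a these two conditions are a < 1 and a > 0.\<close>

lemma integrable_powr_over_square:
  assumes p: "-1 < p" "p < 1"
  shows "integrable lborel (\<lambda>u::real. \<bar>u\<bar> powr p / (1 + u\<^sup>2))"
proof -
  have bd: "set_integrable lborel {0..} (\<lambda>u::real. \<bar>u\<bar> powr p / (1 + u\<^sup>2))"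
  proof -
    have "(\<lambda>x::real. x powr p) integrable_on {0..1}"
      using p by (intro integrable_on_powr_from_0) auto
    hence "(\<lambda>x::real. x powr p) absolutely_integrable_on {0..1}"
      by (rule nonnegative_absolutely_integrable_1) auto
    hence 1: "set_integrable lborel {0..1} (\<lambda>x::real. x powr p)"
      unfolding set_integrable_def by (subst (asm) integrable_completion) auto
    have "(\<lambda>x::real. x powr (p-2)) integrable_on {1..}"
      using has_integral_powr_to_inf[of "p-2" 1] p by (auto simp: integrable_on_def)
    hence "(\<lambda>x::real. x powr (p-2)) absolutely_integrable_on {1..}"
      by (rule nonnegative_absolutely_integrable_1) auto
    hence 2: "set_integrable lborel {1..} (\<lambda>x::real. x powr (p-2))"
      unfolding set_integrable_def by (subst (asm) integrable_completion) auto
    have 3: "set_integrable lborel {0..1} (\<lambda>u::real. \<bar>u\<bar> powr p / (1 + u\<^sup>2))"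
      using 1 unfolding set_integrable_def
    proof (rule Bochner_Integration.integrable_bound)
      have "x powr p / (1 + x\<^sup>2) \<le> x powr p / 1" for x :: real
        by (intro divide_left_mono) (auto simp: add_pos_nonneg)
      thus "AE x in lborel. norm (indicat_real {0..1} x *\<^sub>R (\<bar>x\<bar> powr p / (1 + x\<^sup>2)))
         \<le> norm (indicat_real {0..1} x *\<^sub>R x powr p)"
        by (auto simp: indicator_def)
    qed auto
    have 4: "set_integrable lborel {1..} (\<lambda>u::real. \<bar>u\<bar> powr p / (1 + u\<^sup>2))"
      using 2 unfolding set_integrable_def
    proof (rule Bochner_Integration.integrable_bound)
      show "AE x in lborel. norm (indicat_real {1..} x *\<^sub>R (\<bar>x\<bar> powr p / (1 + x\<^sup>2)))
         \<le> norm (indicat_real {1..} x *\<^sub>R x powr (p - 2))"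
      proof (intro AE_I2)
        fix x :: real
        have "x powr p / (1 + x\<^sup>2) \<le> x powr p / x\<^sup>2" if "x \<ge> 1"
          using that by (intro divide_left_mono) (auto intro!: mult_pos_pos add_pos_nonneg)
        hence "x powr p / (1 + x\<^sup>2) \<le> x powr (p - 2)" if "x \<ge> 1"
          using that by (simp add: powr_diff powr_numeral)
        moreover have "0 \<le> x powr p / (1 + x\<^sup>2)" by simp
        ultimately show "norm (indicat_real {1..} x *\<^sub>R (\<bar>x\<bar> powr p / (1 + x\<^sup>2)))
         \<le> norm (indicat_real {1..} x *\<^sub>R x powr (p - 2))"
          by (auto simp: indicator_def abs_mult)
      qed
    qed auto
    have "{0..} = {0..1} \<union> {1::real..}" by auto
    thus ?thesis using set_integrable_Un[OF 3 4] by simp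
  qed
  \<comment> \<open>The function is even, so reflecting u to -u carries the result to the negative
    half-line.\<close>
  hence "integrable lborel (\<lambda>x. indicat_real {0..} (0 + (-1) * x) *\<^sub>R (\<bar>0 + (-1) * x\<bar> powr p / (1 + (0 + (-1) * x)\<^sup>2)))"
    unfolding set_integrable_def by (intro lborel_integrable_real_affine) auto
  hence bd': "set_integrable lborel {..0} (\<lambda>u::real. \<bar>u\<bar> powr p / (1 + u\<^sup>2))"
    unfolding set_integrable_def
    by (rule Bochner_Integration.integrable_cong[THEN iffD1, rotated -1]) (auto simp: indicator_def)
  have "set_integrable lborel ({..0} \<union> {0..}) (\<lambda>u::real. \<bar>u\<bar> powr p / (1 + u\<^sup>2))"
    by (rule set_integrable_Un[OF bd' bd]) auto
  moreover have "{..0} \<union> {0..} = (UNIV :: real set)" by auto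
  ultimately show ?thesis by (simp add: set_integrable_def)
qed


text \<open>The value at x = 1 of the integral in \<open>spec_const_scale\<close>; dividing by it
  represents |x| powr (2 * a) as an integral of 1 - cos (\<tau> * x).\<close>

definition spec_const :: "real \<Rightarrow> real" where
  "spec_const a = (\<integral>u. (1 - cos u) * \<bar>u\<bar> powr (-1 - 2*a) \<partial>lborel)"

lemma integrable_spec_const:
  assumes a: "0 < a" "a < 1"
  shows "integrable lborel (\<lambda>u::real. (1 - cos u) * \<bar>u\<bar> powr (-1 - 2*a))"
proof (rule Bochner_Integration.integrable_bound)
  \<comment> \<open>The factor 5 is generous: (1 - cos u) * (1 + u^2) is at most u^2 / 2 + 2 *
    u^2.\<close>
  show "integrable lborel (\<lambda>u::real. 5 * (\<bar>u\<bar> powr (1 - 2*a) / (1 + u\<^sup>2)))"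
    using a by (intro integrable_mult_right integrable_powr_over_square) auto
  show "AE u in lborel. norm ((1 - cos u) * \<bar>u\<bar> powr (-1 - 2*a)) \<le> norm (5 * (\<bar>u\<bar> powr (1 - 2*a) / (1 + u\<^sup>2)))"
  proof (intro AE_I2)
    fix u :: real
    show "norm ((1 - cos u) * \<bar>u\<bar> powr (-1 - 2*a)) \<le> norm (5 * (\<bar>u\<bar> powr (1 - 2*a) / (1 + u\<^sup>2)))"
    proof (cases "u = 0")
      case False
      have "(1 - cos u) * (1 + u\<^sup>2) \<le> 5 * u\<^sup>2"
        using one_minus_cos_le[of u] mult_right_mono[of "1 - cos u" 2 "u\<^sup>2"] cos_ge_minus_one[of u] zero_le_power2[of u]
        unfolding distrib_left left_diff_distrib right_diff_distrib by linarith
      hence "(1 - cos u) / u\<^sup>2 \<le> 5 / (1 + u\<^sup>2)"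
        using False by (simp add: divide_simps add_pos_nonneg)
      hence "(1 - cos u) / u\<^sup>2 * \<bar>u\<bar> powr (1 - 2*a) \<le> 5 / (1 + u\<^sup>2) * \<bar>u\<bar> powr (1 - 2*a)"
        by (intro mult_right_mono) auto
      moreover have "\<bar>u\<bar> powr (-1 - 2*a) = \<bar>u\<bar> powr (1 - 2*a) / u\<^sup>2"
        using False powr_diff[of "\<bar>u\<bar>" "1 - 2*a" 2] by (simp add: powr_numeral)
      ultimately show ?thesis by (simp add: abs_mult)
    qed simp
  qed
qed auto

lemma spec_const_pos:
  assumes a: "0 < a" "a < 1"
  shows "spec_const a > 0"
proof -
  \<comment> \<open>A lower bound for the integrand on {1..2}: there 1 - cos u is increasing, since
    2 < pi, and the power is decreasing.\<close>
  let ?c = "(1 - cos 1) * 2 powr (-1 - 2*a)"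
  have "cos 1 < cos (0::real)" using pi_gt3 by (intro cos_monotone_0_pi) auto
  hence c: "?c > 0" by simp
  have "(\<integral>u. indicator {1..2::real} u *\<^sub>R ?c \<partial>lborel) \<le> spec_const a"
    unfolding spec_const_def
  proof (rule integral_mono[OF _ integrable_spec_const[OF a]])
    fix u :: real
    have "?c \<le> (1 - cos u) * u powr (-1 - 2*a)" if "1 \<le> u" "u \<le> 2"
      using that pi_gt3 a by (intro mult_mono powr_mono2' diff_mono cos_monotone_0_pi_le) auto
    thus "indicator {1..2::real} u *\<^sub>R ?c \<le> (1 - cos u) * \<bar>u\<bar> powr (-1 - 2*a)"
      by (auto simp: indicator_def)
  qed auto
  thus ?thesis using c by simp
qed

text \<open>The substitution u = x * \<tau> reduces to \<open>spec_const\<close>, by homogeneity of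
  the power. \<open>Rcov\<close> is the polarisation of |x| powr (2 * a), so this formula becomes
  the spectral representation of the covariance.\<close>

lemma spec_const_scale:
  assumes a: "0 < a" "a < 1"
  shows "has_bochner_integral lborel (\<lambda>\<tau>. (1 - cos (\<tau> * x)) * \<bar>\<tau>\<bar> powr (-1 - 2*a))
           (spec_const a * \<bar>x\<bar> powr (2*a))"
proof (cases "x = 0")
  case False
  let ?f = "\<lambda>u::real. (1 - cos u) * \<bar>u\<bar> powr (-1 - 2*a)"
  have "has_bochner_integral lborel (\<lambda>\<tau>. ?f (0 + x * \<tau>)) (spec_const a /\<^sub>R \<bar>x\<bar>)"
    unfolding spec_const_def
    by (intro lborel_has_bochner_integral_real_affine_iff[THEN iffD1, OF False]
        has_bochner_integral_integrable integrable_spec_const a)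
  hence "has_bochner_integral lborel (\<lambda>\<tau>. \<bar>x\<bar> powr (1 + 2*a) * ?f (0 + x * \<tau>))
      (\<bar>x\<bar> powr (1 + 2*a) * (spec_const a /\<^sub>R \<bar>x\<bar>))"
    by (rule has_bochner_integral_mult_right)
  moreover have "\<bar>x\<bar> powr (1 + 2*a) * (spec_const a /\<^sub>R \<bar>x\<bar>) = spec_const a * \<bar>x\<bar> powr (2*a)"
    using False by (simp add: powr_add field_simps)
  moreover have "(\<lambda>\<tau>. \<bar>x\<bar> powr (1 + 2*a) * ?f (0 + x * \<tau>)) = (\<lambda>\<tau>. (1 - cos (\<tau> * x)) * \<bar>\<tau>\<bar> powr (-1 - 2*a))"
  proof (intro ext)
    fix \<tau> :: real
    have "\<bar>x\<bar> powr (1 + 2*a) * \<bar>x\<bar> powr (-1 - 2*a) = 1"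
      using False by (simp flip: powr_add)
    thus "\<bar>x\<bar> powr (1 + 2*a) * ?f (0 + x * \<tau>) = (1 - cos (\<tau> * x)) * \<bar>\<tau>\<bar> powr (-1 - 2*a)"
      by (simp add: abs_mult powr_mult mult_ac)
  qed
  ultimately show ?thesis by (simp only:)
next
  case True
  thus ?thesis using has_bochner_integral_zero[of lborel] by simp
qed

lemma integrable_return:
  fixes f :: "'a \<Rightarrow> 'b::{banach, second_countable_topology}"
  assumes "x \<in> space M" "f \<in> borel_measurable M"
  shows "integrable (return M x) f"
  using assms by (simp add: integrable_iff_bounded nn_integral_return)

text \<open>Since \<open>Rcov 1 x y = x * y\<close>, the spectral measure degenerates to a unit mass at frequency 0.\<close>
definition spec :: "real \<Rightarrow> real measure" where
  "spec a = (if a = 1 then return borel 0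
     else density lborel (\<lambda>\<tau>. ennreal (\<bar>\<tau>\<bar> powr (1 - 2*a) / (2 * spec_const a))))"

lemma sets_spec [measurable_cong, simp]: "sets (spec a) = sets borel"
  and space_spec [simp]: "space (spec a) = UNIV"
  by (auto simp: spec_def)

lemma sigma_finite_spec [simp]: "sigma_finite_measure (spec a)"
proof (cases "a = 1")
  case True
  then interpret prob_space "spec a" by (simp add: spec_def prob_space_return)
  show ?thesis by unfold_locales
next
  case False
  thus ?thesis unfolding spec_def by (simp add: sigma_finite_measure.sigma_finite_iff_density_finite[OF sigma_finite_lborel])
qed

lemma integrable_spec_over_square:
  assumes a: "0 < a" "a \<le> 1"
  shows "integrable (spec a) (\<lambda>\<tau>. 1 / (1 + \<tau>\<^sup>2))"
proof (cases "a = 1")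
  case True thus ?thesis by (simp add: spec_def integrable_return)
next
  case False
  hence a': "0 < a" "a < 1" using a by auto
  have "integrable lborel (\<lambda>\<tau>::real. \<bar>\<tau>\<bar> powr (1 - 2*a) / (1 + \<tau>\<^sup>2) / (2 * spec_const a))"
    using a' by (intro integrable_divide integrable_powr_over_square) auto
  thus ?thesis using spec_const_pos[OF a'] False unfolding spec_def
    by (subst if_not_P, simp, subst integrable_density) (auto simp: field_simps)
qed

text \<open>For a < 1 the integrand is (cis (\<tau> x) - 1) * cnj (cis (\<tau> y) - 1) / \<tau>^2.
  Its real part has numerator (1 - cos \<tau>x) + (1 - cos \<tau>y) - (1 - cos \<tau>(x - y)), and
  three applications of \<open>spec_const_scale\<close> give \<open>Rcov\<close>. For a = 1 only
  \<tau> = 0 is charged, where the transforms are the lengths x and y.\<close>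

lemma has_bochner_integral_spec:
  assumes a: "0 < a" "a \<le> 1"
  shows "has_bochner_integral (spec a) (\<lambda>\<tau>. interval_ft 0 x \<tau> * cnj (interval_ft 0 y \<tau>)) (of_real (Rcov a x y))"
proof (cases "a = 1")
  case True
  have "Rcov 1 x y = x * y"
    by (simp add: Rcov_def powr_numeral power2_eq_square algebra_simps)
  moreover have "interval_ft 0 z 0 = of_real z" for z by (simp add: interval_ft_def)
  moreover have "(\<lambda>\<tau>. interval_ft 0 x \<tau> * cnj (interval_ft 0 y \<tau>)) \<in> borel_measurable borel"
    by measurable
  ultimately show ?thesis using True
    by (intro has_bochner_integral_iff[THEN iffD2] conjI)
       (auto simp: spec_def intro!: integrable_return, subst integral_return, auto)
next
  case False
  hence a': "0 < a" "a < 1" using a by auto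
  let ?w = "\<lambda>\<tau>::real. \<bar>\<tau>\<bar> powr (1 - 2*a) / (2 * spec_const a)"
  let ?h = "\<lambda>\<tau>. interval_ft 0 x \<tau> * cnj (interval_ft 0 y \<tau>)"
  have int: "integrable (spec a) ?h"
  proof (rule Bochner_Integration.integrable_bound)
    show "integrable (spec a) (\<lambda>\<tau>. (x\<^sup>2 + y\<^sup>2 + 8) * (1 / (1 + \<tau>\<^sup>2)))"
      by (intro integrable_mult_right integrable_spec_over_square a)
    show "AE \<tau> in spec a. norm (?h \<tau>) \<le> norm ((x\<^sup>2 + y\<^sup>2 + 8) * (1 / (1 + \<tau>\<^sup>2)))"
    proof (intro AE_I2)
      fix \<tau> :: real
      have "norm (?h \<tau>) \<le> (norm (interval_ft 0 x \<tau>))\<^sup>2 + (norm (interval_ft 0 y \<tau>))\<^sup>2"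
        using sum_squares_bound[of "norm (interval_ft 0 x \<tau>)" "norm (interval_ft 0 y \<tau>)"]
          mult_nonneg_nonneg[OF norm_ge_zero norm_ge_zero, of "interval_ft 0 x \<tau>" "interval_ft 0 y \<tau>"]
        unfolding norm_mult complex_mod_cnj by linarith
      also have "\<dots> \<le> (x\<^sup>2 + 4) / (1 + \<tau>\<^sup>2) + (y\<^sup>2 + 4) / (1 + \<tau>\<^sup>2)"
        using norm_sq_interval_ft_le[of 0 x \<tau>] norm_sq_interval_ft_le[of 0 y \<tau>] by simp
      also have "\<dots> = (x\<^sup>2 + y\<^sup>2 + 8) * (1 / (1 + \<tau>\<^sup>2))" by (simp flip: add_divide_distrib)
      finally show "norm (?h \<tau>) \<le> norm ((x\<^sup>2 + y\<^sup>2 + 8) * (1 / (1 + \<tau>\<^sup>2)))" by simp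
    qed
  qed simp
  hence intd: "integrable lborel (\<lambda>\<tau>. ?w \<tau> *\<^sub>R ?h \<tau>)"
    using spec_const_pos[OF a'] False unfolding spec_def by (subst (asm) if_not_P, simp, subst (asm) integrable_density) auto
  have eqd: "integral\<^sup>L (spec a) ?h = (\<integral>\<tau>. ?w \<tau> *\<^sub>R ?h \<tau> \<partial>lborel)"
    using spec_const_pos[OF a'] False unfolding spec_def by (subst if_not_P, simp, subst integral_density) auto
  \<comment> \<open>Reflecting \<tau> conjugates the integrand, so the integral is real and only the
    real part has to be computed.\<close>
  have "(\<integral>\<tau>. ?w \<tau> *\<^sub>R ?h \<tau> \<partial>lborel) = (\<integral>\<tau>. ?w (-\<tau>) *\<^sub>R ?h (-\<tau>) \<partial>lborel)"
    using lborel_integral_real_affine[of "-1" "\<lambda>\<tau>. ?w \<tau> *\<^sub>R ?h \<tau>" 0] by simp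
  also have "\<dots> = (\<integral>\<tau>. cnj (?w \<tau> *\<^sub>R ?h \<tau>) \<partial>lborel)"
    by (intro Bochner_Integration.integral_cong) (auto simp: interval_ft_uminus)
  also have "\<dots> = cnj (\<integral>\<tau>. ?w \<tau> *\<^sub>R ?h \<tau> \<partial>lborel)"
    by (rule Bochner_Integration.integral_cnj)
  finally have "(\<integral>\<tau>. ?w \<tau> *\<^sub>R ?h \<tau> \<partial>lborel) \<in> \<real>"
    unfolding Reals_cnj_iff by (rule sym)
  hence im: "integral\<^sup>L (spec a) ?h = of_real (\<integral>\<tau>. Re (?w \<tau> *\<^sub>R ?h \<tau>) \<partial>lborel)"
    unfolding integral_Re[OF intd] eqd by simp
  have "has_bochner_integral lborel (\<lambda>\<tau>. ((1 - cos (\<tau> * x)) * \<bar>\<tau>\<bar> powr (-1 - 2*a) +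
      (1 - cos (\<tau> * y)) * \<bar>\<tau>\<bar> powr (-1 - 2*a) - (1 - cos (\<tau> * (x - y))) * \<bar>\<tau>\<bar> powr (-1 - 2*a)) / (2 * spec_const a))
      ((spec_const a * \<bar>x\<bar> powr (2*a) + spec_const a * \<bar>y\<bar> powr (2*a) - spec_const a * \<bar>x - y\<bar> powr (2*a)) / (2 * spec_const a))"
    by (intro has_bochner_integral_divide_zero has_bochner_integral_add has_bochner_integral_diff spec_const_scale a')
  moreover have "(spec_const a * \<bar>x\<bar> powr (2*a) + spec_const a * \<bar>y\<bar> powr (2*a) - spec_const a * \<bar>x - y\<bar> powr (2*a)) / (2 * spec_const a)
     = Rcov a x y"
    using spec_const_pos[OF a'] by (simp add: Rcov_def field_simps)
  ultimately have R: "(\<integral>\<tau>. ((1 - cos (\<tau> * x)) * \<bar>\<tau>\<bar> powr (-1 - 2*a) +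
      (1 - cos (\<tau> * y)) * \<bar>\<tau>\<bar> powr (-1 - 2*a) - (1 - cos (\<tau> * (x - y))) * \<bar>\<tau>\<bar> powr (-1 - 2*a)) / (2 * spec_const a) \<partial>lborel) = Rcov a x y"
    by (simp add: has_bochner_integral_iff)
  have "(\<integral>\<tau>. Re (?w \<tau> *\<^sub>R ?h \<tau>) \<partial>lborel) = Rcov a x y"
    unfolding R[symmetric]
  proof (rule integral_cong_AE)
    show "AE \<tau> in lborel. Re (?w \<tau> *\<^sub>R ?h \<tau>) = ((1 - cos (\<tau> * x)) * \<bar>\<tau>\<bar> powr (-1 - 2*a) +
      (1 - cos (\<tau> * y)) * \<bar>\<tau>\<bar> powr (-1 - 2*a) - (1 - cos (\<tau> * (x - y))) * \<bar>\<tau>\<bar> powr (-1 - 2*a)) / (2 * spec_const a)"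
      using AE_lborel_singleton[of 0]
    proof eventually_elim
      fix \<tau> :: real assume \<tau>: "\<tau> \<noteq> 0"
      have w: "\<bar>\<tau>\<bar> powr (-1 - 2*a) = \<bar>\<tau>\<bar> powr (1 - 2*a) / \<tau>\<^sup>2"
        using \<tau> powr_diff[of "\<bar>\<tau>\<bar>" "1 - 2*a" 2] by (simp add: powr_numeral)
      have "?h \<tau> = (cis (\<tau> * x) - 1) * cnj (cis (\<tau> * y) - 1) / of_real (\<tau>\<^sup>2)"
        using \<tau> by (simp add: interval_ft_def power2_eq_square field_simps)
      also have "Re \<dots> = ((cos (\<tau> * x) - 1) * (cos (\<tau> * y) - 1) + sin (\<tau> * x) * sin (\<tau> * y)) / \<tau>\<^sup>2"
        by (simp only: Re_divide_of_real) simp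
      also have "(cos (\<tau> * x) - 1) * (cos (\<tau> * y) - 1) + sin (\<tau> * x) * sin (\<tau> * y)
        = (1 - cos (\<tau> * x)) + (1 - cos (\<tau> * y)) - (1 - cos (\<tau> * (x - y)))"
        by (simp add: right_diff_distrib cos_diff) (simp add: algebra_simps)
      finally show "Re (?w \<tau> *\<^sub>R ?h \<tau>) = ((1 - cos (\<tau> * x)) * \<bar>\<tau>\<bar> powr (-1 - 2*a) +
      (1 - cos (\<tau> * y)) * \<bar>\<tau>\<bar> powr (-1 - 2*a) - (1 - cos (\<tau> * (x - y))) * \<bar>\<tau>\<bar> powr (-1 - 2*a)) / (2 * spec_const a)"
        by (simp add: w) (simp add: divide_simps, simp add: algebra_simps)
    qed
  qed (auto)
  thus ?thesis using int im by (simp add: has_bochner_integral_iff)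
qed

section \<open>Integration of coordinatewise products over vectors\<close>

lemma prod_Basis_vec: "(\<Prod>b\<in>Basis. x \<bullet> b) = (\<Prod>i\<in>UNIV. (x :: real^'d) $ i)"
proof -
  have B: "(Basis :: (real^'d) set) = (\<lambda>i. axis i 1) ` UNIV"
    by (auto simp: Basis_vec_def)
  have "inj (\<lambda>i. axis i 1 :: real^'d)" by (auto simp: inj_on_def axis_eq_axis)
  thus ?thesis unfolding B by (subst prod.reindex) (auto simp: inner_axis)
qed

lemma measurable_vec_lambda_PiM [measurable]:
  "(\<lambda>f. \<chi> i. f i) \<in> (\<Pi>\<^sub>M i\<in>(UNIV::'d::finite set). (lborel :: real measure)) \<rightarrow>\<^sub>M (borel :: (real^'d) measure)"
  by (subst borel_measurable_euclidean_space) (auto simp: Basis_vec_def inner_axis)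

text \<open>Lebesgue measure is determined by boxes. The identification makes the product-measure
  theorems for families over a finite index set available on \<open>real^'d\<close>.\<close>

lemma lborel_vec_eq:
  "lborel = distr (\<Pi>\<^sub>M i\<in>(UNIV::'d::finite set). (lborel :: real measure)) (borel :: (real^'d) measure) (\<lambda>f. \<chi> i. f i)"
proof (rule lborel_eqI)
  interpret product_sigma_finite "\<lambda>_::'d. lborel :: real measure" ..
  fix l u :: "real^'d"
  assume le: "\<And>b. b \<in> Basis \<Longrightarrow> l \<bullet> b \<le> u \<bullet> b"
  hence le': "l $ i \<le> u $ i" for i using le[of "axis i 1"] by (simp add: inner_axis)
  have "(\<lambda>f. \<chi> i. f i) -` box l u \<inter> space (\<Pi>\<^sub>M i\<in>(UNIV::'d set). lborel) = (\<Pi>\<^sub>E i\<in>UNIV. {l $ i <..< u $ i})"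
    by (auto simp: mem_box_cart space_PiM PiE_iff)
  thus "emeasure (distr (\<Pi>\<^sub>M i\<in>(UNIV::'d set). lborel) borel (\<lambda>f. \<chi> i. f i)) (box l u) = (\<Prod>b\<in>Basis. (u - l) \<bullet> b)"
    using le' by (simp add: emeasure_distr emeasure_PiM prod_Basis_vec prod_ennreal)
qed simp

lemma measurable_vec_nth [measurable]: "(\<lambda>x::real^'d. x $ i) \<in> borel_measurable borel"
  by (intro borel_measurable_continuous_onI continuous_intros)

lemma nn_integral_vec_prod:
  fixes f :: "'d::finite \<Rightarrow> real \<Rightarrow> ennreal"
  assumes [measurable]: "\<And>i. f i \<in> borel_measurable borel"
  shows "(\<integral>\<^sup>+ y. (\<Prod>i\<in>UNIV. f i (y $ i)) \<partial>(lborel :: (real^'d) measure)) = (\<Prod>i\<in>UNIV. \<integral>\<^sup>+ u. f i u \<partial>lborel)"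
proof -
  interpret product_sigma_finite "\<lambda>_::'d. lborel :: real measure" ..
  show ?thesis by (subst lborel_vec_eq) (simp add: nn_integral_distr product_nn_integral_prod)
qed

lemma
  fixes f :: "'d::finite \<Rightarrow> real \<Rightarrow> 'b::{real_normed_field, banach, second_countable_topology}"
  assumes f: "\<And>i. integrable lborel (f i)"
  shows integrable_vec_prod: "integrable (lborel :: (real^'d) measure) (\<lambda>y. \<Prod>i\<in>UNIV. f i (y $ i))"
    and integral_vec_prod: "(\<integral>y. (\<Prod>i\<in>UNIV. f i (y $ i)) \<partial>(lborel :: (real^'d) measure)) = (\<Prod>i\<in>UNIV. \<integral>u. f i u \<partial>lborel)"
proof -
  interpret product_sigma_finite "\<lambda>_::'d. lborel :: real measure" ..
  have [measurable]: "f i \<in> borel_measurable borel" for i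
    using borel_measurable_integrable[OF f[of i]] by simp
  show "integrable (lborel :: (real^'d) measure) (\<lambda>y. \<Prod>i\<in>UNIV. f i (y $ i))"
    by (subst lborel_vec_eq) (simp add: integrable_distr_eq product_integrable_prod f)
  show "(\<integral>y. (\<Prod>i\<in>UNIV. f i (y $ i)) \<partial>(lborel :: (real^'d) measure)) = (\<Prod>i\<in>UNIV. \<integral>u. f i u \<partial>lborel)"
    by (subst lborel_vec_eq) (simp add: integral_distr product_integral_prod f)
qed

definition spec_density :: "real \<Rightarrow> real \<Rightarrow> real" where
  "spec_density a \<tau> = \<bar>\<tau>\<bar> powr (1 - 2*a) / (2 * spec_const a)"

lemma spec_density_measurable [measurable]: "spec_density a \<in> borel_measurable borel"
  unfolding spec_density_def by measurable

lemma spec_density_nonneg: "0 < a \<Longrightarrow> a < 1 \<Longrightarrow> spec_density a \<tau> \<ge> 0"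
  using spec_const_pos[of a] by (simp add: spec_density_def)

lemma spec_eq_density: "a \<noteq> 1 \<Longrightarrow> spec a = density lborel (\<lambda>\<tau>. ennreal (spec_density a \<tau>))"
  by (simp add: spec_def spec_density_def)

text \<open>Spatial Hurst parameters are used only strictly below 1, so no atoms occur and a density
  suffices; null sets of \<open>lborel\<close>, in particular the origin, are then null here as
  well.\<close>

definition space_spec :: "real^'d \<Rightarrow> (real^'d) measure" where
  "space_spec H = density lborel (\<lambda>\<xi>. \<Prod>i\<in>UNIV. ennreal (spec_density (H $ i) (\<xi> $ i)))"

lemma sets_space_spec [measurable_cong, simp]: "sets (space_spec H) = sets borel"
  and space_space_spec [simp]: "space (space_spec H) = UNIV"
  by (auto simp: space_spec_def)

lemma sigma_finite_space_spec [simp]: "sigma_finite_measure (space_spec H)"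
  unfolding space_spec_def
  by (subst sigma_finite_measure.sigma_finite_iff_density_finite[OF sigma_finite_lborel])
     (auto simp: ennreal_prod_eq_top)

lemma nn_integral_space_spec_prod:
  fixes f :: "'d::finite \<Rightarrow> real \<Rightarrow> ennreal" and H :: "real^'d"
  assumes H: "\<And>i. H $ i \<noteq> 1" and [measurable]: "\<And>i. f i \<in> borel_measurable borel"
  shows "(\<integral>\<^sup>+ \<xi>. (\<Prod>i\<in>UNIV. f i (\<xi> $ i)) \<partial>space_spec H) = (\<Prod>i\<in>UNIV. \<integral>\<^sup>+ u. f i u \<partial>spec (H $ i))"
  using H by (simp add: space_spec_def nn_integral_density spec_eq_density
      nn_integral_vec_prod[symmetric] prod.distrib)

lemma
  fixes f :: "'d::finite \<Rightarrow> real \<Rightarrow> 'b::{real_normed_field, banach, second_countable_topology}" and H :: "real^'d"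
  assumes H: "\<And>i. 0 < H $ i" "\<And>i. H $ i < 1" and f: "\<And>i. integrable (spec (H $ i)) (f i)"
  shows integrable_space_spec_prod: "integrable (space_spec H) (\<lambda>\<xi>. \<Prod>i\<in>UNIV. f i (\<xi> $ i))"
    and integral_space_spec_prod: "(\<integral>\<xi>. (\<Prod>i\<in>UNIV. f i (\<xi> $ i)) \<partial>space_spec H) = (\<Prod>i\<in>UNIV. \<integral>u. f i u \<partial>spec (H $ i))"
proof -
  have H1: "H $ i \<noteq> 1" for i using H(2)[of i] by simp
  have nn: "spec_density (H $ i) \<tau> \<ge> 0" for i \<tau> using spec_density_nonneg H by blast
  have [measurable]: "f i \<in> borel_measurable borel" for i
    using borel_measurable_integrable[OF f[of i]] by simp
  have f': "integrable lborel (\<lambda>u. spec_density (H $ i) u *\<^sub>R f i u)" for i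
    using f[of i] nn by (simp add: spec_eq_density H1 integrable_density)
  have eq: "(\<Prod>i\<in>UNIV. spec_density (H $ i) (\<xi> $ i)) *\<^sub>R (\<Prod>i\<in>UNIV. f i (\<xi> $ i))
      = (\<Prod>i\<in>UNIV. spec_density (H $ i) (\<xi> $ i) *\<^sub>R f i (\<xi> $ i))" for \<xi> :: "real^'d"
    by (simp add: scaleR_conv_of_real prod.distrib of_real_prod)
  have D: "space_spec H = density lborel (\<lambda>\<xi>. ennreal (\<Prod>i\<in>UNIV. spec_density (H $ i) (\<xi> $ i)))"
    unfolding space_spec_def by (simp add: prod_ennreal nn)
  have pn: "AE \<xi> in lborel. 0 \<le> (\<Prod>i\<in>UNIV. spec_density (H $ i) ((\<xi>::real^'d) $ i))"
    by (simp add: prod_nonneg nn)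
  show "integrable (space_spec H) (\<lambda>\<xi>. \<Prod>i\<in>UNIV. f i (\<xi> $ i))"
    unfolding D by (subst integrable_density) (use pn in \<open>auto simp: eq intro!: integrable_vec_prod f'\<close>)
  show "(\<integral>\<xi>. (\<Prod>i\<in>UNIV. f i (\<xi> $ i)) \<partial>space_spec H) = (\<Prod>i\<in>UNIV. \<integral>u. f i u \<partial>spec (H $ i))"
    unfolding D using pn nn H1
    by (subst integral_density) (auto simp: eq integral_vec_prod[OF f'] spec_eq_density integral_density)
qed

lemma integrable_pair_times:
  fixes f :: "'b \<Rightarrow> 'c::{real_normed_field, banach, second_countable_topology}"
    and g :: "'a \<Rightarrow> 'c"
  assumes M: "pair_sigma_finite M1 M2" and g: "integrable M1 g" and f: "integrable M2 f"
  shows "integrable (M1 \<Otimes>\<^sub>M M2) (\<lambda>(x, y). g x * f y)"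
proof (rule pair_sigma_finite.Fubini_integrable[OF M])
  interpret pair_sigma_finite M1 M2 by fact
  note [measurable] = borel_measurable_integrable[OF f] borel_measurable_integrable[OF g]
  show "(\<lambda>(x, y). g x * f y) \<in> borel_measurable (M1 \<Otimes>\<^sub>M M2)" by measurable
  show "integrable M1 (\<lambda>x. \<integral>y. norm (case (x, y) of (x, y) \<Rightarrow> g x * f y) \<partial>M2)"
    using g by (simp add: norm_mult integrable_norm)
  show "AE x in M1. integrable M2 (\<lambda>y. case (x, y) of (x, y) \<Rightarrow> g x * f y)"
    using f by simp
qed

section \<open>The space-time spectral measure\<close>

definition noise_spec :: "real \<Rightarrow> real^'d \<Rightarrow> (real \<times> (real^'d)) measure" where
  "noise_spec H0 H = spec H0 \<Otimes>\<^sub>M space_spec H"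

lemma sets_noise_spec [measurable_cong, simp]: "sets (noise_spec H0 H) = sets borel"
  unfolding noise_spec_def borel_prod[symmetric] by (rule sets_pair_measure_cong) auto

lemma nn_integral_noise_spec:
  assumes [measurable]: "f \<in> borel_measurable borel"
  shows "(\<integral>\<^sup>+ z. f z \<partial>noise_spec H0 H) = (\<integral>\<^sup>+ \<xi>. \<integral>\<^sup>+ \<tau>. f (\<tau>, \<xi>) \<partial>spec H0 \<partial>space_spec H)"
proof -
  interpret pair_sigma_finite "spec H0" "space_spec H" unfolding pair_sigma_finite_def by simp
  have "f \<in> borel_measurable (spec H0 \<Otimes>\<^sub>M space_spec H)"
    using assms sets_noise_spec[of H0 H] unfolding noise_spec_def by (simp cong: measurable_cong_sets)
  thus ?thesis unfolding noise_spec_def by (simp add: nn_integral_snd[symmetric] case_prod_beta')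
qed

text \<open>The universal envelope: up to a constant it bounds the squared transform of every grid
  approximation, uniformly in the mesh, and it is integrable for all Hurst parameters in the range
  considered.\<close>

definition noise_env :: "real \<times> (real^'d) \<Rightarrow> real" where
  "noise_env = (\<lambda>(\<tau>, \<xi>). 1 / (1 + \<tau>\<^sup>2) * (\<Prod>i\<in>UNIV. 1 / (1 + (\<xi> $ i)\<^sup>2)))"

text \<open>The spectral image of the field value \<open>W t x\<close>. Coordinates may be negative:
  \<open>interval_ft 0 u\<close> with u < 0 is minus the transform of the interval from u to 0, in
  accordance with the signs of \<open>Rcov\<close>.\<close>

definition point_ft :: "real \<Rightarrow> real^'d \<Rightarrow> real \<times> (real^'d) \<Rightarrow> complex" where
  "point_ft t x = (\<lambda>(\<tau>, \<xi>). interval_ft 0 t \<tau> * (\<Prod>i\<in>UNIV. interval_ft 0 (x $ i) (\<xi> $ i)))"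

lemma has_bochner_integral_noise_spec_prod:
  fixes f :: "'d::finite \<Rightarrow> real \<Rightarrow> 'b::{real_normed_field, banach, second_countable_topology}" and H :: "real^'d"
  assumes H: "\<And>i. 0 < H $ i" "\<And>i. H $ i < 1"
    and g: "has_bochner_integral (spec H0) g G"
    and f: "\<And>i. has_bochner_integral (spec (H $ i)) (f i) (F i)"
  shows "has_bochner_integral (noise_spec H0 H) (\<lambda>(\<tau>, \<xi>). g \<tau> * (\<Prod>i\<in>UNIV. f i (\<xi> $ i))) (G * (\<Prod>i\<in>UNIV. F i))"
proof -
  interpret pair_sigma_finite "spec H0" "space_spec H" unfolding pair_sigma_finite_def by simp
  have fi: "integrable (spec (H $ i)) (f i)" and fe: "(\<integral>u. f i u \<partial>spec (H $ i)) = F i" for i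
    using f[of i] by (simp_all add: has_bochner_integral_iff)
  have gi: "integrable (spec H0) g" "(\<integral>u. g u \<partial>spec H0) = G" using g by (simp_all add: has_bochner_integral_iff)
  have int: "integrable (noise_spec H0 H) (\<lambda>(\<tau>, \<xi>). g \<tau> * (\<Prod>i\<in>UNIV. f i (\<xi> $ i)))"
    unfolding noise_spec_def by (intro integrable_pair_times gi pair_sigma_finite_axioms integrable_space_spec_prod H fi)
  show ?thesis
    using int unfolding noise_spec_def has_bochner_integral_iff
    by (subst integral_fst'[symmetric]) (auto simp: integral_space_spec_prod H fi fe gi)
qed

lemma integrable_noise_env:
  fixes H :: "real^'d"
  assumes H: "\<And>i. 0 < H $ i" "\<And>i. H $ i < 1" and H0: "0 < H0" "H0 \<le> 1"
  shows "integrable (noise_spec H0 H) noise_env"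
proof -
  have "has_bochner_integral (spec a) (\<lambda>\<tau>. 1 / (1 + \<tau>\<^sup>2)) (integral\<^sup>L (spec a) (\<lambda>\<tau>. 1 / (1 + \<tau>\<^sup>2)))" if "0 < a" "a \<le> 1" for a
    using integrable_spec_over_square[OF that] by (simp add: has_bochner_integral_iff)
  from has_bochner_integral_noise_spec_prod[OF H this[OF H0] this[OF H(1) less_imp_le[OF H(2)]]]
  show ?thesis by (simp add: has_bochner_integral_iff noise_env_def)
qed

lemma has_bochner_integral_point_ft:
  fixes H :: "real^'d"
  assumes H: "\<And>i. 0 < H $ i" "\<And>i. H $ i < 1" and H0: "0 < H0" "H0 \<le> 1"
  shows "has_bochner_integral (noise_spec H0 H) (\<lambda>z. point_ft t x z * cnj (point_ft s y z))
    (of_real (Rcov H0 t s * (\<Prod>i\<in>UNIV. Rcov (H$i) (x$i) (y$i))))"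
  using has_bochner_integral_noise_spec_prod[OF H has_bochner_integral_spec[OF H0]
      has_bochner_integral_spec[OF H(1) less_imp_le[OF H(2)]], of t s "\<lambda>i. x $ i" "\<lambda>i. y $ i"]
  by (simp add: point_ft_def case_prod_beta' prod.distrib mult_ac of_real_prod)

section \<open>Isometry for elementary integrands\<close>

lemma integrable_mult_of_squares:
  fixes f g :: "'a \<Rightarrow> real"
  assumes [measurable]: "f \<in> borel_measurable M" "g \<in> borel_measurable M"
    and "integrable M (\<lambda>x. (f x)\<^sup>2)" "integrable M (\<lambda>x. (g x)\<^sup>2)"
  shows "integrable M (\<lambda>x. f x * g x)"
proof (rule Bochner_Integration.integrable_bound)
  show "integrable M (\<lambda>x. (f x)\<^sup>2 + (g x)\<^sup>2)" using assms by simp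
  have "\<bar>u * v\<bar> \<le> u\<^sup>2 + v\<^sup>2" for u v :: real
    using sum_squares_bound[of "\<bar>u\<bar>" "\<bar>v\<bar>"] mult_nonneg_nonneg[OF abs_ge_zero[of u] abs_ge_zero[of v]]
    unfolding abs_mult power2_abs by linarith
  thus "AE x in M. norm (f x * g x) \<le> norm ((f x)\<^sup>2 + (g x)\<^sup>2)" by simp
qed measurable

text \<open>The covariance condition in \<open>frac_noise\<close> is an equation between Bochner
  integrals, which does not by itself yield integrability. Gaussianity supplies it.\<close>

lemma gaussian_rv_square_integrable:
  assumes "gaussian_rv M X"
  shows "integrable M (\<lambda>\<omega>. (X \<omega>)\<^sup>2)"
proof -
  have [measurable]: "X \<in> borel_measurable M" using assms by (simp add: gaussian_rv_def)
  from assms consider \<sigma> where "\<sigma> > 0" "distributed M lborel X (normal_density 0 \<sigma>)" | "AE \<omega> in M. X \<omega> = 0"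
    by (auto simp: gaussian_rv_def)
  thus ?thesis
  proof cases
    case 1
    have "integrable lborel (\<lambda>x. normal_density 0 \<sigma> x * x\<^sup>2)"
      using integrable_normal_moment[OF 1(1), of 0 2] by simp
    thus ?thesis using distributed_integrable[OF 1(2), of "\<lambda>x. x\<^sup>2"] by simp
  next
    case 2
    have "integrable M (\<lambda>\<omega>. 0::real)" by simp
    thus ?thesis by (rule integrable_cong_AE_imp) (use 2 in auto)
  qed
qed

lemma point_ft_measurable [measurable]: "point_ft t x \<in> borel_measurable borel"
  unfolding point_ft_def borel_prod[symmetric] by measurable

text \<open>Couples a linear combination of field values with its spectral image by reading both off
  one list. Being a relation, it avoids the question whether the random variable determines the
  image, and it is closed under linear operations, so that the isometry has to be proved only
  once.\<close>

definition field_rep ::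
  "(real \<Rightarrow> real^'d \<Rightarrow> 'w \<Rightarrow> real) \<Rightarrow> ('w \<Rightarrow> real) \<Rightarrow> (real \<times> (real^'d) \<Rightarrow> complex) \<Rightarrow> bool" where
  "field_rep W X \<phi> \<longleftrightarrow> (\<exists>ps. (\<forall>(t, x, c) \<in> set ps. 0 \<le> t) \<and>
      X = (\<lambda>\<omega>. sum_list (map (\<lambda>(t, x, c). c * W t x \<omega>) ps)) \<and>
      \<phi> = (\<lambda>z. sum_list (map (\<lambda>(t, x, c). of_real c * point_ft t x z) ps)))"

lemma field_rep_point: "0 \<le> t \<Longrightarrow> field_rep W (W t x) (point_ft t x)"
  unfolding field_rep_def by (intro exI[of _ "[(t, x, 1)]"]) auto

lemma field_rep_zero: "field_rep W (\<lambda>\<omega>. 0) (\<lambda>z. 0)"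
  unfolding field_rep_def by (intro exI[of _ "[]"]) auto

lemma field_rep_add:
  assumes "field_rep W X \<phi>" "field_rep W Y \<psi>"
  shows "field_rep W (\<lambda>\<omega>. X \<omega> + Y \<omega>) (\<lambda>z. \<phi> z + \<psi> z)"
proof -
  from assms obtain ps qs where "\<forall>(t, x, c) \<in> set ps. 0 \<le> t"
      "X = (\<lambda>\<omega>. sum_list (map (\<lambda>(t, x, c). c * W t x \<omega>) ps))"
      "\<phi> = (\<lambda>z. sum_list (map (\<lambda>(t, x, c). of_real c * point_ft t x z) ps))"
      "\<forall>(t, x, c) \<in> set qs. 0 \<le> t"
      "Y = (\<lambda>\<omega>. sum_list (map (\<lambda>(t, x, c). c * W t x \<omega>) qs))"
      "\<psi> = (\<lambda>z. sum_list (map (\<lambda>(t, x, c). of_real c * point_ft t x z) qs))"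
    unfolding field_rep_def by blast
  thus ?thesis unfolding field_rep_def by (intro exI[of _ "ps @ qs"]) auto
qed

lemma field_rep_scale:
  assumes "field_rep W X \<phi>"
  shows "field_rep W (\<lambda>\<omega>. k * X \<omega>) (\<lambda>z. of_real k * \<phi> z)"
proof -
  from assms obtain ps where "\<forall>(t, x, c) \<in> set ps. 0 \<le> t"
      "X = (\<lambda>\<omega>. sum_list (map (\<lambda>(t, x, c). c * W t x \<omega>) ps))"
      "\<phi> = (\<lambda>z. sum_list (map (\<lambda>(t, x, c). of_real c * point_ft t x z) ps))"
    unfolding field_rep_def by blast
  thus ?thesis unfolding field_rep_def
    by (intro exI[of _ "map (\<lambda>(t, x, c). (t, x, k * c)) ps"])
       (auto simp: o_def case_prod_beta' sum_list_const_mult[symmetric] mult.assoc)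
qed

lemma field_rep_diff:
  assumes "field_rep W X \<phi>" "field_rep W Y \<psi>"
  shows "field_rep W (\<lambda>\<omega>. X \<omega> - Y \<omega>) (\<lambda>z. \<phi> z - \<psi> z)"
  using field_rep_add[OF assms(1) field_rep_scale[OF assms(2), of "-1"]] by simp

lemma field_rep_sum:
  assumes "finite A" "\<And>a. a \<in> A \<Longrightarrow> field_rep W (X a) (\<phi> a)"
  shows "field_rep W (\<lambda>\<omega>. \<Sum>a\<in>A. X a \<omega>) (\<lambda>z. \<Sum>a\<in>A. \<phi> a z)"
  using assms by (induction A rule: finite_induct) (auto intro: field_rep_zero field_rep_add)

lemma field_rep_measurable:
  assumes "field_rep W X \<phi>"
  shows "\<phi> \<in> borel_measurable borel"
proof -
  obtain ps where \<phi>: "\<phi> = (\<lambda>z. sum_list (map (\<lambda>(t, x, c). of_real c * point_ft t x z) ps))"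
    using assms unfolding field_rep_def by blast
  have "(\<lambda>z. sum_list (map (\<lambda>(t, x, c). of_real c * point_ft t x z) ps)) \<in> borel_measurable borel"
    by (induction ps) (auto simp: case_prod_beta')
  thus ?thesis by (simp add: \<phi>)
qed

text \<open>Both squares expand into the same double sum: the covariance of two field values equals
  the spectral pairing of their images, by \<open>has_bochner_integral_point_ft\<close>.\<close>

lemma
  fixes H :: "real^'d"
  assumes W: "frac_noise M H0 H W" and H: "\<And>i. 0 < H $ i" "\<And>i. H $ i < 1" and H0: "0 < H0" "H0 \<le> 1"
    and rep: "field_rep W X \<phi>"
  shows field_rep_rv_measurable: "X \<in> borel_measurable M"
    and field_rep_rv_square_integrable: "integrable M (\<lambda>\<omega>. (X \<omega>)\<^sup>2)"
    and field_rep_isometry: "has_bochner_integral (noise_spec H0 H) (\<lambda>z. (norm (\<phi> z))\<^sup>2) (\<integral>\<omega>. (X \<omega>)\<^sup>2 \<partial>M)"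
proof -
  obtain ps where ps: "\<forall>(t, x, c) \<in> set ps. 0 \<le> t"
      "X = (\<lambda>\<omega>. sum_list (map (\<lambda>(t, x, c). c * W t x \<omega>) ps))"
      "\<phi> = (\<lambda>z. sum_list (map (\<lambda>(t, x, c). of_real c * point_ft t x z) ps))"
    using rep unfolding field_rep_def by blast
  define n where "n = length ps"
  define t where "t j = fst (ps ! j)" for j
  define x where "x j = fst (snd (ps ! j))" for j
  define c where "c j = snd (snd (ps ! j))" for j
  have t: "0 \<le> t j" if "j < n" for j
  proof -
    have "case ps ! j of (t, x, c) \<Rightarrow> 0 \<le> t" using bspec[OF ps(1) nth_mem, of j] that by (cases "ps ! j") (simp add: n_def)
    thus ?thesis by (simp add: t_def case_prod_beta')
  qed
  have X: "X = (\<lambda>\<omega>. \<Sum>j<n. c j * W (t j) (x j) \<omega>)"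
    unfolding ps(2) by (simp add: sum_list_sum_nth n_def t_def x_def c_def case_prod_beta' atLeast0LessThan)
  have \<phi>: "\<phi> = (\<lambda>z. \<Sum>j<n. of_real (c j) * point_ft (t j) (x j) z)"
    unfolding ps(3) by (simp add: sum_list_sum_nth n_def t_def x_def c_def case_prod_beta' atLeast0LessThan)
  have Wm: "W s y \<in> borel_measurable M" if "0 \<le> s" for s y
    using W that by (simp add: frac_noise_def)
  \<comment> \<open>The Gaussian condition for lists, applied to a list with one entry, gives the
    marginals.\<close>
  have Wi: "integrable M (\<lambda>\<omega>. (W s y \<omega>)\<^sup>2)" if "0 \<le> s" for s y
  proof -
    have "gaussian_rv M (\<lambda>\<omega>. sum_list (map (\<lambda>(t, x, c). c * W t x \<omega>) [(s, y, 1)]))"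
      using W unfolding frac_noise_def
      by (elim conjE allE[where x = "[(s, y, 1)]"] impE) (auto simp: that)
    thus ?thesis by (auto dest: gaussian_rv_square_integrable)
  qed
  have WW: "integrable M (\<lambda>\<omega>. W s y \<omega> * W s' y' \<omega>)" if "0 \<le> s" "0 \<le> s'" for s y s' y'
    by (intro integrable_mult_of_squares Wm Wi that)
  have cov: "(\<integral>\<omega>. W s y \<omega> * W s' y' \<omega> \<partial>M) = Rcov H0 s s' * (\<Prod>i\<in>UNIV. Rcov (H$i) (y$i) (y'$i))"
    if "0 \<le> s" "0 \<le> s'" for s y s' y' using W that by (simp add: frac_noise_def)
  show "X \<in> borel_measurable M" unfolding X using t
    by (intro borel_measurable_sum borel_measurable_times borel_measurable_const Wm) auto
  have X2: "(\<lambda>\<omega>. (X \<omega>)\<^sup>2) = (\<lambda>\<omega>. \<Sum>j<n. \<Sum>k<n. c j * c k * (W (t j) (x j) \<omega> * W (t k) (x k) \<omega>))"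
    unfolding X power2_eq_square by (simp add: sum_product mult_ac)
  have "has_bochner_integral M (\<lambda>\<omega>. (X \<omega>)\<^sup>2)
      (\<Sum>j<n. \<Sum>k<n. c j * c k * (Rcov H0 (t j) (t k) * (\<Prod>i\<in>UNIV. Rcov (H$i) (x j$i) (x k$i))))"
    unfolding X2
  proof (intro has_bochner_integral_sum has_bochner_integral_mult_right)
    fix j k assume "j \<in> {..<n}" "k \<in> {..<n}"
    hence "0 \<le> t j" "0 \<le> t k" using t by auto
    thus "has_bochner_integral M (\<lambda>\<omega>. W (t j) (x j) \<omega> * W (t k) (x k) \<omega>)
        (Rcov H0 (t j) (t k) * (\<Prod>i\<in>UNIV. Rcov (H$i) (x j$i) (x k$i)))"
      by (simp add: has_bochner_integral_iff WW cov)
  qed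
  hence X2i: "integrable M (\<lambda>\<omega>. (X \<omega>)\<^sup>2)"
    and EX2: "(\<integral>\<omega>. (X \<omega>)\<^sup>2 \<partial>M) = (\<Sum>j<n. \<Sum>k<n. c j * c k * (Rcov H0 (t j) (t k) * (\<Prod>i\<in>UNIV. Rcov (H$i) (x j$i) (x k$i))))"
    by (simp_all add: has_bochner_integral_iff)
  show "integrable M (\<lambda>\<omega>. (X \<omega>)\<^sup>2)" by (fact X2i)
  have "has_bochner_integral (noise_spec H0 H)
      (\<lambda>z. \<Sum>j<n. \<Sum>k<n. of_real (c j * c k) * (point_ft (t j) (x j) z * cnj (point_ft (t k) (x k) z)))
      (\<Sum>j<n. \<Sum>k<n. of_real (c j * c k) * of_real (Rcov H0 (t j) (t k) * (\<Prod>i\<in>UNIV. Rcov (H$i) (x j$i) (x k$i))))"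
    by (intro has_bochner_integral_sum has_bochner_integral_mult_right has_bochner_integral_point_ft H H0)
  moreover have "(\<Sum>j<n. \<Sum>k<n. of_real (c j * c k) * (point_ft (t j) (x j) z * cnj (point_ft (t k) (x k) z)))
     = complex_of_real ((norm (\<phi> z))\<^sup>2)" for z
    unfolding \<phi> complex_norm_square by (simp add: cnj_sum sum_product mult_ac)
  moreover have "(\<Sum>j<n. \<Sum>k<n. of_real (c j * c k) * complex_of_real (Rcov H0 (t j) (t k) * (\<Prod>i\<in>UNIV. Rcov (H$i) (x j$i) (x k$i))))
    = of_real (\<integral>\<omega>. (X \<omega>)\<^sup>2 \<partial>M)" unfolding EX2 by simp
  ultimately have "has_bochner_integral (noise_spec H0 H) (\<lambda>z. complex_of_real ((norm (\<phi> z))\<^sup>2)) (of_real (\<integral>\<omega>. (X \<omega>)\<^sup>2 \<partial>M))"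
    by simp
  thus "has_bochner_integral (noise_spec H0 H) (\<lambda>z. (norm (\<phi> z))\<^sup>2) (\<integral>\<omega>. (X \<omega>)\<^sup>2 \<partial>M)"
    unfolding has_bochner_integral_iff complex_of_real_integrable_eq integral_complex_of_real of_real_eq_iff .
qed

definition rect_ft :: "real \<Rightarrow> real \<Rightarrow> real^'d \<Rightarrow> real^'d \<Rightarrow> real \<times> (real^'d) \<Rightarrow> complex" where
  "rect_ft a b lo hi = (\<lambda>(\<tau>, \<xi>). interval_ft a b \<tau> * (\<Prod>i\<in>UNIV. interval_ft (lo $ i) (hi $ i) (\<xi> $ i)))"

definition elem_ft :: "('d::finite) elem \<Rightarrow> real \<times> (real^'d) \<Rightarrow> complex" where
  "elem_ft E z = sum_list (map (\<lambda>(c, a, b, lo, hi). of_real c * rect_ft a b lo hi z) E)"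

text \<open>Inclusion-exclusion over the corners. Each factor of the transform is the difference of
  its values at hi and lo; expanding the product gives one term for every set S of coordinates taken
  at hi, with the sign that occurs in \<open>rect_incr\<close>.\<close>

lemma field_rep_rect_incr:
  fixes lo hi :: "real^'d"
  assumes ab: "0 \<le> a" "0 \<le> b"
  shows "field_rep W (rect_incr W a b lo hi) (rect_ft a b lo hi)"
proof -
  let ?v = "\<lambda>S. (\<chi> i. if i \<in> S then hi $ i else lo $ i) :: real^'d"
  have "field_rep W (\<lambda>\<omega>. \<Sum>S\<in>Pow (UNIV :: 'd set). (-1) ^ card (UNIV - S) * (W b (?v S) \<omega> - W a (?v S) \<omega>))
    (\<lambda>z. \<Sum>S\<in>Pow (UNIV :: 'd set). of_real ((-1) ^ card (UNIV - S)) * (point_ft b (?v S) z - point_ft a (?v S) z))"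
    by (intro field_rep_sum field_rep_scale field_rep_diff field_rep_point ab) auto
  moreover have "(\<Sum>S\<in>Pow (UNIV :: 'd set). of_real ((-1) ^ card (UNIV - S)) * (point_ft b (?v S) z - point_ft a (?v S) z))
     = rect_ft a b lo hi z" for z
  proof -
    obtain \<tau> \<xi> where z: "z = (\<tau>, \<xi>)" by (cases z)
    let ?h = "\<lambda>i. interval_ft 0 (hi $ i) (\<xi> $ i)" and ?l = "\<lambda>i. interval_ft 0 (lo $ i) (\<xi> $ i)"
    have "(\<Prod>i\<in>UNIV. interval_ft (lo $ i) (hi $ i) (\<xi> $ i)) = (\<Prod>i\<in>UNIV. ?h i + - ?l i)"
      by (simp add: interval_ft_diff[of "lo $ _"])
    also have "\<dots> = (\<Sum>S\<in>Pow UNIV. (\<Prod>i\<in>S. ?h i) * (\<Prod>i\<in>UNIV - S. - ?l i))"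
      by (rule prod_add) simp
    also have "\<dots> = (\<Sum>S\<in>Pow UNIV. (-1) ^ card (UNIV - S) * (\<Prod>i\<in>UNIV. interval_ft 0 (?v S $ i) (\<xi> $ i)))"
    proof (intro sum.cong refl)
      fix S :: "'d set"
      have "(\<Prod>i\<in>UNIV. interval_ft 0 (?v S $ i) (\<xi> $ i)) =
         (\<Prod>i\<in>S. interval_ft 0 (?v S $ i) (\<xi> $ i)) * (\<Prod>i\<in>UNIV - S. interval_ft 0 (?v S $ i) (\<xi> $ i))"
        by (rule prod.subset_diff[of S UNIV, simplified mult.commute]) auto
      also have "\<dots> = (\<Prod>i\<in>S. ?h i) * (\<Prod>i\<in>UNIV - S. ?l i)"
        by (intro arg_cong2[where f = "(*)"] prod.cong) auto
      finally show "(\<Prod>i\<in>S. ?h i) * (\<Prod>i\<in>UNIV - S. - ?l i) =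
          (-1) ^ card (UNIV - S) * (\<Prod>i\<in>UNIV. interval_ft 0 (?v S $ i) (\<xi> $ i))"
        by (simp add: prod_uminus mult_ac)
    qed
    finally show ?thesis
      by (simp add: z rect_ft_def point_ft_def interval_ft_diff[of a b] sum_distrib_left algebra_simps sum_subtractf)
  qed
  ultimately show ?thesis unfolding rect_incr_def by simp
qed

lemma field_rep_elem_int:
  assumes "valid_elem E"
  shows "field_rep W (elem_int W E) (elem_ft E)"
  using assms
proof (induction E)
  case Nil thus ?case using field_rep_zero by (simp add: elem_int_def elem_ft_def)
next
  case (Cons e E)
  obtain c a b lo hi where e: "e = (c, a, b, lo, hi)" by (cases e)
  have "0 \<le> a" "0 \<le> b" "valid_elem E" using Cons.prems by (auto simp: valid_elem_def e)
  from field_rep_add[OF field_rep_scale[OF field_rep_rect_incr[OF this(1,2)]] Cons.IH[OF this(3)]]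
  show ?case by (simp add: elem_int_def elem_ft_def e)
qed

section \<open>Fourier transforms of integrable integrands\<close>

definition ft :: "(real \<times> (real^'d) \<Rightarrow> real) \<Rightarrow> real \<times> (real^'d) \<Rightarrow> complex" where
  "ft f z = (\<integral>w. of_real (f w) * cis (fst z * fst w + snd z \<bullet> snd w) \<partial>lborel)"

lemma measurable_cis_inner [measurable]:
  "(\<lambda>w :: real \<times> (real^'d). cis (fst z * fst w + snd z \<bullet> snd w)) \<in> borel_measurable borel"
  unfolding cis_conv_exp by (intro borel_measurable_continuous_onI continuous_intros)

lemma integrable_ft:
  fixes f :: "real \<times> (real^'d) \<Rightarrow> real"
  assumes "integrable lborel f"
  shows "integrable lborel (\<lambda>w. of_real (f w) * cis (fst z * fst w + snd z \<bullet> snd w))"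
proof (rule Bochner_Integration.integrable_bound[OF assms])
  have [measurable]: "f \<in> borel_measurable borel" using assms by (auto dest: borel_measurable_integrable)
  show "(\<lambda>w. of_real (f w) * cis (fst z * fst w + snd z \<bullet> snd w)) \<in> borel_measurable lborel"
    using borel_measurable_times[OF measurable_compose[OF _ borel_measurable_of_real, of f borel] measurable_cis_inner[of z]] by simp
qed (auto simp: norm_mult)

text \<open>The L1 clause of \<open>wiener_integral\<close> enters through this bound: L1
  convergence of integrands forces convergence of their transforms, uniformly in the
  frequency.\<close>

lemma norm_ft_diff_le:
  assumes "integrable lborel f" "integrable lborel g"
  shows "norm (ft f z - ft g z) \<le> (\<integral>w. \<bar>f w - g w\<bar> \<partial>lborel)"
proof -
  have "ft f z - ft g z = (\<integral>w. of_real (f w - g w) * cis (fst z * fst w + snd z \<bullet> snd w) \<partial>lborel)"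
    unfolding ft_def of_real_diff left_diff_distrib
    by (rule Bochner_Integration.integral_diff[symmetric]) (intro integrable_ft assms)+
  also have "norm \<dots> \<le> (\<integral>w. norm (of_real (f w - g w) * cis (fst z * fst w + snd z \<bullet> snd w)) \<partial>lborel)"
    by (rule integral_norm_bound)
  finally show ?thesis by (simp add: norm_mult flip: of_real_diff)
qed

lemma cis_sum: "finite A \<Longrightarrow> cis (\<Sum>i\<in>A. f i) = (\<Prod>i\<in>A. cis (f i))"
  by (induction A rule: finite_induct) (auto simp: cis_mult[symmetric])

lemma rect_ind_eq: "rect_ind a b lo hi (s, y) = indicator {a<..b} s * (\<Prod>i\<in>UNIV. indicator {lo $ i<..hi $ i} (y $ i))"
  by (auto simp: rect_ind_def indicator_def)

lemma has_bochner_integral_lborel_prod: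
  fixes f :: "'d::finite \<Rightarrow> real \<Rightarrow> 'b::{real_normed_field, banach, second_countable_topology}"
  assumes g: "has_bochner_integral lborel g G"
    and f: "\<And>i. has_bochner_integral lborel (f i) (F i)"
  shows "has_bochner_integral (lborel :: (real \<times> (real^'d)) measure) (\<lambda>(s, y). g s * (\<Prod>i\<in>UNIV. f i (y $ i))) (G * (\<Prod>i\<in>UNIV. F i))"
proof -
  have P: "pair_sigma_finite (lborel :: real measure) (lborel :: (real^'d) measure)" ..
  have fi: "integrable lborel (f i)" and fe: "(\<integral>u. f i u \<partial>lborel) = F i" for i
    using f[of i] by (simp_all add: has_bochner_integral_iff)
  have gi: "integrable lborel g" "(\<integral>u. g u \<partial>lborel) = G" using g by (simp_all add: has_bochner_integral_iff)
  have int: "integrable (lborel \<Otimes>\<^sub>M (lborel :: (real^'d) measure)) (\<lambda>(s, y). g s * (\<Prod>i\<in>UNIV. f i (y $ i)))"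
    by (intro integrable_pair_times[OF P] gi integrable_vec_prod fi)
  show ?thesis
    using int unfolding lborel_prod[symmetric] has_bochner_integral_iff
    by (subst pair_sigma_finite.integral_fst'[OF P, symmetric]) (auto simp: integral_vec_prod fi fe gi)
qed

lemma has_bochner_integral_rect:
  fixes lo hi :: "real^'d"
  assumes "a \<le> b" "\<And>i. lo $ i \<le> hi $ i"
  shows "has_bochner_integral lborel (\<lambda>w. of_real (rect_ind a b lo hi w) * cis (fst z * fst w + snd z \<bullet> snd w)) (rect_ft a b lo hi z)"
proof -
  have "of_real (rect_ind a b lo hi w) * cis (fst z * fst w + snd z \<bullet> snd w) =
    (case w of (s, y) \<Rightarrow> (indicator {a<..b} s *\<^sub>R cis (fst z * s)) *
       (\<Prod>i\<in>UNIV. indicator {lo $ i<..hi $ i} (y $ i) *\<^sub>R cis (snd z $ i * y $ i)))" for w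
    by (cases w) (simp add: rect_ind_eq cis_mult[symmetric] inner_vec_def cis_sum prod.distrib scaleR_conv_of_real of_real_prod)
  moreover have "has_bochner_integral (lborel :: (real \<times> (real^'d)) measure)
      (\<lambda>(s, y). (indicator {a<..b} s *\<^sub>R cis (fst z * s)) *
       (\<Prod>i\<in>UNIV. indicator {lo $ i<..hi $ i} (y $ i) *\<^sub>R cis (snd z $ i * y $ i)))
      (interval_ft a b (fst z) * (\<Prod>i\<in>UNIV. interval_ft (lo $ i) (hi $ i) (snd z $ i)))"
    by (intro has_bochner_integral_lborel_prod has_bochner_integral_interval_ft assms)
  ultimately show ?thesis by (simp add: rect_ft_def case_prod_beta')
qed

lemma has_bochner_integral_elem_ft:
  assumes "valid_elem E"
  shows "has_bochner_integral lborel (\<lambda>w. of_real (elem_fun E w) * cis (fst z * fst w + snd z \<bullet> snd w)) (elem_ft E z)"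
  using assms
proof (induction E)
  case Nil thus ?case by (simp add: elem_fun_def elem_ft_def has_bochner_integral_zero)
next
  case (Cons e E)
  obtain c a b lo hi where e: "e = (c, a, b, lo, hi)" by (cases e)
  have "a \<le> b" "\<And>i. lo $ i \<le> hi $ i" "valid_elem E" using Cons.prems by (auto simp: valid_elem_def e)
  from has_bochner_integral_add[OF has_bochner_integral_mult_right[OF has_bochner_integral_rect[OF this(1,2)], of "of_real c" z]
      Cons.IH[OF this(3)]]
  show ?case by (simp add: elem_fun_def elem_ft_def e algebra_simps)
qed

lemma ft_elem_fun: "valid_elem E \<Longrightarrow> ft (elem_fun E) = elem_ft E"
  using has_bochner_integral_elem_ft[of E] by (intro ext) (simp only: ft_def has_bochner_integral_iff)

lemma integrable_elem_fun:
  assumes "valid_elem E" shows "integrable lborel (elem_fun E)"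
  \<comment> \<open>At frequency zero the exponential factor is 1.\<close>
  using has_bochner_integral_elem_ft[OF assms, of "(0, 0)"]
  by (simp add: has_bochner_integral_iff complex_of_real_integrable_eq)

section \<open>Complex Gaussians\<close>

lemma integrable_exp_neg_square:
  assumes "\<delta> > 0"
  shows "integrable lborel (\<lambda>u::real. exp (- \<delta> * u\<^sup>2 / 2))"
proof -
  have "integrable lborel (\<lambda>u. sqrt (2 * pi * (1 / sqrt \<delta>)\<^sup>2) * (normal_density 0 (1 / sqrt \<delta>) u * (u - 0) ^ 0))"
    using assms by (intro integrable_mult_right integrable_normal_moment) auto
  thus ?thesis using assms
    by (rule_tac Bochner_Integration.integrable_cong[THEN iffD1, rotated -1])
       (auto simp: normal_density_def power_divide field_simps)
qed

text \<open>The closed form of the Fourier transform of exp (- \<zeta> * u^2 / 2). The principal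
  branch \<open>csqrt\<close> is holomorphic on Re \<zeta> > 0, as the continuation argument
  requires.\<close>

definition gauss_ft :: "complex \<Rightarrow> real \<Rightarrow> complex" where
  "gauss_ft \<zeta> w = of_real (sqrt (2 * pi)) / csqrt \<zeta> * exp (- (of_real w)\<^sup>2 / (2 * \<zeta>))"

definition gauss_fun :: "complex \<Rightarrow> real \<Rightarrow> real \<Rightarrow> complex" where
  "gauss_fun \<zeta> w u = exp (- \<zeta> * (of_real u)\<^sup>2 / 2) * cis (w * u)"

lemma norm_gauss_fun: "norm (gauss_fun \<zeta> w u) = exp (- Re \<zeta> * u\<^sup>2 / 2)"
proof -
  have "- \<zeta> * (of_real u)\<^sup>2 / 2 = of_real (- u\<^sup>2 / 2) * \<zeta>" by simp
  hence "Re (- \<zeta> * (of_real u)\<^sup>2 / 2) = - u\<^sup>2 / 2 * Re \<zeta>" by (simp only:) simp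
  thus ?thesis by (simp add: gauss_fun_def norm_mult)
qed

lemma gauss_fun_measurable [measurable]: "gauss_fun \<zeta> w \<in> borel_measurable borel"
  unfolding gauss_fun_def cis_conv_exp by measurable

lemma integrable_gauss_fun: "Re \<zeta> > 0 \<Longrightarrow> integrable lborel (gauss_fun \<zeta> w)"
  by (rule Bochner_Integration.integrable_bound[OF integrable_exp_neg_square[of "Re \<zeta>"]])
     (auto simp: norm_gauss_fun)

text \<open>For real parameters this is the characteristic function of the standard normal
  distribution, rescaled by sqrt a.\<close>

lemma integral_gauss_fun_real:
  assumes a: "a > 0"
  shows "(\<integral>u. gauss_fun (of_real a) w u \<partial>lborel) = gauss_ft (of_real a) w"
proof -
  define t where "t = w / sqrt a"
  have "char std_normal_distribution t = (\<integral>x. std_normal_density x *\<^sub>R iexp (t * x) \<partial>lborel)"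
    unfolding char_def by (subst integral_density) auto
  hence "exp (- (t\<^sup>2) / 2) = (\<integral>x. std_normal_density x *\<^sub>R iexp (t * x) \<partial>lborel)"
    by (simp add: char_std_normal_distribution)
  also have "\<dots> = sqrt a *\<^sub>R (\<integral>u. std_normal_density (sqrt a * u) *\<^sub>R iexp (t * (sqrt a * u)) \<partial>lborel)"
    using a by (subst lborel_integral_real_affine[where c = "sqrt a" and t = 0]) auto
  also have "(\<lambda>u. std_normal_density (sqrt a * u) *\<^sub>R iexp (t * (sqrt a * u))) =
      (\<lambda>u. (1 / sqrt (2 * pi)) *\<^sub>R gauss_fun (of_real a) w u)"
  proof
    fix u
    have "t * (sqrt a * u) = w * u" using a by (simp add: t_def)
    hence e: "iexp (t * (sqrt a * u)) = cis (w * u)" by (simp only: cis_conv_exp)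
    thus "std_normal_density (sqrt a * u) *\<^sub>R iexp (t * (sqrt a * u)) = (1 / sqrt (2 * pi)) *\<^sub>R gauss_fun (of_real a) w u"
      using a unfolding gauss_fun_def normal_density_def e
      by (simp add: scaleR_conv_of_real power_mult_distrib exp_of_real[symmetric] del: exp_of_real)
  qed
  finally have "complex_of_real (exp (- (t\<^sup>2) / 2)) = (sqrt a / sqrt (2 * pi)) *\<^sub>R (\<integral>u. gauss_fun (of_real a) w u \<partial>lborel)"
    by simp
  hence "(\<integral>u. gauss_fun (of_real a) w u \<partial>lborel) = (sqrt (2 * pi) / sqrt a) *\<^sub>R complex_of_real (exp (- (t\<^sup>2) / 2))"
    using a by (simp add: field_simps)
  moreover have "- (t\<^sup>2) / 2 = - w\<^sup>2 / (2 * a)" using a by (simp add: t_def power_divide)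
  moreover have "(complex_of_real t)\<^sup>2 = (of_real w)\<^sup>2 / of_real a"
    using a by (simp add: t_def power_divide flip: of_real_power)
  ultimately show ?thesis using a
    by (simp add: gauss_ft_def mult.commute[of 2] scaleR_conv_of_real exp_of_real[symmetric] del: exp_of_real)
qed

text \<open>On Re \<zeta> \<ge> \<delta> one Gaussian, exp (- \<delta> * u^2 / 2), dominates all
  integrands, so the tails outside [-n, n] vanish uniformly in \<zeta>.\<close>

lemma uniform_limit_gauss:
  assumes \<delta>: "\<delta> > 0"
  shows "uniform_limit {\<zeta>. Re \<zeta> \<ge> \<delta>} (\<lambda>n \<zeta>. integral (cbox (- real n) (real n)) (gauss_fun \<zeta> w))
     (\<lambda>\<zeta>. \<integral>u. gauss_fun \<zeta> w u \<partial>lborel) sequentially"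
proof -
  let ?T = "\<lambda>n. \<integral>u. indicator (- {- real n..real n}) u *\<^sub>R exp (- \<delta> * u\<^sup>2 / 2) \<partial>lborel"
  have "?T \<longlonglongrightarrow> integral\<^sup>L lborel (\<lambda>_::real. 0::real)"
  proof (rule integral_dominated_convergence[where w = "\<lambda>u. exp (- \<delta> * u\<^sup>2 / 2)"])
    show "AE u in lborel. (\<lambda>n. indicator (- {- real n..real n}) u *\<^sub>R exp (- \<delta> * u\<^sup>2 / 2)) \<longlonglongrightarrow> 0"
    proof (intro AE_I2)
      fix u :: real
      have "\<forall>\<^sub>F n in sequentially. indicator (- {- real n..real n}) u *\<^sub>R exp (- \<delta> * u\<^sup>2 / 2) = 0"
        using eventually_ge_at_top[of "nat \<lceil>\<bar>u\<bar>\<rceil>"]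
      proof eventually_elim
        case (elim n)
        hence "\<bar>u\<bar> \<le> real n" by linarith
        thus ?case by (auto simp: indicator_def)
      qed
      thus "(\<lambda>n. indicator (- {- real n..real n}) u *\<^sub>R exp (- \<delta> * u\<^sup>2 / 2)) \<longlonglongrightarrow> 0"
        by (rule tendsto_eventually)
    qed
  qed (use integrable_exp_neg_square[OF \<delta>] in \<open>auto simp: indicator_def\<close>)
  hence T: "?T \<longlonglongrightarrow> 0" by simp
  show ?thesis
  proof (rule uniform_limitI)
    fix e :: real assume "e > 0"
    with T have "\<forall>\<^sub>F n in sequentially. ?T n < e" by (rule order_tendstoD)
    thus "\<forall>\<^sub>F n in sequentially. \<forall>\<zeta>\<in>{\<zeta>. Re \<zeta> \<ge> \<delta>}.
      dist (integral (cbox (- real n) (real n)) (gauss_fun \<zeta> w)) (\<integral>u. gauss_fun \<zeta> w u \<partial>lborel) < e"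
    proof eventually_elim
      case (elim n)
      show ?case
      proof
        fix \<zeta> assume "\<zeta> \<in> {\<zeta>. Re \<zeta> \<ge> \<delta>}"
        hence \<zeta>: "Re \<zeta> \<ge> \<delta>" "Re \<zeta> > 0" using \<delta> by auto
        have si: "set_integrable lborel {- real n..real n} (gauss_fun \<zeta> w)"
          unfolding set_integrable_def by (rule integrable_mult_indicator) (auto simp: integrable_gauss_fun \<zeta>)
        have si': "integrable lborel (\<lambda>u. indicator (- {- real n..real n}) u *\<^sub>R gauss_fun \<zeta> w u)"
          by (rule integrable_mult_indicator) (auto simp: integrable_gauss_fun \<zeta>)
        have "(\<integral>u. gauss_fun \<zeta> w u \<partial>lborel) - integral (cbox (- real n) (real n)) (gauss_fun \<zeta> w)
          = (\<integral>u. gauss_fun \<zeta> w u - indicator {- real n..real n} u *\<^sub>R gauss_fun \<zeta> w u \<partial>lborel)"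
          using si by (subst Bochner_Integration.integral_diff)
            (auto simp: set_borel_integral_eq_integral(2)[OF si, symmetric] set_lebesgue_integral_def set_integrable_def integrable_gauss_fun \<zeta>)
        also have "(\<lambda>u. gauss_fun \<zeta> w u - indicator {- real n..real n} u *\<^sub>R gauss_fun \<zeta> w u) =
          (\<lambda>u. indicator (- {- real n..real n}) u *\<^sub>R gauss_fun \<zeta> w u)"
          by (auto simp: indicator_def fun_eq_iff)
        finally have "norm ((\<integral>u. gauss_fun \<zeta> w u \<partial>lborel) - integral (cbox (- real n) (real n)) (gauss_fun \<zeta> w))
          \<le> (\<integral>u. norm (indicator (- {- real n..real n}) u *\<^sub>R gauss_fun \<zeta> w u) \<partial>lborel)"
          using integral_norm_bound by metis
        also have "\<dots> \<le> ?T n"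
        proof (rule integral_mono)
          show "integrable lborel (\<lambda>u. norm (indicator (- {- real n..real n}) u *\<^sub>R gauss_fun \<zeta> w u))"
            by (rule integrable_norm[OF si'])
          show "integrable lborel (\<lambda>u. indicator (- {- real n..real n}) u *\<^sub>R exp (- \<delta> * u\<^sup>2 / 2))"
            using integrable_exp_neg_square[OF \<delta>] by (intro integrable_mult_indicator) auto
          show "norm (indicator (- {- real n..real n}) u *\<^sub>R gauss_fun \<zeta> w u)
             \<le> indicator (- {- real n..real n}) u *\<^sub>R exp (- \<delta> * u\<^sup>2 / 2)" for u
            using \<zeta> by (auto simp: norm_gauss_fun indicator_def intro!: mult_right_mono)
        qed
        finally show "dist (integral (cbox (- real n) (real n)) (gauss_fun \<zeta> w)) (\<integral>u. gauss_fun \<zeta> w u \<partial>lborel) < e"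
          using elim by (simp add: dist_norm norm_minus_commute)
      qed
    qed
  qed
qed

text \<open>Truncated integrals are holomorphic by differentiation under the integral sign, and
  holomorphy survives locally uniform limits.\<close>

lemma holomorphic_integral_gauss_fun: "(\<lambda>\<zeta>. \<integral>u. gauss_fun \<zeta> w u \<partial>lborel) holomorphic_on {\<zeta>. Re \<zeta> > 0}"
proof (rule holomorphic_uniform_sequence[where f = "\<lambda>n \<zeta>. integral (cbox (- real n) (real n)) (gauss_fun \<zeta> w)"])
  show "open {\<zeta>. Re \<zeta> > 0}" by (rule open_halfspace_Re_gt)
  show "(\<lambda>\<zeta>. integral (cbox (- real n) (real n)) (gauss_fun \<zeta> w)) holomorphic_on {\<zeta>. Re \<zeta> > 0}" for n
  proof (rule leibniz_rule_holomorphic[where fx = "\<lambda>\<zeta> u. - (of_real u)\<^sup>2 / 2 * gauss_fun \<zeta> w u"])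
    show "((\<lambda>\<zeta>. gauss_fun \<zeta> w u) has_field_derivative - (of_real u)\<^sup>2 / 2 * gauss_fun \<zeta> w u) (at \<zeta> within {\<zeta>. Re \<zeta> > 0})" for \<zeta> u
      unfolding gauss_fun_def by (auto intro!: derivative_eq_intros)
    show "(gauss_fun \<zeta> w) integrable_on cbox (- real n) (real n)" for \<zeta>
      unfolding gauss_fun_def cis_conv_exp by (intro integrable_continuous continuous_intros) auto
    show "continuous_on ({\<zeta>. Re \<zeta> > 0} \<times> cbox (- real n) (real n)) (\<lambda>(\<zeta>, u). - (of_real u)\<^sup>2 / 2 * gauss_fun \<zeta> w u)"
      unfolding gauss_fun_def cis_conv_exp case_prod_beta' by (intro continuous_intros) auto
    show "convex {\<zeta>. Re \<zeta> > 0}" by (rule convex_halfspace_Re_gt)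
  qed
next
  fix \<zeta> assume "\<zeta> \<in> {\<zeta>. Re \<zeta> > 0}"
  hence \<zeta>: "Re \<zeta> > 0" by simp
  \<comment> \<open>The ball of radius Re \<zeta> / 2 stays in a half-plane on which the convergence
    is uniform.\<close>
  have sub: "Re z \<ge> Re \<zeta> / 2" if "z \<in> cball \<zeta> (Re \<zeta> / 2)" for z
    using that abs_Re_le_cmod[of "\<zeta> - z"] by (simp add: dist_norm)
  hence "cball \<zeta> (Re \<zeta> / 2) \<subseteq> {\<zeta>. Re \<zeta> > 0}" using \<zeta> by (auto intro: less_le_trans[of _ "Re \<zeta> / 2"])
  moreover have "uniform_limit (cball \<zeta> (Re \<zeta> / 2)) (\<lambda>n \<zeta>. integral (cbox (- real n) (real n)) (gauss_fun \<zeta> w))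
     (\<lambda>\<zeta>. \<integral>u. gauss_fun \<zeta> w u \<partial>lborel) sequentially"
    by (rule uniform_limit_on_subset[OF uniform_limit_gauss[of "Re \<zeta> / 2"]]) (use \<zeta> sub in auto)
  ultimately show "\<exists>d>0. cball \<zeta> d \<subseteq> {\<zeta>. Re \<zeta> > 0} \<and> uniform_limit (cball \<zeta> d) (\<lambda>n \<zeta>. integral (cbox (- real n) (real n)) (gauss_fun \<zeta> w))
     (\<lambda>\<zeta>. \<integral>u. gauss_fun \<zeta> w u \<partial>lborel) sequentially"
    using \<zeta> by (intro exI[of _ "Re \<zeta> / 2"]) auto
qed

lemma Re_pos_nonpos_Reals: "Re \<zeta> > 0 \<Longrightarrow> \<zeta> \<notin> \<real>\<^sub>\<le>\<^sub>0"
  by (auto simp: complex_nonpos_Reals_iff)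

text \<open>Analytic continuation: both sides are holomorphic on the right half-plane and agree on
  the positive real axis.\<close>

lemma has_bochner_integral_gauss_fun:
  assumes "Re \<zeta> > 0"
  shows "has_bochner_integral lborel (gauss_fun \<zeta> w) (gauss_ft \<zeta> w)"
proof -
  let ?U = "complex_of_real ` {0<..}"
  have "(\<integral>u. gauss_fun \<zeta> w u \<partial>lborel) - gauss_ft \<zeta> w = 0"
  proof (rule analytic_continuation[where f = "\<lambda>\<zeta>. (\<integral>u. gauss_fun \<zeta> w u \<partial>lborel) - gauss_ft \<zeta> w" and S = "{\<zeta>. Re \<zeta> > 0}" and U = ?U and \<xi> = 1])
    show "(\<lambda>\<zeta>. (\<integral>u. gauss_fun \<zeta> w u \<partial>lborel) - gauss_ft \<zeta> w) holomorphic_on {\<zeta>. Re \<zeta> > 0}"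
      unfolding gauss_ft_def
      by (intro holomorphic_intros holomorphic_integral_gauss_fun) (auto simp: Re_pos_nonpos_Reals)
    show "connected {\<zeta>. Re \<zeta> > 0}" by (intro convex_connected convex_halfspace_Re_gt)
    show "1 islimpt ?U"
    proof -
      have "(1::real) islimpt {0<..}" by (intro interior_limit_point) (auto simp: interior_open)
      then obtain f where f: "\<forall>n. f n \<in> {0<..} - {1::real}" "f \<longlonglongrightarrow> 1"
        unfolding islimpt_sequential by blast
      have "(\<lambda>n. complex_of_real (f n)) \<longlonglongrightarrow> complex_of_real 1"
        by (rule tendsto_of_real[OF f(2)])
      hence "complex_of_real 1 islimpt ?U" unfolding islimpt_sequential using f(1)
        by (intro exI[of _ "\<lambda>n. complex_of_real (f n)"]) (auto simp: of_real_eq_1_iff)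
      thus ?thesis by simp
    qed
  qed (use assms in \<open>auto simp: open_halfspace_Re_gt integral_gauss_fun_real\<close>)
  thus ?thesis using integrable_gauss_fun[OF assms] by (simp add: has_bochner_integral_iff)
qed

text \<open>The one-dimensional inverse Fourier transform of exp (- \<zeta> * w^2 / 2). The factor 1
  / (2 * pi) per coordinate accounts for the constant in \<open>moll_wave_kernel\<close>.\<close>

definition gauss_dual :: "complex \<Rightarrow> real \<Rightarrow> complex" where
  "gauss_dual \<zeta> u = gauss_ft \<zeta> u / of_real (2 * pi)"

text \<open>The transform of a Gaussian with parameter \<zeta> is, up to a constant, a Gaussian with
  parameter \<open>inverse \<zeta>\<close>. Applying the explicit formula a second time therefore
  gives Fourier inversion directly.\<close>

lemma gauss_dual_inverse:
  assumes "Re \<zeta> > 0"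
  shows "has_bochner_integral lborel (\<lambda>u. gauss_dual \<zeta> u * cis (w * u)) (exp (- \<zeta> * (of_real w)\<^sup>2 / 2))"
proof -
  have z: "\<zeta> \<noteq> 0" using assms by auto
  have "Re (inverse \<zeta>) > 0" using assms z by (simp add: Re_divide inverse_eq_divide)
     (simp add: add_nonneg_eq_0_iff complex_eq_iff not_le sum_power2_gt_zero_iff divide_pos_pos)
  from has_bochner_integral_gauss_fun[OF this, of w]
  have "has_bochner_integral lborel (\<lambda>u. of_real (sqrt (2 * pi)) / csqrt \<zeta> / of_real (2 * pi) * gauss_fun (inverse \<zeta>) w u)
    (of_real (sqrt (2 * pi)) / csqrt \<zeta> / of_real (2 * pi) * gauss_ft (inverse \<zeta>) w)"
    by (rule has_bochner_integral_mult_right)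
  moreover have "of_real (sqrt (2 * pi)) / csqrt \<zeta> / of_real (2 * pi) * gauss_ft (inverse \<zeta>) w = exp (- \<zeta> * (of_real w)\<^sup>2 / 2)"
  proof -
    have "complex_of_real (sqrt (2 * pi)) * of_real (sqrt (2 * pi)) = of_real (2 * pi)"
      by (simp flip: of_real_mult)
    moreover have "csqrt \<zeta> \<noteq> 0" using z by simp
    ultimately show ?thesis
      using z unfolding gauss_ft_def csqrt_inverse[OF Re_pos_nonpos_Reals[OF assms]]
      by (simp add: field_simps)
  qed
  moreover have "of_real (sqrt (2 * pi)) / csqrt \<zeta> / of_real (2 * pi) * gauss_fun (inverse \<zeta>) w u = gauss_dual \<zeta> u * cis (w * u)" for u
    using z by (simp add: gauss_dual_def gauss_ft_def gauss_fun_def field_simps)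
  ultimately show ?thesis by simp
qed

section \<open>The mollified wave kernel as a superposition of Gaussians\<close>

text \<open>By Cauchy's formula on the circle of radius \<open>\<epsilon> / 2\<close> around \<open>\<epsilon>\<close>, the product of
  \<open>(- l / 2) ^ n / fact n\<close> and \<open>exp (- \<epsilon> * l / 2)\<close> is a weighted mean of \<open>exp (- \<zeta> * l / 2)\<close> over \<open>\<zeta>\<close> on the circle.
  With \<open>l = r\<^sup>2\<close>, the coefficients \<open>wcoef\<close> below resum these terms to the sine series of
  \<open>sin (\<sigma> * r) / r * exp (- \<epsilon> * r\<^sup>2 / 2)\<close>.\<close>
definition circ :: "real \<Rightarrow> real \<Rightarrow> complex" where
  "circ \<epsilon> \<theta> = of_real \<epsilon> + of_real (\<epsilon> / 2) * cis (2 * pi * \<theta>)"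

text \<open>Normalised arc length on the circle. As a probability measure it turns bounds uniform in
  \<theta> into bounds for the mixture.\<close>

definition Theta :: "real measure" where
  "Theta = density lborel (indicator {0..1})"

lemma sets_Theta [measurable_cong, simp]: "sets Theta = sets borel"
  and space_Theta [simp]: "space Theta = UNIV"
  by (auto simp: Theta_def)

lemma prob_space_Theta: "prob_space Theta"
  by standard (simp add: Theta_def emeasure_density)

lemma integral_Theta:
  fixes f :: "real \<Rightarrow> complex"
  assumes "continuous_on {0..1} f" and f: "f \<in> borel_measurable borel"
  shows "integrable Theta f" "integral\<^sup>L Theta f = integral {0..1} f"
proof -
  have si: "set_integrable lborel {0..1} f"
    by (rule borel_integrable_atLeastAtMost') (use assms in auto)
  have D: "Theta = density lborel (\<lambda>x. ennreal (indicator {0..1} x))"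
    by (simp add: Theta_def ennreal_indicator)
  show "integrable Theta f" "integral\<^sup>L Theta f = integral {0..1} f"
    using si set_borel_integral_eq_integral(2)[OF si] f unfolding D
    by (simp_all add: integrable_density integral_density set_integrable_def set_lebesgue_integral_def)
qed

lemma circ_measurable [measurable]: "circ \<epsilon> \<in> borel_measurable borel"
  unfolding circ_def cis_conv_exp by measurable

lemma continuous_on_circ [continuous_intros]: "continuous_on A (circ \<epsilon>)"
  unfolding circ_def cis_conv_exp by (intro continuous_intros)

text \<open>With centre \<epsilon> and radius \<epsilon> / 2 the circle stays at distance \<epsilon>
  / 2 from the imaginary axis, so all Gaussians on it decay at a common rate.\<close>

lemma Re_circ_ge: "0 \<le> \<epsilon> \<Longrightarrow> \<epsilon> / 2 \<le> Re (circ \<epsilon> \<theta>)"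
  using mult_left_mono[OF cos_ge_minus_one[of "2 * pi * \<theta>"], of "\<epsilon> / 2"] by (simp add: circ_def)

lemma Re_circ_pos: "0 < \<epsilon> \<Longrightarrow> 0 < Re (circ \<epsilon> \<theta>)"
  using Re_circ_ge[of \<epsilon> \<theta>] by simp

lemma norm_circ_ge: "0 \<le> \<epsilon> \<Longrightarrow> \<epsilon> / 2 \<le> norm (circ \<epsilon> \<theta>)"
  using Re_circ_ge[of \<epsilon> \<theta>] complex_Re_le_cmod[of "circ \<epsilon> \<theta>"] by simp

lemma norm_circ_le: "0 \<le> \<epsilon> \<Longrightarrow> norm (circ \<epsilon> \<theta>) \<le> 3 * \<epsilon> / 2"
  using norm_triangle_ineq[of "of_real \<epsilon>" "of_real (\<epsilon> / 2) * cis (2 * pi * \<theta>)"]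
  by (simp add: circ_def norm_mult)

lemma higher_deriv_exp_scale: "(deriv ^^ n) (\<lambda>u. exp (c * u)) = (\<lambda>u::complex. c ^ n * exp (c * u))"
proof (induction n)
  case (Suc n)
  have "((\<lambda>u. c ^ n * exp (c * u)) has_field_derivative c ^ Suc n * exp (c * u)) (at u)" for u
    by (auto intro!: derivative_eq_intros)
  hence "deriv (\<lambda>u. c ^ n * exp (c * u)) = (\<lambda>u. c ^ Suc n * exp (c * u))"
    by (intro ext DERIV_imp_deriv)
  thus ?case using Suc.IH by simp
qed simp

text \<open>Cauchy's formula for the n-th derivative of exp (c * u) at \<epsilon>. On the circle,
  cis (- 2 * pi * n * \<theta>) is the inverse n-th power of u - \<epsilon> up to the radius; the
  remaining power in the denominator cancels against du.\<close>

lemma circ_moment: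
  assumes \<epsilon>: "\<epsilon> > 0"
  shows "(\<integral>\<theta>. cis (- (2 * pi * real n * \<theta>)) * exp (c * circ \<epsilon> \<theta>) \<partial>Theta)
    = (of_real (\<epsilon> / 2) * c) ^ n * exp (c * of_real \<epsilon>) / fact n"
proof -
  let ?r = "\<epsilon> / 2"
  have "((\<lambda>u. exp (c * u) / (u - of_real \<epsilon>) ^ Suc n) has_contour_integral
      (2 * pi * \<i>) / fact n * (deriv ^^ n) (\<lambda>u. exp (c * u)) (of_real \<epsilon>)) (circlepath (of_real \<epsilon>) ?r)"
    by (rule Cauchy_has_contour_integral_higher_derivative_circlepath)
       (use \<epsilon> in \<open>auto intro!: continuous_intros holomorphic_intros\<close>)
  hence "((\<lambda>\<theta>. exp (c * circlepath (of_real \<epsilon>) ?r \<theta>) / (circlepath (of_real \<epsilon>) ?r \<theta> - of_real \<epsilon>) ^ Suc n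
       * vector_derivative (circlepath (of_real \<epsilon>) ?r) (at \<theta> within {0..1})) has_integral
      (2 * pi * \<i>) / fact n * (c ^ n * exp (c * of_real \<epsilon>))) {0..1}"
    by (simp add: has_contour_integral_def higher_deriv_exp_scale)
  hence "((\<lambda>\<theta>. 2 * pi * \<i> / of_real ?r ^ n * (cis (- (2 * pi * real n * \<theta>)) * exp (c * circ \<epsilon> \<theta>))) has_integral
      (2 * pi * \<i>) / fact n * (c ^ n * exp (c * of_real \<epsilon>))) {0..1}"
  proof (rule has_integral_eq[rotated])
    fix \<theta> :: real assume \<theta>: "\<theta> \<in> {0..1}"
    have c: "circlepath (of_real \<epsilon>) ?r \<theta> = circ \<epsilon> \<theta>"
      by (simp add: circlepath circ_def cis_conv_exp mult_ac)
    have d: "circ \<epsilon> \<theta> - of_real \<epsilon> = of_real ?r * cis (2 * pi * \<theta>)" by (simp add: circ_def)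
    have v: "vector_derivative (circlepath (of_real \<epsilon>) ?r) (at \<theta> within {0..1}) = 2 * pi * \<i> * ?r * cis (2 * pi * \<theta>)"
      using \<theta> by (simp add: vector_derivative_circlepath01 cis_conv_exp mult_ac)
    have p: "cis (2 * pi * \<theta>) ^ n = inverse (cis (- (2 * pi * real n * \<theta>)))"
      by (simp add: Complex.DeMoivre cis_inverse mult_ac)
    show "exp (c * circlepath (of_real \<epsilon>) ?r \<theta>) / (circlepath (of_real \<epsilon>) ?r \<theta> - of_real \<epsilon>) ^ Suc n
       * vector_derivative (circlepath (of_real \<epsilon>) ?r) (at \<theta> within {0..1}) =
       2 * pi * \<i> / of_real ?r ^ n * (cis (- (2 * pi * real n * \<theta>)) * exp (c * circ \<epsilon> \<theta>))"
      unfolding c d v power_mult_distrib power_Suc p using \<epsilon> by (simp add: field_simps)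
  qed
  hence "((\<lambda>\<theta>. of_real ?r ^ n / (2 * pi * \<i>) * (2 * pi * \<i> / of_real ?r ^ n * (cis (- (2 * pi * real n * \<theta>)) * exp (c * circ \<epsilon> \<theta>)))) has_integral
      of_real ?r ^ n / (2 * pi * \<i>) * ((2 * pi * \<i>) / fact n * (c ^ n * exp (c * of_real \<epsilon>)))) {0..1}"
    by (rule has_integral_mult_right)
  hence "((\<lambda>\<theta>. cis (- (2 * pi * real n * \<theta>)) * exp (c * circ \<epsilon> \<theta>)) has_integral
      (of_real ?r * c) ^ n * exp (c * of_real \<epsilon>) / fact n) {0..1}"
    using \<epsilon> by (simp add: power_mult_distrib field_simps)
  moreover have "continuous_on {0..1} (\<lambda>\<theta>. cis (- (2 * pi * real n * \<theta>)) * exp (c * circ \<epsilon> \<theta>))"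
    unfolding cis_conv_exp by (intro continuous_intros)
  moreover have "(\<lambda>\<theta>. cis (- (2 * pi * real n * \<theta>)) * exp (c * circ \<epsilon> \<theta>)) \<in> borel_measurable borel"
    unfolding cis_conv_exp by measurable
  ultimately show ?thesis by (simp add: integral_Theta integral_unique)
qed

text \<open>Chosen to undo \<open>circ_moment\<close> with c = - r^2 / 2: \<open>fact n\<close>
  cancels the factorial of Cauchy's formula and 4 / \<epsilon> cancels the \<epsilon> / 4 in
  \<epsilon> / 2 * (- r^2 / 2). What remains is the n-th term of the series of sin (\<sigma> * r) /
  r.\<close>

definition wcoef :: "real \<Rightarrow> real \<Rightarrow> nat \<Rightarrow> real" where
  "wcoef \<epsilon> \<sigma> n = fact n / fact (2 * n + 1) * (4 / \<epsilon>) ^ n * \<sigma> ^ (2 * n + 1)"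

definition wsum :: "real \<Rightarrow> real \<Rightarrow> real" where
  "wsum \<epsilon> \<sigma> = (\<Sum>n. wcoef \<epsilon> \<sigma> n)"

definition wdens :: "real \<Rightarrow> real \<Rightarrow> real \<Rightarrow> complex" where
  "wdens \<epsilon> \<sigma> \<theta> = (\<Sum>n. of_real (wcoef \<epsilon> \<sigma> n) * cis (- (2 * pi * real n * \<theta>)))"

text \<open>Since (n!)^2 divides (2n)!, the coefficients are dominated by those of an exponential
  series, so the sum converges for every \<sigma> however small \<epsilon> is.\<close>

lemma fact_div_fact_le: "(fact n :: real) / fact (2 * n + 1) \<le> 1 / fact n"
proof -
  have "(fact n * fact n :: nat) dvd fact (n + n)" by (rule fact_fact_dvd_fact)
  hence "(fact n * fact n :: nat) \<le> fact (n + n)" by (rule dvd_imp_le) simp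
  also have "\<dots> \<le> fact (2 * n + 1)" by (intro fact_mono) simp
  finally have "real (fact n * fact n) \<le> real (fact (2 * n + 1))" by (simp only: of_nat_le_iff)
  moreover have "f / F \<le> 1 / f" if "0 < f" "0 < F" "f * f \<le> F" for f F :: real
    using that by (simp add: field_simps)
  ultimately show ?thesis by (simp del: fact_Suc)
qed

lemma summable_wcoef_powser: "summable (\<lambda>n. fact n / fact (2 * n + 1) * (4 / \<epsilon>) ^ n * x ^ n :: real)"
proof (rule summable_comparison_test')
  show "summable (\<lambda>n. inverse (fact n) * \<bar>4 / \<epsilon> * x\<bar> ^ n)" by (rule summable_exp)
  fix n :: nat assume "n \<ge> 0"
  have "norm (fact n / fact (2 * n + 1) * (4 / \<epsilon>) ^ n * x ^ n) = fact n / fact (2 * n + 1) * \<bar>4 / \<epsilon> * x\<bar> ^ n"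
    by (simp add: abs_mult power_mult_distrib power_abs power_divide)
  also have "\<dots> \<le> 1 / fact n * \<bar>4 / \<epsilon> * x\<bar> ^ n"
    by (intro mult_right_mono fact_div_fact_le) auto
  finally show "norm (fact n / fact (2 * n + 1) * (4 / \<epsilon>) ^ n * x ^ n) \<le> inverse (fact n) * \<bar>4 / \<epsilon> * x\<bar> ^ n"
    by (simp add: divide_inverse)
qed

lemma wcoef_eq: "wcoef \<epsilon> \<sigma> n = \<sigma> * (fact n / fact (2 * n + 1) * (4 / \<epsilon>) ^ n * (\<sigma>\<^sup>2) ^ n)"
  by (simp add: wcoef_def power_mult)

lemma summable_wcoef: "summable (wcoef \<epsilon> \<sigma>)"
  unfolding wcoef_eq[abs_def] by (intro summable_mult summable_wcoef_powser)

lemma wcoef_mono: "\<epsilon> > 0 \<Longrightarrow> 0 \<le> \<sigma> \<Longrightarrow> \<sigma> \<le> \<sigma>' \<Longrightarrow> wcoef \<epsilon> \<sigma> n \<le> wcoef \<epsilon> \<sigma>' n"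
  unfolding wcoef_def by (intro mult_left_mono power_mono mult_nonneg_nonneg) auto

lemma wcoef_nonneg: "\<epsilon> > 0 \<Longrightarrow> 0 \<le> \<sigma> \<Longrightarrow> 0 \<le> wcoef \<epsilon> \<sigma> n"
  unfolding wcoef_def by simp

lemma continuous_wsum: "isCont (wsum \<epsilon>) \<sigma>"
proof -
  have "wsum \<epsilon> = (\<lambda>\<sigma>. \<sigma> * (\<Sum>n. fact n / fact (2 * n + 1) * (4 / \<epsilon>) ^ n * (\<sigma>\<^sup>2) ^ n))"
    unfolding wsum_def wcoef_eq by (intro ext suminf_mult summable_wcoef_powser)
  moreover have "isCont (\<lambda>x. \<Sum>n. fact n / fact (2 * n + 1) * (4 / \<epsilon>) ^ n * x ^ n :: real) (\<sigma>\<^sup>2)"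
    by (rule isCont_powser_converges_everywhere[OF summable_wcoef_powser])
  hence "isCont (\<lambda>\<sigma>. \<Sum>n. fact n / fact (2 * n + 1) * (4 / \<epsilon>) ^ n * (\<sigma>\<^sup>2) ^ n :: real) \<sigma>"
    by (rule isCont_o2[rotated]) (intro continuous_intros)
  ultimately show ?thesis by (simp only:) (intro continuous_mult continuous_ident)
qed

lemma summable_wdens: "summable (\<lambda>n. norm (of_real (wcoef \<epsilon> \<sigma> n) * cis (- (2 * pi * real n * \<theta>))))" if "\<epsilon> > 0" "\<sigma> \<ge> 0"
  using summable_wcoef[of \<epsilon> \<sigma>] that by (simp add: norm_mult wcoef_nonneg)

text \<open>All coefficients are nondecreasing in \<sigma> \<ge> 0, so the absolute differences add
  up to an increment of the monotone function \<open>wsum\<close>. This controls the variation in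
  time uniformly in \<theta>.\<close>

lemma norm_wdens_diff_le:
  assumes "\<epsilon> > 0" "0 \<le> \<sigma>'" "\<sigma>' \<le> \<sigma>"
  shows "norm (wdens \<epsilon> \<sigma> \<theta> - wdens \<epsilon> \<sigma>' \<theta>) \<le> wsum \<epsilon> \<sigma> - wsum \<epsilon> \<sigma>'"
proof -
  have "wdens \<epsilon> \<sigma> \<theta> - wdens \<epsilon> \<sigma>' \<theta> = (\<Sum>n. of_real (wcoef \<epsilon> \<sigma> n) * cis (- (2 * pi * real n * \<theta>)) - of_real (wcoef \<epsilon> \<sigma>' n) * cis (- (2 * pi * real n * \<theta>)))"
    unfolding wdens_def using assms by (intro suminf_diff summable_norm_cancel[OF summable_wdens]) auto
  also have "\<dots> = (\<Sum>n. of_real (wcoef \<epsilon> \<sigma> n - wcoef \<epsilon> \<sigma>' n) * cis (- (2 * pi * real n * \<theta>)))"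
    by (simp add: algebra_simps)
  also have "norm \<dots> \<le> (\<Sum>n. norm (of_real (wcoef \<epsilon> \<sigma> n - wcoef \<epsilon> \<sigma>' n) * cis (- (2 * pi * real n * \<theta>))))"
    using assms by (intro summable_norm)
      (auto simp: norm_mult wcoef_mono summable_diff summable_wcoef simp flip: of_real_diff)
  also have "\<dots> = (\<Sum>n. wcoef \<epsilon> \<sigma> n - wcoef \<epsilon> \<sigma>' n)"
    using assms by (auto simp: norm_mult wcoef_mono simp flip: of_real_diff)
  also have "\<dots> = wsum \<epsilon> \<sigma> - wsum \<epsilon> \<sigma>'"
    unfolding wsum_def by (intro suminf_diff[symmetric] summable_wcoef)
  finally show ?thesis .
qed

lemma wdens_0 [simp]: "wdens \<epsilon> 0 \<theta> = 0" and wsum_0 [simp]: "wsum \<epsilon> 0 = 0"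
  by (simp_all add: wdens_def wsum_def wcoef_def)

lemma norm_wdens_le: "\<epsilon> > 0 \<Longrightarrow> 0 \<le> \<sigma> \<Longrightarrow> norm (wdens \<epsilon> \<sigma> \<theta>) \<le> wsum \<epsilon> \<sigma>"
  using norm_wdens_diff_le[of \<epsilon> 0 \<sigma> \<theta>] by simp

lemma wsum_mono: "\<epsilon> > 0 \<Longrightarrow> 0 \<le> \<sigma>' \<Longrightarrow> \<sigma>' \<le> \<sigma> \<Longrightarrow> wsum \<epsilon> \<sigma>' \<le> wsum \<epsilon> \<sigma>"
  unfolding wsum_def by (intro suminf_le wcoef_mono summable_wcoef)

lemma wdens_measurable [measurable]: "wdens \<epsilon> \<sigma> \<in> borel_measurable borel"
  unfolding wdens_def[abs_def] cis_conv_exp by measurable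

text \<open>Sum and integral may be exchanged because the exponential factor has modulus at most 1,
  leaving the summable majorant \<open>wcoef\<close>. Each moment then produces one term of the sine
  series.\<close>

lemma wave_superposition:
  assumes \<epsilon>: "\<epsilon> > 0" and \<sigma>: "\<sigma> \<ge> 0" and r: "r \<noteq> 0"
  shows "(\<integral>\<theta>. wdens \<epsilon> \<sigma> \<theta> * exp (- circ \<epsilon> \<theta> * (of_real r)\<^sup>2 / 2) \<partial>Theta)
     = of_real (sin (\<sigma> * r) / r * exp (- \<epsilon> * r\<^sup>2 / 2))"
proof -
  interpret prob_space Theta by (rule prob_space_Theta)
  define c :: complex where "c = - (of_real r)\<^sup>2 / 2"
  have e: "- circ \<epsilon> \<theta> * (of_real r)\<^sup>2 / 2 = c * circ \<epsilon> \<theta>" for \<theta> by (simp add: c_def)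
  let ?f = "\<lambda>n \<theta>. of_real (wcoef \<epsilon> \<sigma> n) * cis (- (2 * pi * real n * \<theta>)) * exp (c * circ \<epsilon> \<theta>)"
  have nE: "norm (exp (c * circ \<epsilon> \<theta>)) \<le> 1" for \<theta>
    using Re_circ_pos[OF \<epsilon>, of \<theta>] by (simp add: c_def flip: of_real_power)
  have nf: "norm (?f n \<theta>) \<le> wcoef \<epsilon> \<sigma> n" for n \<theta>
    using mult_left_mono[OF nE wcoef_nonneg[OF \<epsilon> \<sigma>], of n \<theta>] wcoef_nonneg[OF \<epsilon> \<sigma>]
    by (simp add: norm_mult)
  have [measurable]: "?f n \<in> borel_measurable borel" for n unfolding cis_conv_exp by measurable
  have int: "integrable Theta (?f n)" for n
    by (rule integrable_const_bound[where B = "wcoef \<epsilon> \<sigma> n"]) (use nf in auto)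
  have sm: "summable (\<lambda>n. norm (?f n \<theta>))" for \<theta>
    by (rule summable_comparison_test'[OF summable_wcoef]) (use nf in auto)
  have "(\<lambda>n. \<integral>\<theta>. ?f n \<theta> \<partial>Theta) sums (\<integral>\<theta>. (\<Sum>n. ?f n \<theta>) \<partial>Theta)"
  proof (rule sums_integral[OF int])
    show "summable (\<lambda>n. \<integral>\<theta>. norm (?f n \<theta>) \<partial>Theta)"
    proof (rule summable_comparison_test'[OF summable_wcoef])
      fix n :: nat
      have "(\<integral>\<theta>. norm (?f n \<theta>) \<partial>Theta) \<le> wcoef \<epsilon> \<sigma> n"
        using nf int by (intro integral_le_const) auto
      thus "norm (\<integral>\<theta>. norm (?f n \<theta>) \<partial>Theta) \<le> wcoef \<epsilon> \<sigma> n" by simp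
    qed
  qed (use sm in auto)
  moreover have "(\<Sum>n. ?f n \<theta>) = wdens \<epsilon> \<sigma> \<theta> * exp (c * circ \<epsilon> \<theta>)" for \<theta>
    unfolding wdens_def using \<epsilon> \<sigma> by (intro suminf_mult2[symmetric] summable_norm_cancel[OF summable_wdens]) auto
  moreover have "(\<integral>\<theta>. ?f n \<theta> \<partial>Theta) = of_real ((-1) ^ n / fact (2 * n + 1) * (\<sigma> * r) ^ (2 * n + 1) / r * exp (- \<epsilon> * r\<^sup>2 / 2))" for n
  proof -
    have "(\<integral>\<theta>. ?f n \<theta> \<partial>Theta) = of_real (wcoef \<epsilon> \<sigma> n) * ((of_real (\<epsilon> / 2) * c) ^ n * exp (c * of_real \<epsilon>) / fact n)"
      using circ_moment[OF \<epsilon>, of n c] by (simp add: mult.assoc)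
    also have "\<dots> = of_real (wcoef \<epsilon> \<sigma> n * (\<epsilon> / 2 * (- r\<^sup>2 / 2)) ^ n * exp (- \<epsilon> * r\<^sup>2 / 2) / fact n)"
      by (simp add: c_def exp_of_real[symmetric] mult_ac del: exp_of_real)
    also have "wcoef \<epsilon> \<sigma> n * (\<epsilon> / 2 * (- r\<^sup>2 / 2)) ^ n * exp (- \<epsilon> * r\<^sup>2 / 2) / fact n
      = (-1) ^ n / fact (2 * n + 1) * (\<sigma> * r) ^ (2 * n + 1) / r * exp (- \<epsilon> * r\<^sup>2 / 2)"
    proof -
      have "(4 / \<epsilon>) ^ n * (\<epsilon> / 2 * (- r\<^sup>2 / 2)) ^ n = (- r\<^sup>2) ^ n"
        using \<epsilon> by (simp flip: power_mult_distrib)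
      also have "\<dots> = (-1) ^ n * r ^ (2 * n)" by (subst power_minus) (simp add: power_mult)
      finally have "(4 / \<epsilon>) ^ n * (\<epsilon> / 2 * (- r\<^sup>2 / 2)) ^ n = (-1) ^ n * r ^ (2 * n)" .
      hence "wcoef \<epsilon> \<sigma> n * (\<epsilon> / 2 * (- r\<^sup>2 / 2)) ^ n = fact n / fact (2 * n + 1) * \<sigma> ^ (2 * n + 1) * ((-1) ^ n * r ^ (2 * n))"
        unfolding wcoef_def by (simp add: mult_ac)
      thus ?thesis using r by (simp only:) (simp add: power_mult_distrib)
    qed
    finally show ?thesis .
  qed
  ultimately have "(\<lambda>n. complex_of_real ((-1) ^ n / fact (2 * n + 1) * (\<sigma> * r) ^ (2 * n + 1) / r * exp (- \<epsilon> * r\<^sup>2 / 2))) sums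
     (\<integral>\<theta>. wdens \<epsilon> \<sigma> \<theta> * exp (c * circ \<epsilon> \<theta>) \<partial>Theta)" by simp
  moreover have "(\<lambda>n. complex_of_real ((-1) ^ n / fact (2 * n + 1) * (\<sigma> * r) ^ (2 * n + 1) / r * exp (- \<epsilon> * r\<^sup>2 / 2))) sums
     of_real (sin (\<sigma> * r) / r * exp (- \<epsilon> * r\<^sup>2 / 2))"
    unfolding sums_of_real_iff by (intro sums_mult2 sums_divide sin_paired)
  ultimately show ?thesis unfolding e by (rule sums_unique2)
qed

section \<open>Decay and variation of the Gaussian factors, uniformly on the circle\<close>

lemma integrable_inverse_one_plus_square: "integrable lborel (\<lambda>u::real. 1 / (1 + u\<^sup>2))"
proof (rule integrable_cong_AE_imp[OF integrable_powr_over_square[of 0]])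
  show "AE u::real in lborel. \<bar>u\<bar> powr 0 / (1 + u\<^sup>2) = 1 / (1 + u\<^sup>2)"
    using AE_lborel_singleton[of 0] by eventually_elim (subst powr_zero_eq_one, simp)
qed auto

lemma exp_neg_le_inverse: "0 \<le> x \<Longrightarrow> exp (- x) \<le> 1 / (1 + x)" for x :: real
  using exp_ge_add_one_self[of x] by (simp add: exp_minus field_simps)

text \<open>With z on the circle, Re (1 / (2 * z)) = Re z / (2 * |z|^2). Since Re z \<ge> \<epsilon>
  / 2 and |z| \<le> 3 * \<epsilon> / 2, this is at least 1 / (9 * \<epsilon>), the rate in the
  exponent.\<close>

lemma norm_gauss_dual_circ:
  assumes \<epsilon>: "\<epsilon> > 0"
  shows "norm (gauss_dual (circ \<epsilon> \<theta>) u) \<le> 1 / sqrt \<epsilon> * exp (- u\<^sup>2 / (9 * \<epsilon>))"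
proof -
  let ?z = "circ \<epsilon> \<theta>"
  have "Re (1 / (2 * ?z)) = Re ?z / (2 * (norm ?z)\<^sup>2)"
  proof -
    have "1 / (2 * ?z) = cnj ?z / of_real (2 * (norm ?z)\<^sup>2)"
      by (subst complex_div_cnj) (simp add: norm_mult power_mult_distrib)
    thus ?thesis by (simp only: Re_divide_of_real) simp
  qed
  also have "\<dots> \<ge> (\<epsilon> / 2) / (2 * (3 * \<epsilon> / 2)\<^sup>2)"
    using \<epsilon> Re_circ_ge[of \<epsilon> \<theta>] norm_circ_ge[of \<epsilon> \<theta>] norm_circ_le[of \<epsilon> \<theta>]
    by (intro frac_le mult_left_mono power_mono mult_pos_pos zero_less_power) auto
  also have "(\<epsilon> / 2) / (2 * (3 * \<epsilon> / 2)\<^sup>2) = 1 / (9 * \<epsilon>)"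
    using \<epsilon> by (simp add: power2_eq_square field_simps)
  finally have "1 / (9 * \<epsilon>) \<le> Re (1 / (2 * ?z))" .
  hence "- u\<^sup>2 * Re (1 / (2 * ?z)) \<le> - u\<^sup>2 * (1 / (9 * \<epsilon>))" by (intro mult_left_mono_neg) auto
  moreover have "- (of_real u)\<^sup>2 / (2 * ?z) = of_real (- u\<^sup>2) * (1 / (2 * ?z))" by simp
  hence "Re (- (of_real u)\<^sup>2 / (2 * ?z)) = - u\<^sup>2 * Re (1 / (2 * ?z))"
    by (simp only: times_complex.sel Re_complex_of_real Im_complex_of_real)
  ultimately have 1: "norm (exp (- (of_real u)\<^sup>2 / (2 * ?z))) \<le> exp (- u\<^sup>2 / (9 * \<epsilon>))" by simp
  have "norm (gauss_dual ?z u) = sqrt (2 * pi) / (2 * pi) * (1 / sqrt (norm ?z)) * norm (exp (- (of_real u)\<^sup>2 / (2 * ?z)))"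
    by (simp add: gauss_dual_def gauss_ft_def norm_mult norm_divide)
  also have "\<dots> \<le> sqrt (2 * pi) / (2 * pi) * (1 / sqrt (\<epsilon> / 2)) * exp (- u\<^sup>2 / (9 * \<epsilon>))"
    using \<epsilon> norm_circ_ge[of \<epsilon> \<theta>]
    by (intro mult_mono[OF _ 1] mult_left_mono divide_left_mono real_sqrt_le_mono mult_pos_pos) auto
  also have "sqrt (2 * pi) / (2 * pi) * (1 / sqrt (\<epsilon> / 2)) = 1 / sqrt pi * (1 / sqrt \<epsilon>)"
    using \<epsilon> by (simp add: real_sqrt_mult real_sqrt_divide field_simps)
  also have "\<dots> \<le> 1 * (1 / sqrt \<epsilon>)"
    using pi_ge_two \<epsilon> by (intro mult_right_mono) (auto simp: real_le_rsqrt)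
  finally show ?thesis by simp
qed

lemma gauss_dual_deriv:
  assumes "Re \<zeta> > 0"
  shows "(gauss_dual \<zeta> has_vector_derivative - of_real u / \<zeta> * gauss_dual \<zeta> u) (at u within S)"
proof -
  have [simp]: "\<zeta> \<noteq> 0" using assms by auto
  have "((\<lambda>w. of_real (sqrt (2 * pi)) / csqrt \<zeta> * exp (- w\<^sup>2 / (2 * \<zeta>)) / of_real (2 * pi)) has_field_derivative
     - of_real u / \<zeta> * gauss_dual \<zeta> u) (at (of_real u))"
    unfolding gauss_dual_def gauss_ft_def by (rule derivative_eq_intros refl | simp)+
  thus ?thesis unfolding gauss_dual_def[abs_def] gauss_ft_def
    by (rule has_vector_derivative_real_field)
qed

text \<open>The first bound gives integrability. The second bounds the variation on [v, u]: the
  derivative is dominated by C / (1 + u^2), whose primitive C * arctan u is bounded. Both hold with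
  one constant for the whole circle.\<close>

lemma gauss_dual_circ_bounds:
  assumes \<epsilon>: "\<epsilon> > 0"
  obtains C where "C > 0" "\<And>\<theta> u. norm (gauss_dual (circ \<epsilon> \<theta>) u) \<le> C / (1 + u\<^sup>2)"
    "\<And>\<theta> u v. v \<le> u \<Longrightarrow> norm (gauss_dual (circ \<epsilon> \<theta>) u - gauss_dual (circ \<epsilon> \<theta>) v) \<le> C * (arctan u - arctan v)"
proof -
  \<comment> \<open>Half of the exponent, with rate 1 / (18 * \<epsilon>), is traded for one factor
    1 / (m * (1 + u^2)); m is such that m * (1 + u^2) \<le> 1 + u^2 / (18 * \<epsilon>). The second
    power obtained from the other half pays for the derivative.\<close>
  define m where "m = min 1 (1 / (18 * \<epsilon>))"
  have m: "0 < m" "m \<le> 1" "m \<le> 1 / (18 * \<epsilon>)" using \<epsilon> by (auto simp: m_def)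
  have e: "exp (- u\<^sup>2 / (9 * \<epsilon>)) \<le> 1 / (m\<^sup>2 * (1 + u\<^sup>2)\<^sup>2)" for u
  proof -
    have "exp (- u\<^sup>2 / (9 * \<epsilon>)) = (exp (- (u\<^sup>2 / (18 * \<epsilon>))))\<^sup>2"
      using \<epsilon> by (simp add: power2_eq_square flip: exp_add)
    also have "\<dots> \<le> (1 / (1 + u\<^sup>2 / (18 * \<epsilon>)))\<^sup>2"
      using \<epsilon> by (intro power_mono exp_neg_le_inverse) auto
    also have "\<dots> \<le> (1 / (m * (1 + u\<^sup>2)))\<^sup>2"
    proof -
      have "m * (1 + u\<^sup>2) = m + m * u\<^sup>2" by (simp add: algebra_simps)
      also have "\<dots> \<le> 1 + 1 / (18 * \<epsilon>) * u\<^sup>2" using m by (intro add_mono mult_right_mono) auto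
      finally have "m * (1 + u\<^sup>2) \<le> 1 + u\<^sup>2 / (18 * \<epsilon>)" by simp
      thus ?thesis using m \<epsilon> by (intro power_mono divide_left_mono mult_pos_pos add_pos_nonneg) auto
    qed
    finally show ?thesis by (simp add: power_divide power_mult_distrib)
  qed
  \<comment> \<open>In the last factor, 1 serves the function itself and 2 / \<epsilon> its
    derivative, whose extra factor |w| / |z| is at most (1 + w^2) / (\<epsilon> / 2).\<close>
  define C where "C = 1 / sqrt \<epsilon> * (1 / m\<^sup>2) * (1 + 2 / \<epsilon>)"
  have q: "1 \<le> 1 + u\<^sup>2" for u :: real by simp
  show ?thesis
  proof (rule that[of C])
    show "C > 0" using \<epsilon> m by (simp add: C_def add_pos_pos)
    fix \<theta> u
    have "norm (gauss_dual (circ \<epsilon> \<theta>) u) \<le> 1 / sqrt \<epsilon> * (1 / (m\<^sup>2 * (1 + u\<^sup>2)\<^sup>2))"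
      using norm_gauss_dual_circ[OF \<epsilon>, of \<theta> u] mult_left_mono[OF e[of u], of "1 / sqrt \<epsilon>"] \<epsilon> by simp
    also have "\<dots> = 1 / sqrt \<epsilon> * (1 / m\<^sup>2) * (1 / (1 + u\<^sup>2)) * (1 / (1 + u\<^sup>2))" by (simp add: power2_eq_square)
    finally have b: "norm (gauss_dual (circ \<epsilon> \<theta>) u) \<le> 1 / sqrt \<epsilon> * (1 / m\<^sup>2) * (1 / (1 + u\<^sup>2)) * (1 / (1 + u\<^sup>2))" .
    also have "\<dots> \<le> 1 / sqrt \<epsilon> * (1 / m\<^sup>2) * (1 + 2 / \<epsilon>) * (1 / (1 + u\<^sup>2))"
    proof -
      have "1 / (1 + u\<^sup>2) \<le> 1" using q[of u] by (subst divide_le_eq_1_pos) (auto simp: add_pos_nonneg)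
      also have "\<dots> \<le> 1 + 2 / \<epsilon>" using \<epsilon> by simp
      finally show ?thesis using \<epsilon> q[of u] by (intro mult_right_mono mult_left_mono) auto
    qed
    finally show "norm (gauss_dual (circ \<epsilon> \<theta>) u) \<le> C / (1 + u\<^sup>2)" by (simp add: C_def)
  next
    fix \<theta> :: real and u v :: real
    assume "v \<le> u"
    have bd: "norm (- of_real w / circ \<epsilon> \<theta> * gauss_dual (circ \<epsilon> \<theta>) w) \<le> C * (1 / (1 + w\<^sup>2))" for w
    proof -
      have b: "norm (gauss_dual (circ \<epsilon> \<theta>) w) \<le> 1 / sqrt \<epsilon> * (1 / m\<^sup>2) * (1 / (1 + w\<^sup>2)) * (1 / (1 + w\<^sup>2))"
        using norm_gauss_dual_circ[OF \<epsilon>, of \<theta> w] mult_left_mono[OF e[of w], of "1 / sqrt \<epsilon>"] \<epsilon> by (simp add: power2_eq_square mult.assoc)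
      have aw: "\<bar>w\<bar> \<le> 1 + w\<^sup>2" using sum_squares_bound[of 1 "\<bar>w\<bar>"] by (simp add: power2_eq_square)
      have "norm (- of_real w / circ \<epsilon> \<theta> * gauss_dual (circ \<epsilon> \<theta>) w) = \<bar>w\<bar> / norm (circ \<epsilon> \<theta>) * norm (gauss_dual (circ \<epsilon> \<theta>) w)"
        by (simp add: norm_mult norm_divide)
      also have "\<dots> \<le> (1 + w\<^sup>2) / (\<epsilon> / 2) * (1 / sqrt \<epsilon> * (1 / m\<^sup>2) * (1 / (1 + w\<^sup>2)) * (1 / (1 + w\<^sup>2)))"
        using \<epsilon> aw norm_circ_ge[of \<epsilon> \<theta>] by (intro mult_mono frac_le b) auto
      also have "\<dots> = 1 / sqrt \<epsilon> * (1 / m\<^sup>2) * (2 / \<epsilon>) * (1 / (1 + w\<^sup>2))"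
      proof -
        have h: "A / (\<epsilon> / 2) * (X * Y * (1 / A) * (1 / A)) = X * Y * (2 / \<epsilon>) * (1 / A)" if "A > 0" for A X Y :: real
          using that \<epsilon> by (simp add: field_simps)
        have "1 + w\<^sup>2 > 0" by (simp add: add_pos_nonneg)
        thus ?thesis by (rule h)
      qed
      also have "\<dots> \<le> C * (1 / (1 + w\<^sup>2))" unfolding C_def using \<epsilon> by (intro mult_right_mono mult_left_mono) auto
      finally show ?thesis .
    qed
    show "norm (gauss_dual (circ \<epsilon> \<theta>) u - gauss_dual (circ \<epsilon> \<theta>) v) \<le> C * (arctan u - arctan v)"
    proof (cases "v < u")
      case True
      have "norm (gauss_dual (circ \<epsilon> \<theta>) u - gauss_dual (circ \<epsilon> \<theta>) v) \<le> C * arctan u - C * arctan v"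
      proof (rule differentiable_bound_general[OF True, where \<phi>' = "\<lambda>w. C * (1 / (1 + w\<^sup>2))"])
        show "continuous_on {v..u} (gauss_dual (circ \<epsilon> \<theta>))"
          by (rule continuous_on_vector_derivative, rule gauss_dual_deriv[OF Re_circ_pos[OF \<epsilon>]])
        show "continuous_on {v..u} (\<lambda>u. C * arctan u)" by (intro continuous_intros)
        show "(gauss_dual (circ \<epsilon> \<theta>) has_vector_derivative - of_real w / circ \<epsilon> \<theta> * gauss_dual (circ \<epsilon> \<theta>) w) (at w)" for w
          by (rule gauss_dual_deriv[OF Re_circ_pos[OF \<epsilon>]])
        show "((\<lambda>w. C * arctan w) has_vector_derivative C * (1 / (1 + w\<^sup>2))) (at w)" for w
          by (auto intro!: derivative_eq_intros simp flip: has_real_derivative_iff_has_vector_derivative simp: inverse_eq_divide)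
      qed (rule bd)
      thus ?thesis by (simp add: right_diff_distrib)
    qed (use \<open>v \<le> u\<close> in simp)
  qed
qed

text \<open>The branch cut rules out an argument by continuity; measurability is read off from the
  explicit real and imaginary parts.\<close>

lemma csqrt_measurable [measurable]: "csqrt \<in> borel_measurable borel"
proof -
  have "csqrt = (\<lambda>z. of_real (sqrt ((cmod z + Re z) / 2)) +
      \<i> * of_real ((if Im z = 0 then 1 else sgn (Im z)) * sqrt ((cmod z - Re z) / 2)))"
    by (auto simp: fun_eq_iff complex_eq_iff)
  also have "\<dots> \<in> borel_measurable borel" by measurable
  finally show ?thesis .
qed

lemma gauss_dual_measurable [measurable (raw)]:
  assumes [measurable]: "f \<in> borel_measurable M" "g \<in> borel_measurable M"
  shows "(\<lambda>x. gauss_dual (f x) (g x)) \<in> borel_measurable M"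
  unfolding gauss_dual_def gauss_ft_def by measurable

lemma continuous_gauss_dual: "Re \<zeta> > 0 \<Longrightarrow> continuous_on A (gauss_dual \<zeta>)"
  by (rule continuous_on_vector_derivative, rule gauss_dual_deriv)

section \<open>The mollified kernel and its spatial Fourier transform\<close>

lemma norm_sq_vec: "(norm (x :: real^'d))\<^sup>2 = (\<Sum>i\<in>UNIV. (x $ i)\<^sup>2)"
  by (simp add: norm_vec_def L2_set_def sum_nonneg)

text \<open>The heat kernel is the product over the coordinates of \<open>gauss_dual\<close> at the
  real parameter \<epsilon>, so one-dimensional inversion applies in each coordinate.\<close>

lemma heat_kernel_ft_eq:
  assumes \<epsilon>: "\<epsilon> > 0"
  shows "heat_kernel_ft \<epsilon> (\<xi> :: real^'d) = exp (- \<epsilon> * (norm \<xi>)\<^sup>2 / 2)"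
proof -
  let ?f = "\<lambda>i u. gauss_dual (of_real \<epsilon>) u * cis (\<xi> $ i * u)"
  have e: "(\<Prod>i\<in>UNIV. ?f i (y $ i)) = of_real (heat_kernel \<epsilon> y) * cis (y \<bullet> \<xi>)" for y
  proof -
    have g: "gauss_dual (of_real \<epsilon>) u = of_real ((2 * pi * \<epsilon>) powr (- 1 / 2) * exp (- u\<^sup>2 / (2 * \<epsilon>)))" for u
    proof -
      have "sqrt (2 * pi) / sqrt \<epsilon> / (2 * pi) = 1 / sqrt (2 * pi * \<epsilon>)"
        using \<epsilon> by (simp add: real_sqrt_mult field_simps)
      also have "\<dots> = (2 * pi * \<epsilon>) powr (- 1 / 2)"
        using \<epsilon> by (simp add: powr_minus powr_half_sqrt inverse_eq_divide)
      finally have c: "sqrt (2 * pi) / sqrt \<epsilon> / (2 * pi) = (2 * pi * \<epsilon>) powr (- 1 / 2)" .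
      have "gauss_dual (of_real \<epsilon>) u = of_real (sqrt (2 * pi) / sqrt \<epsilon> / (2 * pi) * exp (- u\<^sup>2 / (2 * \<epsilon>)))"
        unfolding gauss_dual_def gauss_ft_def using \<epsilon>
        by (simp add: exp_of_real[symmetric] del: exp_of_real)
      thus ?thesis unfolding c .
    qed
    have "(\<Prod>i\<in>UNIV. gauss_dual (of_real \<epsilon>) (y $ i)) = of_real (\<Prod>i\<in>(UNIV::'d set). (2 * pi * \<epsilon>) powr (- 1 / 2) * exp (- (y $ i)\<^sup>2 / (2 * \<epsilon>)))"
      by (simp only: g of_real_prod)
    also have "(\<Prod>i\<in>(UNIV::'d set). (2 * pi * \<epsilon>) powr (- 1 / 2) * exp (- (y $ i)\<^sup>2 / (2 * \<epsilon>))) =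
      ((2 * pi * \<epsilon>) powr (- 1 / 2)) ^ CARD('d) * exp (\<Sum>i\<in>UNIV. - (y $ i)\<^sup>2 / (2 * \<epsilon>))"
      by (simp add: prod.distrib exp_sum)
    also have "((2 * pi * \<epsilon>) powr (- 1 / 2)) ^ CARD('d) = (2 * pi * \<epsilon>) powr (- real CARD('d) / 2)"
      using \<epsilon> by (simp add: powr_realpow[symmetric] powr_powr)
    also have "(\<Sum>i\<in>UNIV. - (y $ i)\<^sup>2 / (2 * \<epsilon>)) = - (norm y)\<^sup>2 / (2 * \<epsilon>)"
      by (simp add: norm_sq_vec sum_negf sum_divide_distrib)
    finally show ?thesis
      by (simp add: prod.distrib heat_kernel_def inner_vec_def cis_sum mult.commute)
  qed
  have gi: "has_bochner_integral lborel (?f i) (exp (- of_real \<epsilon> * (of_real (\<xi> $ i))\<^sup>2 / 2))" for i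
    by (rule gauss_dual_inverse) (use \<epsilon> in auto)
  have "(\<integral>y. of_real (heat_kernel \<epsilon> y) * cis (y \<bullet> \<xi>) \<partial>lborel) = (\<Prod>i\<in>UNIV. exp (- of_real \<epsilon> * (of_real (\<xi> $ i))\<^sup>2 / 2))"
    unfolding e[symmetric] using gi by (subst integral_vec_prod) (auto simp: has_bochner_integral_iff)
  also have "\<dots> = of_real (exp (- \<epsilon> * (norm \<xi>)\<^sup>2 / 2))"
    by (simp add: exp_sum[symmetric] norm_sq_vec sum_distrib_left sum_divide_distrib sum_negf exp_of_real[symmetric] del: exp_of_real)
  finally have I: "(\<integral>y. of_real (heat_kernel \<epsilon> y) * cis (y \<bullet> \<xi>) \<partial>lborel) = complex_of_real (exp (- \<epsilon> * (norm \<xi>)\<^sup>2 / 2))" .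
  have int: "integrable lborel (\<lambda>y. of_real (heat_kernel \<epsilon> y) * cis (y \<bullet> \<xi>))"
    unfolding e[symmetric] using gi by (intro integrable_vec_prod) (auto simp: has_bochner_integral_iff)
  have "heat_kernel_ft \<epsilon> \<xi> = (\<integral>y. Re (of_real (heat_kernel \<epsilon> y) * cis (y \<bullet> \<xi>)) \<partial>lborel)"
    by (simp add: heat_kernel_ft_def)
  also have "\<dots> = exp (- \<epsilon> * (norm \<xi>)\<^sup>2 / 2)" unfolding integral_Re[OF int] I by simp
  finally show ?thesis .
qed

text \<open>Applied once to Gaussians in frequency and once to their duals in space. The dominating
  functions D i do not depend on \<theta>, which makes the integrand integrable on the product
  space.\<close>

lemma Theta_superposition_Fubini:
  fixes h :: "'d::finite \<Rightarrow> real \<Rightarrow> real \<Rightarrow> complex"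
  assumes a [measurable]: "a \<in> borel_measurable borel" and aB: "\<And>\<theta>. norm (a \<theta>) \<le> B"
    and h: "\<And>i. case_prod (h i) \<in> borel_measurable (borel \<Otimes>\<^sub>M borel)"
    and hD: "\<And>i \<theta> u. norm (h i \<theta> u) \<le> D i u" and D: "\<And>i. integrable lborel (D i)"
  shows "integrable (lborel :: (real^'d) measure) (\<lambda>y. \<integral>\<theta>. a \<theta> * (\<Prod>i\<in>UNIV. h i \<theta> (y $ i)) \<partial>Theta)"
    and "(\<integral>y. (\<integral>\<theta>. a \<theta> * (\<Prod>i\<in>UNIV. h i \<theta> (y $ i)) \<partial>Theta) \<partial>(lborel :: (real^'d) measure))
       = (\<integral>\<theta>. a \<theta> * (\<Prod>i\<in>UNIV. \<integral>u. h i \<theta> u \<partial>lborel) \<partial>Theta)"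
proof -
  interpret T: prob_space Theta by (rule prob_space_Theta)
  have P: "pair_sigma_finite Theta (lborel :: (real^'d) measure)"
    unfolding pair_sigma_finite_def using T.sigma_finite_measure_axioms sigma_finite_lborel by blast
  interpret P: pair_sigma_finite Theta "lborel :: (real^'d) measure" by (rule P)
  have hm [measurable]: "(\<lambda>x. h i (f x) (g x)) \<in> borel_measurable M"
    if [measurable]: "f \<in> borel_measurable M" "g \<in> borel_measurable M" for f g and M :: "'m measure" and i
  proof -
    have "(\<lambda>x. case_prod (h i) (f x, g x)) \<in> borel_measurable M"
      by (rule measurable_compose[OF _ h]) measurable
    thus ?thesis by simp
  qed
  have int: "integrable (Theta \<Otimes>\<^sub>M (lborel :: (real^'d) measure)) (\<lambda>(\<theta>, y). a \<theta> * (\<Prod>i\<in>UNIV. h i \<theta> (y $ i)))"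
  proof (rule Bochner_Integration.integrable_bound)
    show "integrable (Theta \<Otimes>\<^sub>M (lborel :: (real^'d) measure)) (\<lambda>(\<theta>, y). B * (\<Prod>i\<in>UNIV. D i (y $ i)))"
      by (intro integrable_pair_times P integrable_vec_prod D) simp
    show "(\<lambda>(\<theta>, y). a \<theta> * (\<Prod>i\<in>UNIV. h i \<theta> (y $ i))) \<in> borel_measurable (Theta \<Otimes>\<^sub>M (lborel :: (real^'d) measure))"
      unfolding case_prod_beta'
      by (intro borel_measurable_times borel_measurable_prod hm) measurable
    show "AE x in Theta \<Otimes>\<^sub>M (lborel :: (real^'d) measure). norm (case x of (\<theta>, y) \<Rightarrow> a \<theta> * (\<Prod>i\<in>UNIV. h i \<theta> (y $ i)))
       \<le> norm (case x of (\<theta>, y) \<Rightarrow> B * (\<Prod>i\<in>UNIV. D i (y $ i)))"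
    proof (intro AE_I2, clarify)
      fix \<theta> :: real and y :: "real^'d"
      have D0: "0 \<le> D i u" for i u using hD[of i 0 u] norm_ge_zero order_trans by blast
      have B0: "0 \<le> B" using aB[of 0] norm_ge_zero order_trans by blast
      have "norm (a \<theta> * (\<Prod>i\<in>UNIV. h i \<theta> (y $ i))) = norm (a \<theta>) * (\<Prod>i\<in>UNIV. norm (h i \<theta> (y $ i)))"
        by (simp add: norm_mult prod_norm)
      also have "\<dots> \<le> B * (\<Prod>i\<in>UNIV. D i (y $ i))"
        using hD by (intro mult_mono aB prod_mono prod_nonneg B0) auto
      finally show "norm (a \<theta> * (\<Prod>i\<in>UNIV. h i \<theta> (y $ i))) \<le> norm (B * (\<Prod>i\<in>UNIV. D i (y $ i)))"
        using B0 D0 by (simp add: prod_nonneg)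
    qed
  qed
  show "integrable (lborel :: (real^'d) measure) (\<lambda>y. \<integral>\<theta>. a \<theta> * (\<Prod>i\<in>UNIV. h i \<theta> (y $ i)) \<partial>Theta)"
    using P.integrable_snd[OF int] by simp
  have hint: "integrable lborel (h i \<theta>)" for i \<theta>
    by (rule Bochner_Integration.integrable_bound[OF D[of i]])
       (use hD order_trans[OF hD abs_ge_self] in \<open>auto intro: hm\<close>)
  show "(\<integral>y. (\<integral>\<theta>. a \<theta> * (\<Prod>i\<in>UNIV. h i \<theta> (y $ i)) \<partial>Theta) \<partial>(lborel :: (real^'d) measure))
       = (\<integral>\<theta>. a \<theta> * (\<Prod>i\<in>UNIV. \<integral>u. h i \<theta> u \<partial>lborel) \<partial>Theta)"
  proof -
    have "(\<integral>y. (\<Prod>i\<in>UNIV. h i \<theta> (y $ i)) \<partial>(lborel :: (real^'d) measure)) = (\<Prod>i\<in>UNIV. \<integral>u. h i \<theta> u \<partial>lborel)" for \<theta>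
      by (rule integral_vec_prod) (rule hint)
    thus ?thesis unfolding P.Fubini_integral[OF int] by simp
  qed
qed

lemma prod_gauss_fun:
  "(\<Prod>i\<in>UNIV. gauss_fun \<zeta> (z $ i) (\<xi> $ i)) = cis (z \<bullet> \<xi>) * exp (- \<zeta> * (of_real (norm (\<xi> :: real^'d)))\<^sup>2 / 2)"
proof -
  have "- \<zeta> * (of_real (norm \<xi>))\<^sup>2 / 2 = (\<Sum>i\<in>UNIV. - \<zeta> * (of_real (\<xi> $ i))\<^sup>2 / 2)"
    by (simp add: norm_sq_vec sum_distrib_left sum_divide_distrib sum_negf flip: of_real_power)
  thus ?thesis
    by (simp only: gauss_fun_def prod.distrib exp_sum[OF finite] inner_vec_def cis_sum[OF finite] inner_real_def mult.commute)
qed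

lemma gauss_fun_measurable' [measurable (raw)]:
  assumes [measurable]: "f \<in> borel_measurable M" "g \<in> borel_measurable M" "h \<in> borel_measurable M"
  shows "(\<lambda>x. gauss_fun (f x) (g x) (h x)) \<in> borel_measurable M"
  unfolding gauss_fun_def cis_conv_exp by measurable

text \<open>The mollified wave kernel in mixture form. It is a complex number a priori; that it is
  real is part of \<open>moll_wave_kernel_eq\<close>.\<close>

definition kernel_int :: "real \<Rightarrow> real \<Rightarrow> real^'d \<Rightarrow> complex" where
  "kernel_int \<epsilon> \<sigma> z = (\<integral>\<theta>. wdens \<epsilon> \<sigma> \<theta> * (\<Prod>i\<in>UNIV. gauss_dual (circ \<epsilon> \<theta>) (z $ i)) \<partial>Theta)"

lemma wave_symbol_superposition:
  assumes "\<epsilon> > 0" "\<sigma> \<ge> 0" "(\<xi> :: real^'d) \<noteq> 0"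
  shows "(\<integral>\<theta>. wdens \<epsilon> \<sigma> \<theta> * exp (- circ \<epsilon> \<theta> * (of_real (norm \<xi>))\<^sup>2 / 2) \<partial>Theta) =
     of_real (wave_ft \<sigma> \<xi> * exp (- \<epsilon> * (norm \<xi>)\<^sup>2 / 2))"
  using wave_superposition[of \<epsilon> \<sigma> "norm \<xi>"] assms by (simp add: wave_ft_def)

lemma wave_symbol_fourier:
  fixes z :: "real^'d"
  assumes \<epsilon>: "\<epsilon> > 0" and \<sigma>: "\<sigma> \<ge> 0"
  shows "has_bochner_integral lborel (\<lambda>\<xi>. cis (z \<bullet> \<xi>) * of_real (wave_ft \<sigma> \<xi> * exp (- \<epsilon> * (norm \<xi>)\<^sup>2 / 2)))
           (of_real ((2 * pi) ^ CARD('d)) * kernel_int \<epsilon> \<sigma> z)"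
proof -
  note F = Theta_superposition_Fubini[of "wdens \<epsilon> \<sigma>" "wsum \<epsilon> \<sigma>" "\<lambda>i \<theta> u. gauss_fun (circ \<epsilon> \<theta>) (z $ i) u" "\<lambda>i u. exp (- (\<epsilon>/2) * u\<^sup>2 / 2)"]
  have nb: "norm (gauss_fun (circ \<epsilon> \<theta>) (z $ i) u) \<le> exp (- (\<epsilon>/2) * u\<^sup>2 / 2)" for i \<theta> u
    using mult_right_mono[OF Re_circ_ge[of \<epsilon> \<theta>], of "u\<^sup>2"] \<epsilon> by (simp add: norm_gauss_fun)
  have m: "case_prod (\<lambda>\<theta> u. gauss_fun (circ \<epsilon> \<theta>) (z $ i) u) \<in> borel_measurable (borel \<Otimes>\<^sub>M borel)" for i
    by measurable
  \<comment> \<open>At \<xi> = 0 the quotient in \<open>wave_ft\<close> has the value 0 instead of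
    the limit \<sigma>; the identity holds off this null set.\<close>
  have ae: "AE \<xi> in lborel. (\<integral>\<theta>. wdens \<epsilon> \<sigma> \<theta> * (\<Prod>i\<in>UNIV. gauss_fun (circ \<epsilon> \<theta>) (z $ i) (\<xi> $ i)) \<partial>Theta) =
     cis (z \<bullet> \<xi>) * of_real (wave_ft \<sigma> \<xi> * exp (- \<epsilon> * (norm \<xi>)\<^sup>2 / 2))"
    using AE_lborel_singleton[of 0]
  proof eventually_elim
    case (elim \<xi>)
    have "(\<integral>\<theta>. wdens \<epsilon> \<sigma> \<theta> * (\<Prod>i\<in>UNIV. gauss_fun (circ \<epsilon> \<theta>) (z $ i) (\<xi> $ i)) \<partial>Theta) =
       (\<integral>\<theta>. cis (z \<bullet> \<xi>) * (wdens \<epsilon> \<sigma> \<theta> * exp (- circ \<epsilon> \<theta> * (of_real (norm \<xi>))\<^sup>2 / 2)) \<partial>Theta)"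
      by (simp add: prod_gauss_fun mult_ac)
    thus ?case using wave_symbol_superposition[OF \<epsilon> \<sigma> elim] by simp
  qed
  have "has_bochner_integral lborel (\<lambda>\<xi>. \<integral>\<theta>. wdens \<epsilon> \<sigma> \<theta> * (\<Prod>i\<in>UNIV. gauss_fun (circ \<epsilon> \<theta>) (z $ i) (\<xi> $ i)) \<partial>Theta)
     (\<integral>\<theta>. wdens \<epsilon> \<sigma> \<theta> * (\<Prod>i\<in>UNIV. \<integral>u. gauss_fun (circ \<epsilon> \<theta>) (z $ i) u \<partial>lborel) \<partial>Theta)"
    unfolding has_bochner_integral_iff
    using F[OF wdens_measurable norm_wdens_le[OF \<epsilon> \<sigma>] m nb integrable_exp_neg_square[of "\<epsilon>/2"]] \<epsilon> by auto
  moreover have "(\<integral>u. gauss_fun (circ \<epsilon> \<theta>) w u \<partial>lborel) = of_real (2 * pi) * gauss_dual (circ \<epsilon> \<theta>) w" for \<theta> w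
    using has_bochner_integral_gauss_fun[OF Re_circ_pos[OF \<epsilon>], of \<theta> w]
    by (simp add: has_bochner_integral_iff gauss_dual_def)
  hence "(\<integral>\<theta>. wdens \<epsilon> \<sigma> \<theta> * (\<Prod>i\<in>UNIV. \<integral>u. gauss_fun (circ \<epsilon> \<theta>) (z $ i) u \<partial>lborel) \<partial>Theta)
     = (\<integral>\<theta>. of_real ((2 * pi) ^ CARD('d)) * (wdens \<epsilon> \<sigma> \<theta> * (\<Prod>i\<in>UNIV. gauss_dual (circ \<epsilon> \<theta>) (z $ i))) \<partial>Theta)"
    by (simp add: prod.distrib mult_ac)
  hence "(\<integral>\<theta>. wdens \<epsilon> \<sigma> \<theta> * (\<Prod>i\<in>UNIV. \<integral>u. gauss_fun (circ \<epsilon> \<theta>) (z $ i) u \<partial>lborel) \<partial>Theta)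
     = of_real ((2 * pi) ^ CARD('d)) * kernel_int \<epsilon> \<sigma> z"
    by (simp add: kernel_int_def)
  ultimately have "has_bochner_integral lborel (\<lambda>\<xi>. \<integral>\<theta>. wdens \<epsilon> \<sigma> \<theta> * (\<Prod>i\<in>UNIV. gauss_fun (circ \<epsilon> \<theta>) (z $ i) (\<xi> $ i)) \<partial>Theta)
     (of_real ((2 * pi) ^ CARD('d)) * kernel_int \<epsilon> \<sigma> z)" by simp
  thus ?thesis
  proof (rule has_bochner_integralI_AE[OF _ _ ae])
    show "(\<lambda>\<xi>. cis (z \<bullet> \<xi>) * of_real (wave_ft \<sigma> \<xi> * exp (- \<epsilon> * (norm \<xi>)\<^sup>2 / 2))) \<in> borel_measurable lborel"
      unfolding cis_conv_exp wave_ft_def by measurable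
  qed
qed

lemma gauss_dual_uminus [simp]: "gauss_dual \<zeta> (- u) = gauss_dual \<zeta> u"
  by (simp add: gauss_dual_def gauss_ft_def)

text \<open>The symbol is real, so conjugation replaces z by -z; every \<open>gauss_dual\<close> is
  even, so this changes nothing. Hence \<open>kernel_int\<close> is real and equals the cosine
  integral.\<close>

lemma moll_wave_kernel_eq:
  fixes z :: "real^'d"
  assumes \<epsilon>: "\<epsilon> > 0" and \<sigma>: "\<sigma> \<ge> 0"
  shows "of_real (moll_wave_kernel \<epsilon> \<sigma> z) = kernel_int \<epsilon> \<sigma> z"
proof -
  let ?\<phi> = "\<lambda>\<xi> :: real^'d. wave_ft \<sigma> \<xi> * exp (- \<epsilon> * (norm \<xi>)\<^sup>2 / 2)"
  let ?c = "(2 * pi) ^ CARD('d)"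
  have c: "?c > 0" by simp
  note 1 = wave_symbol_fourier[OF \<epsilon> \<sigma>, of z] and 2 = wave_symbol_fourier[OF \<epsilon> \<sigma>, of "- z"]
  have i: "integrable lborel (\<lambda>\<xi>. cis (z \<bullet> \<xi>) * of_real (?\<phi> \<xi>))" using 1 by (simp add: has_bochner_integral_iff)
  have "of_real ?c * kernel_int \<epsilon> \<sigma> (- z) = (\<integral>\<xi>. cnj (cis (z \<bullet> \<xi>) * of_real (?\<phi> \<xi>)) \<partial>lborel)"
    using 2 by (simp add: has_bochner_integral_iff cis_cnj)
  also have "\<dots> = cnj (of_real ?c * kernel_int \<epsilon> \<sigma> z)"
    using 1 by (subst Bochner_Integration.integral_cnj) (simp add: has_bochner_integral_iff)
  also have "\<dots> = of_real ?c * cnj (kernel_int \<epsilon> \<sigma> z)" by simp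
  finally have "cnj (kernel_int \<epsilon> \<sigma> z) = kernel_int \<epsilon> \<sigma> (- z)" using c by auto
  also have "\<dots> = kernel_int \<epsilon> \<sigma> z" by (simp add: kernel_int_def)
  finally have real: "of_real (Re (kernel_int \<epsilon> \<sigma> z)) = kernel_int \<epsilon> \<sigma> z"
    by (simp add: complex_eq_iff)
  have "?c * moll_wave_kernel \<epsilon> \<sigma> z = (\<integral>\<xi>. Re (cis (z \<bullet> \<xi>) * of_real (?\<phi> \<xi>)) \<partial>lborel)"
    using \<epsilon> by (simp add: moll_wave_kernel_def heat_kernel_ft_eq mult.assoc)
  also have "\<dots> = Re (of_real ?c * kernel_int \<epsilon> \<sigma> z)"
    using 1 unfolding integral_Re[OF i] by (simp only: has_bochner_integral_iff)
  also have "\<dots> = ?c * Re (kernel_int \<epsilon> \<sigma> z)" by (simp only: times_complex.sel Re_complex_of_real Im_complex_of_real)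
  finally have "moll_wave_kernel \<epsilon> \<sigma> z = Re (kernel_int \<epsilon> \<sigma> z)" using c by simp
  thus ?thesis using real by simp
qed

text \<open>The mixture inverts coordinate by coordinate, so the symbol is recovered from
  \<open>gauss_dual_inverse\<close> and a second use of the superposition formula.\<close>

lemma has_bochner_integral_moll_wave_kernel_ft:
  fixes w :: "real^'d"
  assumes \<epsilon>: "\<epsilon> > 0" and \<sigma>: "\<sigma> \<ge> 0" and w: "w \<noteq> 0"
  shows "has_bochner_integral lborel (\<lambda>z. of_real (moll_wave_kernel \<epsilon> \<sigma> z) * cis (w \<bullet> z))
           (of_real (wave_ft \<sigma> w * exp (- \<epsilon> * (norm w)\<^sup>2 / 2)))"
proof -
  obtain C where C: "C > 0" "\<And>\<theta> u. norm (gauss_dual (circ \<epsilon> \<theta>) u) \<le> C / (1 + u\<^sup>2)"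
    using gauss_dual_circ_bounds[OF \<epsilon>] by metis
  note F = Theta_superposition_Fubini[of "wdens \<epsilon> \<sigma>" "wsum \<epsilon> \<sigma>" "\<lambda>i \<theta> u. gauss_dual (circ \<epsilon> \<theta>) u * cis (w $ i * u)" "\<lambda>i u. C * (1 / (1 + u\<^sup>2))"]
  have m: "case_prod (\<lambda>\<theta> u. gauss_dual (circ \<epsilon> \<theta>) u * cis (w $ i * u)) \<in> borel_measurable (borel \<Otimes>\<^sub>M borel)" for i
    unfolding cis_conv_exp by measurable
  have nb: "norm (gauss_dual (circ \<epsilon> \<theta>) u * cis (w $ i * u)) \<le> C * (1 / (1 + u\<^sup>2))" for i \<theta> u
    using C(2) by (simp add: norm_mult)
  have "has_bochner_integral lborel (\<lambda>z. \<integral>\<theta>. wdens \<epsilon> \<sigma> \<theta> * (\<Prod>i\<in>UNIV. gauss_dual (circ \<epsilon> \<theta>) (z $ i) * cis (w $ i * z $ i)) \<partial>Theta)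
     (\<integral>\<theta>. wdens \<epsilon> \<sigma> \<theta> * (\<Prod>i\<in>UNIV. \<integral>u. gauss_dual (circ \<epsilon> \<theta>) u * cis (w $ i * u) \<partial>lborel) \<partial>Theta)"
    unfolding has_bochner_integral_iff
    using F[OF wdens_measurable norm_wdens_le[OF \<epsilon> \<sigma>] m nb integrable_mult_right[OF integrable_inverse_one_plus_square]] \<epsilon> by auto
  moreover have "(\<integral>\<theta>. wdens \<epsilon> \<sigma> \<theta> * (\<Prod>i\<in>UNIV. gauss_dual (circ \<epsilon> \<theta>) (z $ i) * cis (w $ i * z $ i)) \<partial>Theta)
     = of_real (moll_wave_kernel \<epsilon> \<sigma> z) * cis (w \<bullet> z)" for z
    by (simp add: moll_wave_kernel_eq[OF \<epsilon> \<sigma>] kernel_int_def prod.distrib inner_vec_def cis_sum mult.assoc[symmetric])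
  moreover have "(\<integral>\<theta>. wdens \<epsilon> \<sigma> \<theta> * (\<Prod>i\<in>UNIV. \<integral>u. gauss_dual (circ \<epsilon> \<theta>) u * cis (w $ i * u) \<partial>lborel) \<partial>Theta) =
     (\<integral>\<theta>. wdens \<epsilon> \<sigma> \<theta> * exp (- circ \<epsilon> \<theta> * (of_real (norm w))\<^sup>2 / 2) \<partial>Theta)"
  proof (intro Bochner_Integration.integral_cong refl)
    fix \<theta>
    have "(\<Prod>i\<in>UNIV. \<integral>u. gauss_dual (circ \<epsilon> \<theta>) u * cis (w $ i * u) \<partial>lborel) = (\<Prod>i\<in>UNIV. gauss_fun (circ \<epsilon> \<theta>) ((0::real^'d) $ i) (w $ i))"
      using gauss_dual_inverse[OF Re_circ_pos[OF \<epsilon>, of \<theta>]]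
      by (intro prod.cong refl) (simp add: has_bochner_integral_iff gauss_fun_def)
    thus "wdens \<epsilon> \<sigma> \<theta> * (\<Prod>i\<in>UNIV. \<integral>u. gauss_dual (circ \<epsilon> \<theta>) u * cis (w $ i * u) \<partial>lborel) =
        wdens \<epsilon> \<sigma> \<theta> * exp (- circ \<epsilon> \<theta> * (of_real (norm w))\<^sup>2 / 2)"
      by (simp only: prod_gauss_fun) simp
  qed
  ultimately show ?thesis using wave_symbol_superposition[OF \<epsilon> \<sigma> w] by simp
qed

section \<open>Approximation by step functions\<close>

text \<open>Summation by parts, in a form suited to induction on r: once the upper boundary term h r
  * e r is subtracted, there remain differences of h, controlled by V, and the lower boundary term h
  (p + 1) * e p, accounted for by A.\<close>

lemma Abel_sum_bound:
  fixes h e :: "int \<Rightarrow> complex" and V :: "int \<Rightarrow> real"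
  assumes "p + 1 \<le> r" and e: "\<And>k. norm (e k) \<le> 1"
    and h: "\<And>k. p < k \<Longrightarrow> k \<le> r \<Longrightarrow> norm (h k) \<le> A"
    and V: "\<And>k. p + 1 < k \<Longrightarrow> k \<le> r \<Longrightarrow> norm (h k - h (k - 1)) \<le> V k - V (k - 1)"
  shows "norm ((\<Sum>k\<in>{p<..r}. h k * (e k - e (k - 1))) - h r * e r) \<le> A + (V r - V (p + 1))"
  using assms(1) h V
proof (induction r rule: int_ge_induct)
  case base
  have "{p<..p + 1} = {p + 1}" by auto
  moreover have "norm (h (p + 1)) * norm (e p) \<le> A * 1"
    using e[of p] base(1)[of "p + 1"] by (intro mult_mono) (auto intro: order_trans[OF norm_ge_zero])
  ultimately show ?case by (simp add: algebra_simps norm_mult)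
next
  case (step r)
  have s: "{p<..r + 1} = insert (r + 1) {p<..r}" using step.hyps by auto
  have le: "norm (h r - h (r + 1)) \<le> V (r + 1) - V r"
    using step.prems(2)[of "r + 1"] step.hyps by (simp add: norm_minus_commute)
  have "norm (h r - h (r + 1)) * norm (e r) \<le> (V (r + 1) - V r) * 1"
    by (rule mult_mono[OF le e order_trans[OF norm_ge_zero le]]) simp
  moreover have "norm ((\<Sum>k\<in>{p<..r}. h k * (e k - e (k - 1))) - h r * e r) \<le> A + (V r - V (p + 1))"
    by (rule step.IH) (use step.prems in auto)
  moreover have "(\<Sum>k\<in>{p<..r + 1}. h k * (e k - e (k - 1))) - h (r + 1) * e (r + 1) =
     ((\<Sum>k\<in>{p<..r}. h k * (e k - e (k - 1))) - h r * e r) + (h r - h (r + 1)) * e r"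
    unfolding s by (simp add: algebra_simps)
  ultimately show ?case
    using norm_triangle_ineq[of "(\<Sum>k\<in>{p<..r}. h k * (e k - e (k - 1))) - h r * e r" "(h r - h (r + 1)) * e r"]
    by (simp add: norm_mult)
qed

lemma int_telescope:
  fixes G :: "int \<Rightarrow> real"
  assumes "p \<le> r"
  shows "(\<Sum>k\<in>{p<..r}. G k - G (k - 1)) = G r - G p"
  using assms
proof (induction r rule: int_ge_induct)
  case (step r)
  have "{p<..r + 1} = insert (r + 1) {p<..r}" using step.hyps by auto
  thus ?case using step.IH by simp
qed simp

text \<open>Summation by parts turns bounded variation into decay of order \<open>1 / \<bar>\<xi>\<bar>\<close> uniformly in
  the mesh.\<close>
lemma step_ft_bound:
  fixes h :: "int \<Rightarrow> complex" and V G :: "int \<Rightarrow> real"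
  assumes N: "N > 0" and A: "A \<ge> 0" and B: "B \<ge> 0"
    and h: "\<And>k. p < k \<Longrightarrow> k \<le> r \<Longrightarrow> norm (h k) \<le> A"
    and V: "\<And>k. p + 1 < k \<Longrightarrow> k \<le> r \<Longrightarrow> norm (h k - h (k - 1)) \<le> V k - V (k - 1)"
    and VB: "\<And>k. p < k \<Longrightarrow> k \<le> r \<Longrightarrow> \<bar>V k\<bar> \<le> B"
    and G: "\<And>k. p < k \<Longrightarrow> k \<le> r \<Longrightarrow> norm (h k) / N \<le> G k - G (k - 1)"
    and GB: "\<And>k. p \<le> k \<Longrightarrow> k \<le> r \<Longrightarrow> \<bar>G k\<bar> \<le> B"
  shows "(norm (\<Sum>k\<in>{p<..r}. h k * interval_ft (of_int (k - 1) / N) (of_int k / N) \<xi>))\<^sup>2 \<le> ((2 * B)\<^sup>2 + (2 * A + 2 * B)\<^sup>2) / (1 + \<xi>\<^sup>2)"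
proof (cases "p + 1 \<le> r")
  case pr: True
  let ?S = "\<Sum>k\<in>{p<..r}. h k * interval_ft (of_int (k - 1) / N) (of_int k / N) \<xi>"
  \<comment> \<open>Low frequencies: the transform of a cell is at most the mesh 1 / N, so the sum
    is bounded by a Riemann sum, and this by the increments of G.\<close>
  have "norm ?S \<le> (\<Sum>k\<in>{p<..r}. norm (h k * interval_ft (of_int (k - 1) / N) (of_int k / N) \<xi>))"
    by (rule norm_sum)
  also have "\<dots> \<le> (\<Sum>k\<in>{p<..r}. G k - G (k - 1))"
  proof (rule sum_mono)
    fix k assume k: "k \<in> {p<..r}"
    have "\<bar>of_int k / N - of_int (k - 1) / N\<bar> = 1 / N" using N by (simp add: diff_divide_distrib)
    hence "norm (h k * interval_ft (of_int (k - 1) / N) (of_int k / N) \<xi>) \<le> norm (h k) * (1 / N)"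
      using norm_interval_ft_le_length[of "of_int (k - 1) / N" "of_int k / N" \<xi>]
      unfolding norm_mult by (intro mult_left_mono) auto
    also have "\<dots> \<le> G k - G (k - 1)" using G[of k] k by simp
    finally show "norm (h k * interval_ft (of_int (k - 1) / N) (of_int k / N) \<xi>) \<le> G k - G (k - 1)" .
  qed
  also have "\<dots> = G r - G p" using pr by (intro int_telescope) simp
  also have "\<dots> \<le> 2 * B" using GB[of r] GB[of p] pr by simp
  finally have 1: "norm ?S \<le> 2 * B" .
  \<comment> \<open>High frequencies: multiplication by \<xi> turns the cell transforms into
    differences of unimodular numbers, to which summation by parts applies.\<close>
  have 2: "norm ?S * \<bar>\<xi>\<bar> \<le> 2 * A + 2 * B"
  proof (cases "\<xi> = 0")
    case False
    define e where "e k = cis (\<xi> * (of_int k / N))" for k :: int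
    have "?S = (\<Sum>k\<in>{p<..r}. h k * (e k - e (k - 1))) / (\<i> * of_real \<xi>)"
      using False by (simp add: interval_ft_def e_def sum_divide_distrib)
    hence "norm ?S * \<bar>\<xi>\<bar> = norm (\<Sum>k\<in>{p<..r}. h k * (e k - e (k - 1)))"
      using False by (simp add: norm_divide norm_mult)
    also have "\<dots> \<le> norm ((\<Sum>k\<in>{p<..r}. h k * (e k - e (k - 1))) - h r * e r) + norm (h r * e r)"
      using norm_triangle_sub[of "\<Sum>k\<in>{p<..r}. h k * (e k - e (k - 1))" "h r * e r"] by (simp add: add.commute)
    also have "\<dots> \<le> (A + (V r - V (p + 1))) + A * 1"
    proof (rule add_mono)
      show "norm ((\<Sum>k\<in>{p<..r}. h k * (e k - e (k - 1))) - h r * e r) \<le> A + (V r - V (p + 1))"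
        by (rule Abel_sum_bound) (use pr h V in \<open>auto simp: e_def\<close>)
      show "norm (h r * e r) \<le> A * 1"
        using h[of r] pr by (simp add: norm_mult e_def)
    qed
    also have "\<dots> \<le> 2 * A + 2 * B" using VB[of r] VB[of "p + 1"] pr by simp
    finally show ?thesis .
  qed (use A B in simp)
  have "(norm ?S)\<^sup>2 * (1 + \<xi>\<^sup>2) = (norm ?S)\<^sup>2 + (norm ?S * \<bar>\<xi>\<bar>)\<^sup>2"
    by (simp add: power_mult_distrib algebra_simps)
  also have "\<dots> \<le> (2 * B)\<^sup>2 + (2 * A + 2 * B)\<^sup>2" by (intro add_mono power_mono 1 2) auto
  finally show ?thesis by (simp add: pos_le_divide_eq add_pos_nonneg)
qed simp

text \<open>A displacement of at most 1 changes the envelope by at most the factor 3. As the mesh is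
  at most 1, values at cell corners are controlled by the envelope anywhere in the cell.\<close>

lemma one_plus_square_shift:
  fixes c b :: real
  assumes "\<bar>c - b\<bar> \<le> 1"
  shows "1 / (1 + b\<^sup>2) \<le> 3 / (1 + c\<^sup>2)"
proof -
  have "c\<^sup>2 \<le> 2 * b\<^sup>2 + 2 * (c - b)\<^sup>2"
    using zero_le_power2[of "2 * b - c"] by (simp add: power2_eq_square algebra_simps)
  also have "(c - b)\<^sup>2 \<le> 1" using assms by (simp add: abs_square_le_1)
  finally have "1 + c\<^sup>2 \<le> 3 * (1 + b\<^sup>2)" using zero_le_power2[of b] unfolding distrib_left by linarith
  thus ?thesis by (simp add: divide_simps add_pos_nonneg)
qed

text \<open>The mean value theorem gives the envelope at an intermediate point; shifting it back
  costs the factor 3. Riemann sums of the envelope are thereby bounded by telescoping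
  increments.\<close>

lemma arctan_increment_ge:
  assumes "0 < d" "d \<le> 1"
  shows "d / (1 + v\<^sup>2) \<le> 3 * (arctan (v + d) - arctan v)"
proof -
  obtain c where c: "v < c" "c < v + d" "arctan (v + d) - arctan v = (v + d - v) * inverse (1 + c\<^sup>2)"
    using MVT2[of v "v + d" arctan "\<lambda>x. inverse (1 + x\<^sup>2)"] assms by (auto intro: DERIV_arctan)
  have "d * (1 / (1 + v\<^sup>2)) \<le> d * (3 / (1 + c\<^sup>2))"
    using c assms by (intro mult_left_mono one_plus_square_shift) auto
  thus ?thesis unfolding c(3) by (simp add: field_simps)
qed

text \<open>Only cells ending at or before t are kept, so that the elapsed time t - k / (n + 1) is
  nonnegative, as the bounds on \<open>wdens\<close> require.\<close>

definition grid_time :: "nat \<Rightarrow> real \<Rightarrow> int set" where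
  "grid_time n t = {0<..\<lfloor>real (Suc n) * t\<rfloor>}"

text \<open>With mesh 1 / (n + 1) these cells cover the interval from -(n + 1) to n + 1: the mesh
  shrinks while the window grows.\<close>

definition grid_space :: "nat \<Rightarrow> int set" where
  "grid_space n = {- int (Suc n * Suc n)<..int (Suc n * Suc n)}"

definition grid_vec :: "nat \<Rightarrow> ('d::finite \<Rightarrow> int) \<Rightarrow> real^'d" where
  "grid_vec n k = (\<chi> i. of_int (k i) / real (Suc n))"

definition grid_index :: "nat \<Rightarrow> real \<Rightarrow> (int \<times> ('d::finite \<Rightarrow> int)) set" where
  "grid_index n t = grid_time n t \<times> (\<Pi>\<^sub>E i\<in>UNIV. grid_space n)"

definition grid_cell :: "nat \<Rightarrow> (real \<times> (real^'d) \<Rightarrow> real) \<Rightarrow> int \<times> ('d \<Rightarrow> int) \<Rightarrow> real \<times> real \<times> real \<times> (real^'d) \<times> (real^'d)" where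
  "grid_cell n f = (\<lambda>(k0, k). (f (of_int k0 / real (Suc n), grid_vec n k), of_int (k0 - 1) / real (Suc n), of_int k0 / real (Suc n),
     grid_vec n (\<lambda>i. k i - 1), grid_vec n k))"

text \<open>Each cell is open below and closed above and carries the value at its upper corner, so a point
  belongs to the cell whose index is the coordinatewise ceiling of the rescaled point.\<close>
definition grid_elem :: "nat \<Rightarrow> real \<Rightarrow> (real \<times> (real^'d) \<Rightarrow> real) \<Rightarrow> ('d::finite) elem" where
  "grid_elem n t f = map (grid_cell n f) (SOME xs. set xs = grid_index n t \<and> distinct xs)"

lemma finite_grid_index: "finite (grid_index n t)"
  unfolding grid_index_def grid_time_def grid_space_def by (intro finite_cartesian_product finite_PiE) auto

lemma grid_list: "set (SOME xs. set xs = grid_index n t \<and> distinct xs) = (grid_index n t :: (int \<times> ('d::finite \<Rightarrow> int)) set)"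
  "distinct (SOME xs. set xs = (grid_index n t :: (int \<times> ('d::finite \<Rightarrow> int)) set) \<and> distinct xs)"
  using someI_ex[OF finite_distinct_list[OF finite_grid_index[of n t]]] by blast+

lemma set_grid_elem: "set (grid_elem n t f) = grid_cell n f ` (grid_index n t :: (int \<times> ('d::finite \<Rightarrow> int)) set)"
  unfolding grid_elem_def set_map grid_list ..

lemma valid_grid_elem: "valid_elem (grid_elem n t f)"
proof -
  have "case grid_cell n f p of (c, a, b, lo, hi) \<Rightarrow> 0 \<le> a \<and> a \<le> b \<and> (\<forall>i. lo $ i \<le> hi $ i)"
    if "p \<in> grid_index n t" for p :: "int \<times> ('a \<Rightarrow> int)"
  proof -
    have "fst p > 0" using that by (auto simp: grid_index_def grid_time_def)
    thus ?thesis by (simp add: grid_cell_def case_prod_beta' grid_vec_def divide_right_mono)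
  qed
  thus ?thesis unfolding valid_elem_def set_grid_elem by (intro ballI) (erule imageE, simp only:)
qed

lemma elem_fun_grid_elem:
  "elem_fun (grid_elem n t f) z = (\<Sum>(k0, k)\<in>grid_index n t. f (of_int k0 / real (Suc n), grid_vec n k) *
     rect_ind (of_int (k0 - 1) / real (Suc n)) (of_int k0 / real (Suc n)) (grid_vec n (\<lambda>i. k i - 1)) (grid_vec n k) z)"
  unfolding elem_fun_def grid_elem_def map_map o_def
  by (subst sum_list_distinct_conv_sum_set[OF grid_list(2)]) (simp add: grid_list grid_cell_def case_prod_beta')

lemma elem_ft_grid_elem:
  "elem_ft (grid_elem n t f) z = (\<Sum>(k0, k)\<in>grid_index n t. of_real (f (of_int k0 / real (Suc n), grid_vec n k)) *
     rect_ft (of_int (k0 - 1) / real (Suc n)) (of_int k0 / real (Suc n)) (grid_vec n (\<lambda>i. k i - 1)) (grid_vec n k) z)"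
  unfolding elem_ft_def grid_elem_def map_map o_def
  by (subst sum_list_distinct_conv_sum_set[OF grid_list(2)]) (simp add: grid_list grid_cell_def case_prod_beta')

lemma in_cell_iff: "N > 0 \<Longrightarrow> of_int (k - 1) / N < y \<and> y \<le> of_int k / N \<longleftrightarrow> k = \<lceil>N * y\<rceil>" for y N :: real
  using ceiling_eq_iff[of "N * y" k] by (auto simp: field_simps)

lemma elem_fun_grid_elem_eq:
  fixes y :: "real^'d"
  shows "elem_fun (grid_elem n t f) (s, y) =
    (if (\<lceil>real (Suc n) * s\<rceil>, \<lambda>i. \<lceil>real (Suc n) * y $ i\<rceil>) \<in> grid_index n t
     then f (of_int \<lceil>real (Suc n) * s\<rceil> / real (Suc n), grid_vec n (\<lambda>i. \<lceil>real (Suc n) * y $ i\<rceil>)) else 0)"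
proof -
  have "rect_ind (of_int (k0 - 1) / real (Suc n)) (of_int k0 / real (Suc n)) (grid_vec n (\<lambda>i. k i - 1)) (grid_vec n k) (s, y)
    = (if (k0, k) = (\<lceil>real (Suc n) * s\<rceil>, \<lambda>i. \<lceil>real (Suc n) * y $ i\<rceil>) then 1 else 0)" for k0 k
    using in_cell_iff[of "real (Suc n)" k0 s] in_cell_iff[of "real (Suc n)"]
    unfolding rect_ind_def grid_vec_def by (auto simp: fun_eq_iff simp del: of_nat_Suc of_int_diff)
  hence "elem_fun (grid_elem n t f) (s, y) = (\<Sum>p\<in>grid_index n t. (if p = (\<lceil>real (Suc n) * s\<rceil>, \<lambda>i. \<lceil>real (Suc n) * y $ i\<rceil>) then
      f (of_int (fst p) / real (Suc n), grid_vec n (snd p)) else 0))"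
    unfolding elem_fun_grid_elem by (intro sum.cong refl) (auto simp: case_prod_beta')
  thus ?thesis by (simp add: sum.delta' finite_grid_index)
qed

definition wave_src :: "real \<Rightarrow> real \<Rightarrow> real^'d \<Rightarrow> real \<times> (real^'d) \<Rightarrow> real" where
  "wave_src \<epsilon> t x = (\<lambda>(s, y). if 0 \<le> s \<and> s \<le> t then moll_wave_kernel \<epsilon> (t - s) (x - y) else 0)"

lemma grid_time_bounds:
  assumes "k \<in> grid_time n t"
  shows "0 < of_int k / real (Suc n)" "of_int k / real (Suc n) \<le> t"
proof -
  have "0 < k" "k \<le> \<lfloor>real (Suc n) * t\<rfloor>" using assms by (auto simp: grid_time_def)
  moreover from this(2) have "of_int k \<le> real (Suc n) * t" by linarith
  ultimately show "0 < of_int k / real (Suc n)" "of_int k / real (Suc n) \<le> t"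
    by (simp_all add: pos_divide_le_eq mult.commute del: of_nat_Suc)
qed

text \<open>The elapsed time decreases along the grid, whence the minus sign in V; G is linear
  because \<open>wsum \<epsilon> t\<close> bounds the density at all times. The factor 1 + t lets
  one constant dominate V, of size \<open>wsum \<epsilon> t\<close>, as well as G, of size
  \<open>wsum \<epsilon> t * t\<close>.\<close>

lemma time_step_ft_bound:
  assumes \<epsilon>: "\<epsilon> > 0" and t: "t \<ge> 0"
  shows "(norm (\<Sum>k\<in>grid_time n t. wdens \<epsilon> (t - of_int k / real (Suc n)) \<theta> *
      interval_ft (of_int (k - 1) / real (Suc n)) (of_int k / real (Suc n)) \<tau>))\<^sup>2
     \<le> ((2 * (wsum \<epsilon> t * (1 + t)))\<^sup>2 + (2 * wsum \<epsilon> t + 2 * (wsum \<epsilon> t * (1 + t)))\<^sup>2) / (1 + \<tau>\<^sup>2)"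
proof -
  let ?N = "real (Suc n)" and ?A = "wsum \<epsilon> t"
  have A: "0 \<le> ?A" using wsum_mono[of \<epsilon> 0 t] \<epsilon> t by simp
  have At: "?A \<le> ?A * (1 + t)" using mult_left_mono[of 1 "1 + t" ?A] A t by simp
  have b: "0 < of_int k / ?N" "of_int k / ?N \<le> t" if "0 < k" "k \<le> \<lfloor>?N * t\<rfloor>" for k
    using grid_time_bounds[of k n t] that by (auto simp: grid_time_def)
  have w: "norm (wdens \<epsilon> (t - of_int k / ?N) \<theta>) \<le> ?A" if "0 < k" "k \<le> \<lfloor>?N * t\<rfloor>" for k
    using b[OF that] by (intro order_trans[OF norm_wdens_le wsum_mono] \<epsilon>) auto
  show ?thesis unfolding grid_time_def
  proof (rule step_ft_bound[where V = "\<lambda>k. - wsum \<epsilon> (t - of_int k / ?N)" and G = "\<lambda>k. ?A * (of_int k / ?N)"])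
    fix k :: int assume k: "0 < k" "k \<le> \<lfloor>?N * t\<rfloor>"
    show "norm (wdens \<epsilon> (t - of_int k / ?N) \<theta>) \<le> ?A" by (rule w[OF k])
    show "\<bar>- wsum \<epsilon> (t - of_int k / ?N)\<bar> \<le> ?A * (1 + t)"
      using wsum_mono[of \<epsilon> "t - of_int k / ?N" t] wsum_mono[of \<epsilon> 0 "t - of_int k / ?N"] b[OF k] \<epsilon> At by simp
    have "norm (wdens \<epsilon> (t - of_int k / ?N) \<theta>) / ?N \<le> ?A / ?N"
      by (intro divide_right_mono w[OF k]) simp
    also have "\<dots> = ?A * (of_int k / ?N) - ?A * (of_int (k - 1) / ?N)"
      by (simp add: diff_divide_distrib right_diff_distrib)
    finally show "norm (wdens \<epsilon> (t - of_int k / ?N) \<theta>) / ?N \<le> ?A * (of_int k / ?N) - ?A * (of_int (k - 1) / ?N)" .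
  next
    fix k :: int assume k: "0 + 1 < k" "k \<le> \<lfloor>?N * t\<rfloor>"
    have "t - of_int k / ?N \<le> t - of_int (k - 1) / ?N" by (simp add: divide_right_mono)
    thus "norm (wdens \<epsilon> (t - of_int k / ?N) \<theta> - wdens \<epsilon> (t - of_int (k - 1) / ?N) \<theta>)
        \<le> - wsum \<epsilon> (t - of_int k / ?N) - - wsum \<epsilon> (t - of_int (k - 1) / ?N)"
      using norm_wdens_diff_le[OF \<epsilon>, of "t - of_int k / ?N" "t - of_int (k - 1) / ?N" \<theta>] b[of k] k
      by (simp add: norm_minus_commute)
  next
    fix k :: int assume k: "0 \<le> k" "k \<le> \<lfloor>?N * t\<rfloor>"
    have "of_int k / ?N \<le> t" using b[of k] k t by (cases "k = 0") auto
    hence "?A * (of_int k / ?N) \<le> ?A * (1 + t)" using A by (intro mult_left_mono) auto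
    thus "\<bar>?A * (of_int k / ?N)\<bar> \<le> ?A * (1 + t)" using A k by simp
  qed (use A t in auto)
qed

text \<open>V is - C * arctan, the variation control of \<open>gauss_dual_circ_bounds\<close>, and G
  is three times it, by \<open>arctan_increment_ge\<close>. As |arctan| \<le> 2, both are bounded by
  6 * C.\<close>

lemma space_step_ft_bound:
  assumes C: "C > 0" "\<And>\<theta> u. norm (gauss_dual (circ \<epsilon> \<theta>) u) \<le> C / (1 + u\<^sup>2)"
    "\<And>\<theta> u v. v \<le> u \<Longrightarrow> norm (gauss_dual (circ \<epsilon> \<theta>) u - gauss_dual (circ \<epsilon> \<theta>) v) \<le> C * (arctan u - arctan v)"
  shows "(norm (\<Sum>k\<in>grid_space n. gauss_dual (circ \<epsilon> \<theta>) (x - of_int k / real (Suc n)) *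
      interval_ft (of_int (k - 1) / real (Suc n)) (of_int k / real (Suc n)) \<xi>))\<^sup>2
     \<le> ((2 * (6 * C))\<^sup>2 + (2 * C + 2 * (6 * C))\<^sup>2) / (1 + \<xi>\<^sup>2)"
proof -
  let ?N = "real (Suc n)"
  have at: "\<bar>arctan v\<bar> \<le> 2" for v using arctan_bounded[of v] pi_less_4 by auto
  have Cat: "\<bar>C * arctan v\<bar> \<le> C * 2" for v
    using mult_left_mono[OF at[of v], of C] C(1) by (simp add: abs_mult)
  show ?thesis unfolding grid_space_def
  proof (rule step_ft_bound[where V = "\<lambda>k. - (C * arctan (x - of_int k / ?N))" and G = "\<lambda>k. - (3 * (C * arctan (x - of_int k / ?N)))"])
    fix k :: int
    have "C / (1 + (x - of_int k / ?N)\<^sup>2) \<le> C / 1"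
      using C(1) by (intro divide_left_mono) (auto simp: add_pos_nonneg)
    thus "norm (gauss_dual (circ \<epsilon> \<theta>) (x - of_int k / ?N)) \<le> C" using C(2)[of \<theta> "x - of_int k / ?N"] by simp
    have le: "x - of_int k / ?N \<le> x - of_int (k - 1) / ?N" by (simp add: divide_right_mono)
    show "norm (gauss_dual (circ \<epsilon> \<theta>) (x - of_int k / ?N) - gauss_dual (circ \<epsilon> \<theta>) (x - of_int (k - 1) / ?N)) \<le>
       - (C * arctan (x - of_int k / ?N)) - - (C * arctan (x - of_int (k - 1) / ?N))"
      using C(3)[OF le, of \<theta>] by (simp add: norm_minus_commute right_diff_distrib)
    show "\<bar>- (C * arctan (x - of_int k / ?N))\<bar> \<le> 6 * C" using Cat[of "x - of_int k / ?N"] C(1) by simp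
    show "\<bar>- (3 * (C * arctan (x - of_int k / ?N)))\<bar> \<le> 6 * C" using Cat[of "x - of_int k / ?N"] by simp
    have d: "x - of_int (k - 1) / ?N = (x - of_int k / ?N) + 1 / ?N" by (simp add: diff_divide_distrib)
    have "norm (gauss_dual (circ \<epsilon> \<theta>) (x - of_int k / ?N)) / ?N \<le> C / (1 + (x - of_int k / ?N)\<^sup>2) / ?N"
      by (intro divide_right_mono C(2)) simp
    also have "\<dots> = C * ((1 / ?N) / (1 + (x - of_int k / ?N)\<^sup>2))" by simp
    also have "\<dots> \<le> C * (3 * (arctan (x - of_int k / ?N + 1 / ?N) - arctan (x - of_int k / ?N)))"
      using C(1) by (intro mult_left_mono arctan_increment_ge) auto
    also have "\<dots> = - (3 * (C * arctan (x - of_int k / ?N))) - - (3 * (C * arctan (x - of_int (k - 1) / ?N)))"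
      unfolding d by (simp add: algebra_simps)
    finally show "norm (gauss_dual (circ \<epsilon> \<theta>) (x - of_int k / ?N)) / ?N \<le>
       - (3 * (C * arctan (x - of_int k / ?N))) - - (3 * (C * arctan (x - of_int (k - 1) / ?N)))" .
  qed (use C in auto)
qed

lemma kernel_integrand:
  fixes z :: "real^'d"
  assumes C: "C > 0" "\<And>\<theta> u. norm (gauss_dual (circ \<epsilon> \<theta>) u) \<le> C / (1 + u\<^sup>2)" and \<epsilon>: "\<epsilon> > 0" and \<sigma>: "0 \<le> \<sigma>" "\<sigma> \<le> t"
  shows "norm (wdens \<epsilon> \<sigma> \<theta> * (\<Prod>i\<in>UNIV. gauss_dual (circ \<epsilon> \<theta>) (z $ i))) \<le> wsum \<epsilon> t * (\<Prod>i\<in>UNIV. C / (1 + (z $ i)\<^sup>2))"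
    and "integrable Theta (\<lambda>\<theta>. wdens \<epsilon> \<sigma> \<theta> * (\<Prod>i\<in>UNIV. gauss_dual (circ \<epsilon> \<theta>) (z $ i)))"
proof -
  interpret prob_space Theta by (rule prob_space_Theta)
  show n: "norm (wdens \<epsilon> \<sigma> \<theta> * (\<Prod>i\<in>UNIV. gauss_dual (circ \<epsilon> \<theta>) (z $ i))) \<le> wsum \<epsilon> t * (\<Prod>i\<in>UNIV. C / (1 + (z $ i)\<^sup>2))" for \<theta>
    unfolding norm_mult prod_norm[symmetric]
    using \<epsilon> \<sigma> C wsum_mono[of \<epsilon> 0 t]
    by (intro mult_mono order_trans[OF norm_wdens_le wsum_mono] prod_mono prod_nonneg) auto
  show "integrable Theta (\<lambda>\<theta>. wdens \<epsilon> \<sigma> \<theta> * (\<Prod>i\<in>UNIV. gauss_dual (circ \<epsilon> \<theta>) (z $ i)))"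
    by (rule integrable_const_bound[where B = "wsum \<epsilon> t * (\<Prod>i\<in>UNIV. C / (1 + (z $ i)\<^sup>2))"]) (use n in auto)
qed

lemma abs_moll_wave_kernel_le:
  fixes z :: "real^'d"
  assumes C: "C > 0" "\<And>\<theta> u. norm (gauss_dual (circ \<epsilon> \<theta>) u) \<le> C / (1 + u\<^sup>2)" and \<epsilon>: "\<epsilon> > 0" and \<sigma>: "0 \<le> \<sigma>" "\<sigma> \<le> t"
  shows "\<bar>moll_wave_kernel \<epsilon> \<sigma> z\<bar> \<le> wsum \<epsilon> t * (\<Prod>i\<in>UNIV. C / (1 + (z $ i)\<^sup>2))"
proof -
  interpret prob_space Theta by (rule prob_space_Theta)
  note k = kernel_integrand[OF C \<epsilon> \<sigma>]
  have "\<bar>moll_wave_kernel \<epsilon> \<sigma> z\<bar> = norm (kernel_int \<epsilon> \<sigma> z)"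
    by (simp flip: moll_wave_kernel_eq[OF \<epsilon> \<sigma>(1)])
  also have "\<dots> \<le> (\<integral>\<theta>. norm (wdens \<epsilon> \<sigma> \<theta> * (\<Prod>i\<in>UNIV. gauss_dual (circ \<epsilon> \<theta>) (z $ i))) \<partial>Theta)"
    unfolding kernel_int_def by (rule integral_norm_bound)
  also have "\<dots> \<le> wsum \<epsilon> t * (\<Prod>i\<in>UNIV. C / (1 + (z $ i)\<^sup>2))"
    by (intro integral_le_const integrable_norm k) (use k in auto)
  finally show ?thesis .
qed

lemma tendsto_wdens:
  assumes \<epsilon>: "\<epsilon> > 0" and \<sigma>: "\<And>n. 0 \<le> s n" "0 \<le> \<sigma>" and lim: "s \<longlonglongrightarrow> \<sigma>"
  shows "(\<lambda>n. wdens \<epsilon> (s n) \<theta>) \<longlonglongrightarrow> wdens \<epsilon> \<sigma> \<theta>"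
proof -
  have "norm (wdens \<epsilon> (s n) \<theta> - wdens \<epsilon> \<sigma> \<theta>) \<le> \<bar>wsum \<epsilon> (s n) - wsum \<epsilon> \<sigma>\<bar>" for n
    using norm_wdens_diff_le[OF \<epsilon>, of "s n" \<sigma> \<theta>] norm_wdens_diff_le[OF \<epsilon>, of \<sigma> "s n" \<theta>] \<sigma>
    by (cases "s n \<le> \<sigma>") (auto simp: norm_minus_commute intro: order_trans)
  moreover have "(\<lambda>n. \<bar>wsum \<epsilon> (s n) - wsum \<epsilon> \<sigma>\<bar>) \<longlonglongrightarrow> 0"
  proof -
    have "(\<lambda>n. wsum \<epsilon> (s n)) \<longlonglongrightarrow> wsum \<epsilon> \<sigma>" by (rule isCont_tendsto_compose[OF continuous_wsum lim])
    thus ?thesis using LIM_zero tendsto_rabs_zero by blast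
  qed
  ultimately have "(\<lambda>n. wdens \<epsilon> (s n) \<theta> - wdens \<epsilon> \<sigma> \<theta>) \<longlonglongrightarrow> 0"
    by (rule Lim_null_comparison[OF always_eventually[OF allI]])
  thus ?thesis by (rule LIM_zero_cancel)
qed

text \<open>Joint continuity in time and space, by dominated convergence over the circle with a
  constant majorant.\<close>

lemma tendsto_moll_wave_kernel:
  fixes z :: "real^'d"
  assumes \<epsilon>: "\<epsilon> > 0" and \<sigma>: "\<And>n. 0 \<le> s n" "\<And>n. s n \<le> t" "0 \<le> \<sigma>" and lim: "s \<longlonglongrightarrow> \<sigma>" and zlim: "zs \<longlonglongrightarrow> z"
  shows "(\<lambda>n. moll_wave_kernel \<epsilon> (s n) (zs n)) \<longlonglongrightarrow> moll_wave_kernel \<epsilon> \<sigma> z"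
proof -
  interpret prob_space Theta by (rule prob_space_Theta)
  obtain C where C: "C > 0" "\<And>\<theta> u. norm (gauss_dual (circ \<epsilon> \<theta>) u) \<le> C / (1 + u\<^sup>2)"
    using gauss_dual_circ_bounds[OF \<epsilon>] by metis
  have t: "0 \<le> t" using \<sigma>(1,2)[of 0] by simp
  have "(\<lambda>n. kernel_int \<epsilon> (s n) (zs n)) \<longlonglongrightarrow> kernel_int \<epsilon> \<sigma> z"
    unfolding kernel_int_def
  proof (rule integral_dominated_convergence[where w = "\<lambda>_. wsum \<epsilon> t * (\<Prod>i\<in>(UNIV::'d set). C)"])
    show "AE \<theta> in Theta. (\<lambda>n. wdens \<epsilon> (s n) \<theta> * (\<Prod>i\<in>UNIV. gauss_dual (circ \<epsilon> \<theta>) (zs n $ i)))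
         \<longlonglongrightarrow> wdens \<epsilon> \<sigma> \<theta> * (\<Prod>i\<in>UNIV. gauss_dual (circ \<epsilon> \<theta>) (z $ i))"
    proof (intro AE_I2 tendsto_mult tendsto_wdens tendsto_prod \<epsilon> \<sigma> lim)
      fix \<theta> i
      have "continuous_on UNIV (gauss_dual (circ \<epsilon> \<theta>))" by (rule continuous_gauss_dual[OF Re_circ_pos[OF \<epsilon>]])
      hence "isCont (gauss_dual (circ \<epsilon> \<theta>)) (z $ i)" by (simp add: continuous_on_eq_continuous_at)
      thus "(\<lambda>n. gauss_dual (circ \<epsilon> \<theta>) (zs n $ i)) \<longlonglongrightarrow> gauss_dual (circ \<epsilon> \<theta>) (z $ i)"
        by (rule isCont_tendsto_compose) (intro tendsto_vec_nth zlim)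
    qed
    show "AE \<theta> in Theta. norm (wdens \<epsilon> (s n) \<theta> * (\<Prod>i\<in>UNIV. gauss_dual (circ \<epsilon> \<theta>) (zs n $ i))) \<le> wsum \<epsilon> t * (\<Prod>i\<in>(UNIV::'d set). C)" for n
    proof (intro AE_I2)
      fix \<theta>
      have "norm (wdens \<epsilon> (s n) \<theta> * (\<Prod>i\<in>UNIV. gauss_dual (circ \<epsilon> \<theta>) (zs n $ i))) \<le> wsum \<epsilon> t * (\<Prod>i\<in>UNIV. C / (1 + (zs n $ i)\<^sup>2))"
        by (rule kernel_integrand[OF C \<epsilon> \<sigma>(1,2)])
      also have "\<dots> \<le> wsum \<epsilon> t * (\<Prod>i\<in>(UNIV::'d set). C)"
      proof (intro mult_left_mono prod_mono conjI)
        fix i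
        have "C / (1 + (zs n $ i)\<^sup>2) \<le> C / 1"
          using C(1) by (intro divide_left_mono) (auto simp: add_pos_nonneg)
        thus "C / (1 + (zs n $ i)\<^sup>2) \<le> C" by simp
      qed (use C wsum_mono[of \<epsilon> 0 t] \<epsilon> t in auto)
      finally show "norm (wdens \<epsilon> (s n) \<theta> * (\<Prod>i\<in>UNIV. gauss_dual (circ \<epsilon> \<theta>) (zs n $ i))) \<le> wsum \<epsilon> t * (\<Prod>i\<in>(UNIV::'d set). C)" .
    qed
  qed auto
  hence "(\<lambda>n. complex_of_real (moll_wave_kernel \<epsilon> (s n) (zs n))) \<longlonglongrightarrow> of_real (moll_wave_kernel \<epsilon> \<sigma> z)"
    by (simp add: moll_wave_kernel_eq \<epsilon> \<sigma>)
  thus ?thesis by (simp only: tendsto_of_real_iff)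
qed

text \<open>Sampling is linear, so the transform of the step function is an average over the circle
  of transforms of sampled products. For fixed \<theta> the grid is a product, hence the sum over
  cells factors into a time sum T and spatial sums S i, each bounded uniformly in the mesh by
  summation by parts.\<close>

lemma elem_ft_grid_bound:
  fixes x :: "real^'d"
  assumes \<epsilon>: "\<epsilon> > 0" and t: "t \<ge> 0"
  obtains K where "K \<ge> 0" "\<And>n z. (norm (elem_ft (grid_elem n t (wave_src \<epsilon> t x)) z))\<^sup>2 \<le> K * noise_env z"
proof -
  interpret prob_space Theta by (rule prob_space_Theta)
  obtain C where C: "C > 0" "\<And>\<theta> u. norm (gauss_dual (circ \<epsilon> \<theta>) u) \<le> C / (1 + u\<^sup>2)"
    "\<And>\<theta> u v. v \<le> u \<Longrightarrow> norm (gauss_dual (circ \<epsilon> \<theta>) u - gauss_dual (circ \<epsilon> \<theta>) v) \<le> C * (arctan u - arctan v)"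
    using gauss_dual_circ_bounds[OF \<epsilon>] by metis
  define CT where "CT = (2 * (wsum \<epsilon> t * (1 + t)))\<^sup>2 + (2 * wsum \<epsilon> t + 2 * (wsum \<epsilon> t * (1 + t)))\<^sup>2"
  define CS where "CS = (2 * (6 * C))\<^sup>2 + (2 * C + 2 * (6 * C))\<^sup>2"
  have CT0: "CT \<ge> 0" and CS0: "CS \<ge> 0" by (auto simp: CT_def CS_def)
  show ?thesis
  proof (rule that[of "CT * CS ^ CARD('d)"])
    show "0 \<le> CT * CS ^ CARD('d)" using CT0 CS0 by simp
    fix n :: nat and z :: "real \<times> (real^'d)"
    obtain \<tau> \<xi> where z: "z = (\<tau>, \<xi>)" by (cases z)
    let ?N = "real (Suc n)"
    let ?I = "\<lambda>k u. interval_ft (of_int (k - 1) / ?N) (of_int k / ?N) u"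
    define T where "T \<theta> = (\<Sum>k\<in>grid_time n t. wdens \<epsilon> (t - of_int k / ?N) \<theta> * ?I k \<tau>)" for \<theta>
    define S where "S i \<theta> = (\<Sum>k\<in>grid_space n. gauss_dual (circ \<epsilon> \<theta>) (x $ i - of_int k / ?N) * ?I k (\<xi> $ i))" for i \<theta>
    let ?w = "\<lambda>k0 k \<theta>. wdens \<epsilon> (t - of_int k0 / ?N) \<theta> * (\<Prod>i\<in>UNIV. gauss_dual (circ \<epsilon> \<theta>) ((x - grid_vec n k) $ i))"
    let ?R = "\<lambda>k0 k. ?I k0 \<tau> * (\<Prod>i\<in>UNIV. ?I (k i) (\<xi> $ i))"
    have TS: "T \<theta> * (\<Prod>i\<in>UNIV. S i \<theta>) = (\<Sum>(k0, k)\<in>grid_index n t. ?w k0 k \<theta> * ?R k0 k)" for \<theta>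
    proof -
      have "(\<Prod>i\<in>UNIV. S i \<theta>) = (\<Sum>k\<in>(\<Pi>\<^sub>E i\<in>UNIV. grid_space n). \<Prod>i\<in>UNIV. gauss_dual (circ \<epsilon> \<theta>) (x $ i - of_int (k i) / ?N) * ?I (k i) (\<xi> $ i))"
        unfolding S_def by (rule prod_sum_PiE) (auto simp: grid_space_def)
      thus ?thesis
        unfolding T_def grid_index_def sum.cartesian_product[symmetric]
        by (simp add: sum_product prod.distrib grid_vec_def mult_ac)
    qed
    have int: "integrable Theta (\<lambda>\<theta>. ?w k0 k \<theta> * ?R k0 k)" if "(k0, k) \<in> grid_index n t" for k0 k
    proof -
      have "0 \<le> t - of_int k0 / ?N" "t - of_int k0 / ?N \<le> t"
        using grid_time_bounds[of k0 n t] that by (auto simp: grid_index_def)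
      thus ?thesis by (intro integrable_mult_left kernel_integrand(2)[OF C(1,2) \<epsilon>])
    qed
    have "(\<integral>\<theta>. T \<theta> * (\<Prod>i\<in>UNIV. S i \<theta>) \<partial>Theta) = (\<Sum>(k0, k)\<in>grid_index n t. \<integral>\<theta>. ?w k0 k \<theta> * ?R k0 k \<partial>Theta)"
      unfolding TS case_prod_beta' by (intro Bochner_Integration.integral_sum) (use int in auto)
    also have "\<dots> = (\<Sum>(k0, k)\<in>grid_index n t. of_real (wave_src \<epsilon> t x (of_int k0 / ?N, grid_vec n k)) * ?R k0 k)"
    proof (intro sum.cong refl, clarify)
      fix k0 k assume k: "(k0, k :: 'd \<Rightarrow> int) \<in> grid_index n t"
      hence b: "0 < of_int k0 / ?N" "of_int k0 / ?N \<le> t"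
        using grid_time_bounds[of k0 n t] by (auto simp: grid_index_def)
      hence "wave_src \<epsilon> t x (of_int k0 / ?N, grid_vec n k) = moll_wave_kernel \<epsilon> (t - of_int k0 / ?N) (x - grid_vec n k)"
        by (simp add: wave_src_def)
      thus "(\<integral>\<theta>. ?w k0 k \<theta> * ?R k0 k \<partial>Theta) = of_real (wave_src \<epsilon> t x (of_int k0 / ?N, grid_vec n k)) * ?R k0 k"
        using b by (simp add: moll_wave_kernel_eq[OF \<epsilon>] kernel_int_def del: of_nat_Suc of_int_diff)
    qed
    also have "\<dots> = elem_ft (grid_elem n t (wave_src \<epsilon> t x)) z"
      unfolding elem_ft_grid_elem z by (simp add: rect_ft_def grid_vec_def)
    finally have eq: "elem_ft (grid_elem n t (wave_src \<epsilon> t x)) z = (\<integral>\<theta>. T \<theta> * (\<Prod>i\<in>UNIV. S i \<theta>) \<partial>Theta)" by simp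
    let ?K = "sqrt (CT * CS ^ CARD('d) * noise_env z)"
    have env0: "noise_env z \<ge> 0" by (simp add: noise_env_def z prod_nonneg)
    have nb: "norm (T \<theta> * (\<Prod>i\<in>UNIV. S i \<theta>)) \<le> ?K" for \<theta>
    proof (rule real_le_rsqrt)
      have "(norm (T \<theta> * (\<Prod>i\<in>UNIV. S i \<theta>)))\<^sup>2 = (norm (T \<theta>))\<^sup>2 * (\<Prod>i\<in>UNIV. (norm (S i \<theta>))\<^sup>2)"
        by (simp add: norm_mult prod_norm[symmetric] power_mult_distrib prod_power_distrib)
      also have "\<dots> \<le> (CT / (1 + \<tau>\<^sup>2)) * (\<Prod>i\<in>UNIV. CS / (1 + (\<xi> $ i)\<^sup>2))"
        unfolding T_def S_def CT_def CS_def
        by (intro mult_mono time_step_ft_bound \<epsilon> t prod_mono conjI space_step_ft_bound[OF C] prod_nonneg) auto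
      also have "\<dots> = CT * CS ^ CARD('d) * noise_env z"
        by (simp add: noise_env_def z prod_dividef)
      finally show "(norm (T \<theta> * (\<Prod>i\<in>UNIV. S i \<theta>)))\<^sup>2 \<le> CT * CS ^ CARD('d) * noise_env z" .
    qed
    have "norm (\<integral>\<theta>. T \<theta> * (\<Prod>i\<in>UNIV. S i \<theta>) \<partial>Theta) \<le> (\<integral>\<theta>. norm (T \<theta> * (\<Prod>i\<in>UNIV. S i \<theta>)) \<partial>Theta)"
      by (rule integral_norm_bound)
    also have "\<dots> \<le> ?K"
    proof (rule integral_le_const)
      show "integrable Theta (\<lambda>\<theta>. norm (T \<theta> * (\<Prod>i\<in>UNIV. S i \<theta>)))"
        unfolding TS case_prod_beta' by (intro integrable_norm Bochner_Integration.integrable_sum) (use int in auto)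
    qed (use nb in auto)
    finally have "(norm (elem_ft (grid_elem n t (wave_src \<epsilon> t x)) z))\<^sup>2 \<le> ?K\<^sup>2"
      unfolding eq by (intro power_mono) auto
    thus "(norm (elem_ft (grid_elem n t (wave_src \<epsilon> t x)) z))\<^sup>2 \<le> CT * CS ^ CARD('d) * noise_env z"
      using CT0 CS0 env0 by simp
  qed
qed

section \<open>Convergence of the step functions in L1\<close>

lemma moll_wave_kernel_measurable [measurable (raw)]:
  fixes g :: "'a \<Rightarrow> real^'d"
  assumes \<epsilon>: "\<epsilon> > 0" and [measurable]: "f \<in> borel_measurable M" "g \<in> borel_measurable M"
  shows "(\<lambda>p. moll_wave_kernel \<epsilon> (f p) (g p)) \<in> borel_measurable M"
  unfolding moll_wave_kernel_def wave_ft_def heat_kernel_ft_eq[OF \<epsilon>] by measurable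

lemma wave_src_measurable [measurable]:
  assumes \<epsilon>: "\<epsilon> > 0" shows "wave_src \<epsilon> t x \<in> borel_measurable borel"
  unfolding wave_src_def borel_prod[symmetric] using \<epsilon> by measurable

text \<open>The factor 3 is that of \<open>one_plus_square_shift\<close>: one function dominates
  both the integrand and its step approximations, which evaluate the kernel at cell corners.\<close>

definition src_bound :: "real \<Rightarrow> real \<Rightarrow> real \<Rightarrow> real^'d \<Rightarrow> real \<times> (real^'d) \<Rightarrow> real" where
  "src_bound \<epsilon> C t x = (\<lambda>(s, y). (indicator {0..t} s * wsum \<epsilon> t) * (\<Prod>i\<in>UNIV. 3 * C / (1 + (x $ i - y $ i)\<^sup>2)))"

lemma integrable_src_bound: "integrable lborel (src_bound \<epsilon> C t x)"
proof -
  have "integrable lborel (\<lambda>u. 3 * C * (1 / (1 + (v + (-1) * u)\<^sup>2)))" for v :: real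
    by (intro integrable_mult_right lborel_integrable_real_affine integrable_inverse_one_plus_square) simp
  hence f: "has_bochner_integral lborel (\<lambda>u. 3 * C / (1 + (v - u)\<^sup>2)) (\<integral>u. 3 * C / (1 + (v - u)\<^sup>2) \<partial>lborel)" for v :: real
    by (simp add: has_bochner_integral_iff)
  have g: "has_bochner_integral lborel (\<lambda>s::real. indicator {0..t} s * wsum \<epsilon> t) (\<integral>s. indicator {0..t} s * wsum \<epsilon> t \<partial>lborel)"
    unfolding has_bochner_integral_iff
    by (intro conjI refl integrable_mult_left integrable_real_indicator) (auto simp: emeasure_lborel_Icc_eq)
  show ?thesis
    using has_bochner_integral_lborel_prod[OF g f, of "\<lambda>i. x $ i"] by (simp add: has_bochner_integral_iff src_bound_def)
qed

lemma abs_ceiling_grid: "\<bar>of_int \<lceil>real (Suc n) * u\<rceil> / real (Suc n) - u\<bar> \<le> 1"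
proof -
  have "\<bar>of_int \<lceil>real (Suc n) * u\<rceil> - real (Suc n) * u\<bar> \<le> 1" by linarith
  hence "\<bar>of_int \<lceil>real (Suc n) * u\<rceil> - real (Suc n) * u\<bar> / real (Suc n) \<le> 1"
    by (simp add: divide_le_eq del: of_nat_Suc)
  also have "\<bar>of_int \<lceil>real (Suc n) * u\<rceil> - real (Suc n) * u\<bar> / real (Suc n) = \<bar>of_int \<lceil>real (Suc n) * u\<rceil> / real (Suc n) - u\<bar>"
    by (simp add: diff_divide_distrib[symmetric] abs_divide[symmetric] del: of_nat_Suc) (simp add: field_simps)
  finally show ?thesis .
qed

lemma tendsto_ceiling_grid: "(\<lambda>n. of_int \<lceil>real (Suc n) * u\<rceil> / real (Suc n)) \<longlonglongrightarrow> u"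
proof -
  have "(\<lambda>n. of_int \<lceil>real (Suc n) * u\<rceil> / real (Suc n) - u) \<longlonglongrightarrow> 0"
  proof (rule Lim_null_comparison[OF always_eventually[OF allI]])
    fix n
    have "of_int \<lceil>real (Suc n) * u\<rceil> / real (Suc n) - u = (of_int \<lceil>real (Suc n) * u\<rceil> - real (Suc n) * u) / real (Suc n)"
      by (simp add: field_simps)
    moreover have "\<bar>of_int \<lceil>real (Suc n) * u\<rceil> - real (Suc n) * u\<bar> \<le> 1" by linarith
    ultimately show "norm (of_int \<lceil>real (Suc n) * u\<rceil> / real (Suc n) - u) \<le> 1 / real (Suc n)"
      by (simp add: divide_right_mono del: of_nat_Suc)
    show "(\<lambda>n. 1 / real (Suc n)) \<longlonglongrightarrow> 0" using LIMSEQ_inverse_real_of_nat by (simp add: inverse_eq_divide)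
  qed
  thus ?thesis by (rule LIM_zero_cancel)
qed

lemma
  fixes x :: "real^'d"
  assumes C: "C > 0" "\<And>\<theta> u. norm (gauss_dual (circ \<epsilon> \<theta>) u) \<le> C / (1 + u\<^sup>2)" and \<epsilon>: "\<epsilon> > 0" and t: "t \<ge> 0"
  shows wave_src_bound: "\<bar>wave_src \<epsilon> t x z\<bar> \<le> src_bound \<epsilon> C t x z"
    and grid_elem_bound: "\<bar>elem_fun (grid_elem n t (wave_src \<epsilon> t x)) z\<bar> \<le> src_bound \<epsilon> C t x z"
proof -
  obtain s y where z: "z = (s, y)" by (cases z)
  have w0: "0 \<le> wsum \<epsilon> t" using wsum_mono[of \<epsilon> 0 t] \<epsilon> t by simp
  have nn: "0 \<le> src_bound \<epsilon> C t x z"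
    using C w0 by (auto simp: src_bound_def z indicator_def intro!: mult_nonneg_nonneg prod_nonneg)
  \<comment> \<open>One estimate covers both claims: y' is either y itself or the corner of the cell
    containing y.\<close>
  have key: "\<bar>wave_src \<epsilon> t x (s', y')\<bar> \<le> src_bound \<epsilon> C t x (s, y)"
    if "0 \<le> s" "s \<le> t" "\<And>i. \<bar>y' $ i - y $ i\<bar> \<le> 1" for s' y'
  proof (cases "0 \<le> s' \<and> s' \<le> t")
    case True
    have "\<bar>moll_wave_kernel \<epsilon> (t - s') (x - y')\<bar> \<le> wsum \<epsilon> t * (\<Prod>i\<in>UNIV. C / (1 + ((x - y') $ i)\<^sup>2))"
      using True by (intro abs_moll_wave_kernel_le[OF C \<epsilon>]) auto
    also have "\<dots> \<le> wsum \<epsilon> t * (\<Prod>i\<in>UNIV. 3 * C / (1 + (x $ i - y $ i)\<^sup>2))"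
    proof (intro mult_left_mono prod_mono conjI w0)
      fix i
      have "C * (1 / (1 + (x $ i - y' $ i)\<^sup>2)) \<le> C * (3 / (1 + (x $ i - y $ i)\<^sup>2))"
        using that(3)[of i] C(1) by (intro mult_left_mono one_plus_square_shift) auto
      thus "C / (1 + ((x - y') $ i)\<^sup>2) \<le> 3 * C / (1 + (x $ i - y $ i)\<^sup>2)" by (simp add: mult.commute)
    qed (use C in auto)
    finally show ?thesis using True that by (simp add: wave_src_def src_bound_def)
  next
    case False
    hence "wave_src \<epsilon> t x (s', y') = 0" by (auto simp: wave_src_def)
    thus ?thesis using nn by (simp add: z)
  qed
  show "\<bar>wave_src \<epsilon> t x z\<bar> \<le> src_bound \<epsilon> C t x z"
  proof (cases "0 \<le> s \<and> s \<le> t")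
    case True thus ?thesis using key[of y s] by (simp add: z)
  next
    case False
    hence "wave_src \<epsilon> t x z = 0" by (auto simp: wave_src_def z)
    thus ?thesis using nn by simp
  qed
  show "\<bar>elem_fun (grid_elem n t (wave_src \<epsilon> t x)) z\<bar> \<le> src_bound \<epsilon> C t x z"
  proof (cases "(\<lceil>real (Suc n) * s\<rceil>, \<lambda>i. \<lceil>real (Suc n) * y $ i\<rceil>) \<in> (grid_index n t :: (int \<times> ('d \<Rightarrow> int)) set)")
    case True
    hence g: "\<lceil>real (Suc n) * s\<rceil> \<in> grid_time n t" by (simp add: grid_index_def)
    hence "real (Suc n) * s > 0" by (simp add: grid_time_def)
    hence s0: "s > 0" by (simp add: zero_less_mult_iff)
    \<comment> \<open>The cell of s ends at or before t, so s lies in the time support of the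
      bound.\<close>
    have "s \<le> of_int \<lceil>real (Suc n) * s\<rceil> / real (Suc n)"
      by (simp add: le_divide_eq mult.commute del: of_nat_Suc)
    also have "\<dots> \<le> t" by (rule grid_time_bounds(2)[OF g])
    finally show ?thesis unfolding z elem_fun_grid_elem_eq using True s0
      by (simp del: of_nat_Suc) (intro key, auto simp: grid_vec_def abs_ceiling_grid simp del: of_nat_Suc)
  qed (use nn in \<open>simp add: z elem_fun_grid_elem_eq del: of_nat_Suc\<close>)
qed

text \<open>At s = 0 the cell index is 0, which the grid omits, and at s = t the cell may end beyond
  t. These two null sets of times are excluded.\<close>

lemma tendsto_grid_elem:
  fixes x :: "real^'d"
  assumes \<epsilon>: "\<epsilon> > 0" and t: "t \<ge> 0" and s: "s \<noteq> 0" "s \<noteq> t"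
  shows "(\<lambda>n. elem_fun (grid_elem n t (wave_src \<epsilon> t x)) (s, y)) \<longlonglongrightarrow> wave_src \<epsilon> t x (s, y)"
proof -
  consider "s < 0" | "0 < s" "s < t" | "s > t" using s by linarith
  thus ?thesis
  proof cases
    case 1
    have "\<lceil>real (Suc n) * s\<rceil> \<notin> grid_time n t" for n
    proof -
      have "real (Suc n) * s \<le> 0" using 1 by (simp add: mult_nonneg_nonpos)
      thus ?thesis by (simp add: grid_time_def del: of_nat_Suc)
    qed
    thus ?thesis using 1 by (simp add: elem_fun_grid_elem_eq grid_index_def wave_src_def del: of_nat_Suc)
  next
    case 3
    have "\<lceil>real (Suc n) * s\<rceil> \<notin> grid_time n t" for n
    proof
      assume "\<lceil>real (Suc n) * s\<rceil> \<in> grid_time n t"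
      from grid_time_bounds(2)[OF this] have "of_int \<lceil>real (Suc n) * s\<rceil> \<le> real (Suc n) * t"
        by (simp add: divide_le_eq mult.commute del: of_nat_Suc)
      hence "real (Suc n) * s \<le> real (Suc n) * t" by linarith
      thus False using 3 by (simp del: of_nat_Suc)
    qed
    thus ?thesis using 3 by (simp add: elem_fun_grid_elem_eq grid_index_def wave_src_def del: of_nat_Suc)
  next
    case 2
    define sn where "sn n = of_int \<lceil>real (Suc n) * s\<rceil> / real (Suc n)" for n
    define yn :: "nat \<Rightarrow> real^'d" where "yn n = grid_vec n (\<lambda>i. \<lceil>real (Suc n) * y $ i\<rceil>)" for n
    have snl: "sn \<longlonglongrightarrow> s" unfolding sn_def by (rule tendsto_ceiling_grid)
    have ynl: "yn \<longlonglongrightarrow> y"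
      by (rule vec_tendstoI) (simp add: yn_def grid_vec_def tendsto_ceiling_grid del: of_nat_Suc)
    have ev1: "\<forall>\<^sub>F n in sequentially. sn n \<le> t"
      using order_tendstoD(2)[OF snl, of t] 2 by (auto elim: eventually_mono)
    have sn0: "0 < sn n" for n
    proof -
      have "real (Suc n) * s > 0" using 2 by simp
      thus ?thesis unfolding sn_def by (simp add: zero_less_divide_iff del: of_nat_Suc)
    qed
    have ev2: "\<forall>\<^sub>F n in sequentially. \<forall>i. \<lceil>real (Suc n) * y $ i\<rceil> \<in> grid_space n"
    proof (rule eventually_all_finite)
      fix i
      show "\<forall>\<^sub>F n in sequentially. \<lceil>real (Suc n) * y $ i\<rceil> \<in> grid_space n"
        using eventually_gt_at_top[of "nat \<lceil>\<bar>y $ i\<bar>\<rceil> + 1"]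
      proof eventually_elim
        case (elim n)
        hence "\<bar>y $ i\<bar> + 1 \<le> real (Suc n)" by linarith
        hence "real (Suc n) * (\<bar>y $ i\<bar> + 1) \<le> real (Suc n) * real (Suc n)" by (rule mult_left_mono) simp
        moreover have "\<bar>real (Suc n) * y $ i\<bar> = real (Suc n) * \<bar>y $ i\<bar>" by (simp add: abs_mult)
        moreover have "real (Suc n) \<ge> 1" by simp
        ultimately have "\<bar>real (Suc n) * y $ i\<bar> + 1 \<le> real (Suc n) * real (Suc n)" by (simp only: distrib_left mult_1_right)
        hence "\<bar>real (Suc n) * y $ i\<bar> + 1 \<le> real (Suc n * Suc n)" by (simp only: of_nat_mult)
        moreover have "- int m < \<lceil>u\<rceil> \<and> \<lceil>u\<rceil> \<le> int m" if "\<bar>u\<bar> + 1 \<le> real m" for u :: real and m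
        proof
          have "real_of_int (- int m) < u" "u \<le> real_of_int (int m)" using that by auto
          thus "- int m < \<lceil>u\<rceil>" "\<lceil>u\<rceil> \<le> int m" by (simp_all only: less_ceiling_iff ceiling_le_iff)
        qed
        ultimately show ?case unfolding grid_space_def greaterThanAtMost_iff by blast
      qed
    qed
    \<comment> \<open>The maximum with 0 repairs the finitely many n for which the sampling time
      exceeds t, so that the kernel limit applies to the whole sequence.\<close>
    have ev: "\<forall>\<^sub>F n in sequentially. elem_fun (grid_elem n t (wave_src \<epsilon> t x)) (s, y) = moll_wave_kernel \<epsilon> (max 0 (t - sn n)) (x - yn n)"
      using ev1 ev2
    proof eventually_elim
      case (elim n)
      have "real_of_int \<lceil>real (Suc n) * s\<rceil> \<le> real (Suc n) * t"
        using elim(1) by (simp add: sn_def divide_le_eq mult.commute del: of_nat_Suc)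
      moreover have "0 < real (Suc n) * s" using 2 by simp
      ultimately have "\<lceil>real (Suc n) * s\<rceil> \<in> grid_time n t"
        unfolding grid_time_def by (simp add: le_floor_iff del: of_nat_Suc)
      hence "(\<lceil>real (Suc n) * s\<rceil>, \<lambda>i. \<lceil>real (Suc n) * y $ i\<rceil>) \<in> (grid_index n t :: (int \<times> ('d \<Rightarrow> int)) set)"
        using elim(2) by (auto simp: grid_index_def)
      hence "elem_fun (grid_elem n t (wave_src \<epsilon> t x)) (s, y) = wave_src \<epsilon> t x (sn n, yn n)"
        by (simp add: elem_fun_grid_elem_eq sn_def yn_def del: of_nat_Suc)
      thus ?case using elim(1) sn0[of n] by (simp add: wave_src_def)
    qed
    have "(\<lambda>n. moll_wave_kernel \<epsilon> (max 0 (t - sn n)) (x - yn n)) \<longlonglongrightarrow> moll_wave_kernel \<epsilon> (t - s) (x - y)"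
    proof (rule tendsto_moll_wave_kernel[OF \<epsilon>, where t = t])
      have "(\<lambda>n. max 0 (t - sn n)) \<longlonglongrightarrow> max 0 (t - s)" by (intro tendsto_intros snl)
      thus "(\<lambda>n. max 0 (t - sn n)) \<longlonglongrightarrow> t - s" using 2 by simp
      show "max 0 (t - sn n) \<le> t" for n using sn0[of n] t by simp
    qed (use 2 in \<open>auto intro!: tendsto_intros ynl\<close>)
    hence "(\<lambda>n. elem_fun (grid_elem n t (wave_src \<epsilon> t x)) (s, y)) \<longlonglongrightarrow> moll_wave_kernel \<epsilon> (t - s) (x - y)"
      by (rule Lim_transform_eventually) (use ev in \<open>auto elim: eventually_mono\<close>)
    thus ?thesis using 2 by (simp add: wave_src_def)
  qed
qed

lemma integrable_wave_src:
  assumes \<epsilon>: "\<epsilon> > 0" and t: "t \<ge> 0" shows "integrable lborel (wave_src \<epsilon> t x)"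
proof -
  obtain C where C: "C > 0" "\<And>\<theta> u. norm (gauss_dual (circ \<epsilon> \<theta>) u) \<le> C / (1 + u\<^sup>2)"
    using gauss_dual_circ_bounds[OF \<epsilon>] by metis
  show ?thesis
  proof (rule Bochner_Integration.integrable_bound[OF integrable_src_bound[of \<epsilon> C t x]])
    show "AE z in lborel. norm (wave_src \<epsilon> t x z) \<le> norm (src_bound \<epsilon> C t x z)"
    proof (rule AE_I2)
      fix z :: "real \<times> (real^'a)"
      show "norm (wave_src \<epsilon> t x z) \<le> norm (src_bound \<epsilon> C t x z)"
        using wave_src_bound[OF C \<epsilon> t, of x z] abs_ge_self[of "src_bound \<epsilon> C t x z"]
        unfolding real_norm_def by linarith
    qed
  qed (use \<epsilon> in simp)
qed

lemma grid_elem_L1: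
  fixes x :: "real^'d"
  assumes \<epsilon>: "\<epsilon> > 0" and t: "t \<ge> 0"
  shows "(\<lambda>n. \<integral>\<^sup>+ z. ennreal \<bar>wave_src \<epsilon> t x z - elem_fun (grid_elem n t (wave_src \<epsilon> t x)) z\<bar> \<partial>lborel) \<longlonglongrightarrow> 0"
proof -
  obtain C where C: "C > 0" "\<And>\<theta> u. norm (gauss_dual (circ \<epsilon> \<theta>) u) \<le> C / (1 + u\<^sup>2)"
    using gauss_dual_circ_bounds[OF \<epsilon>] by metis
  have i: "integrable lborel (src_bound \<epsilon> C t x)" by (rule integrable_src_bound)
  have nn: "0 \<le> src_bound \<epsilon> C t x z" for z using wave_src_bound[OF C \<epsilon> t, of x z] by simp
  have ae1: "AE z in lborel :: (real \<times> (real^'d)) measure. fst z \<noteq> c" for c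
  proof -
    have "AE z in lborel \<Otimes>\<^sub>M (lborel :: (real^'d) measure). fst z \<noteq> c"
    proof (rule lborel_pair.AE_pair_measure)
      show "{z \<in> space (lborel \<Otimes>\<^sub>M (lborel :: (real^'d) measure)). fst z \<noteq> c} \<in> sets (lborel \<Otimes>\<^sub>M lborel)"
        by measurable
    qed (use AE_lborel_singleton[of c] in auto)
    thus ?thesis unfolding lborel_prod .
  qed
  have "(\<lambda>n. \<integral>\<^sup>+ z. norm (wave_src \<epsilon> t x z - elem_fun (grid_elem n t (wave_src \<epsilon> t x)) z) \<partial>lborel) \<longlonglongrightarrow> 0"
  proof (rule nn_integral_dominated_convergence_norm[where w = "src_bound \<epsilon> C t x"])
    show "elem_fun (grid_elem n t (wave_src \<epsilon> t x)) \<in> borel_measurable lborel" for n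
      using borel_measurable_integrable[OF integrable_elem_fun[OF valid_grid_elem]] .
    show "src_bound \<epsilon> C t x \<in> borel_measurable lborel" using i by (rule borel_measurable_integrable)
    show "(\<integral>\<^sup>+ z. src_bound \<epsilon> C t x z \<partial>lborel) < \<infinity>"
      using i nn by (simp add: integrable_iff_bounded)
    show "AE z in lborel. norm (elem_fun (grid_elem j t (wave_src \<epsilon> t x)) z) \<le> src_bound \<epsilon> C t x z" for j
      by (intro AE_I2, unfold real_norm_def) (rule grid_elem_bound[OF C \<epsilon> t])
    show "AE z in lborel. (\<lambda>n. elem_fun (grid_elem n t (wave_src \<epsilon> t x)) z) \<longlonglongrightarrow> wave_src \<epsilon> t x z"
      using ae1[of 0] ae1[of t]
    proof eventually_elim
      case (elim z)
      thus ?case using tendsto_grid_elem[OF \<epsilon> t, of "fst z" x "snd z"] by simp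
    qed
  qed (use \<epsilon> in simp)
  thus ?thesis by simp
qed

section \<open>Space-time Fourier transform of the integrand\<close>

definition wave_time_ft :: "real \<Rightarrow> real \<Rightarrow> real \<Rightarrow> complex" where
  "wave_time_ft t \<tau> r = (\<integral>s. indicator {0..t} s *\<^sub>R (cis (\<tau> * s) * of_real (sin ((t - s) * r) / r)) \<partial>lborel)"

lemma lborel_distr_reflect: "distr lborel borel (\<lambda>y. x - y) = (lborel :: (real^'d) measure)"
  using lborel_affine[of "-1::real" x] by (simp add: density_1)

lemma wave_ft_uminus: "wave_ft \<sigma> (- w) = wave_ft \<sigma> w" by (simp add: wave_ft_def)

lemma moll_wave_kernel_shift_ft:
  fixes x \<xi> :: "real^'d"
  assumes \<epsilon>: "\<epsilon> > 0" and \<sigma>: "\<sigma> \<ge> 0" and \<xi>: "\<xi> \<noteq> 0"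
  shows "(\<integral>y. of_real (moll_wave_kernel \<epsilon> \<sigma> (x - y)) * cis (\<xi> \<bullet> y) \<partial>lborel) =
     cis (\<xi> \<bullet> x) * of_real (wave_ft \<sigma> \<xi> * exp (- \<epsilon> * (norm \<xi>)\<^sup>2 / 2))"
proof -
  have [measurable]: "(\<lambda>y. of_real (moll_wave_kernel \<epsilon> \<sigma> (x - y)) * cis (\<xi> \<bullet> y)) \<in> borel_measurable borel"
    unfolding cis_conv_exp using \<epsilon> by measurable
  have "(\<integral>y. of_real (moll_wave_kernel \<epsilon> \<sigma> (x - y)) * cis (\<xi> \<bullet> y) \<partial>lborel) =
     (\<integral>y. of_real (moll_wave_kernel \<epsilon> \<sigma> (x - y)) * cis (\<xi> \<bullet> y) \<partial>distr lborel borel (\<lambda>y. x - y))"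
    by (simp add: lborel_distr_reflect)
  also have "\<dots> = (\<integral>y. of_real (moll_wave_kernel \<epsilon> \<sigma> y) * cis (\<xi> \<bullet> (x - y)) \<partial>lborel)"
    by (subst integral_distr) auto
  also have "\<dots> = (\<integral>y. cis (\<xi> \<bullet> x) * (of_real (moll_wave_kernel \<epsilon> \<sigma> y) * cis (- \<xi> \<bullet> y)) \<partial>lborel)"
    by (intro Bochner_Integration.integral_cong refl) (simp add: inner_diff_right cis_mult mult_ac)
  also have "\<dots> = cis (\<xi> \<bullet> x) * of_real (wave_ft \<sigma> \<xi> * exp (- \<epsilon> * (norm \<xi>)\<^sup>2 / 2))"
    using has_bochner_integral_moll_wave_kernel_ft[OF \<epsilon> \<sigma>, of "- \<xi>"] \<xi>
    by (simp add: has_bochner_integral_iff wave_ft_uminus)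
  finally show ?thesis .
qed

text \<open>Integrating over space first gives the symbol at each time. The point x contributes a
  factor of modulus 1, hence disappears from second moments, and the mollifier is a scalar that does
  not depend on \<tau>.\<close>

lemma ft_wave_src:
  fixes x \<xi> :: "real^'d"
  assumes \<epsilon>: "\<epsilon> > 0" and t: "t \<ge> 0" and \<xi>: "\<xi> \<noteq> 0"
  shows "ft (wave_src \<epsilon> t x) (\<tau>, \<xi>) = cis (\<xi> \<bullet> x) * of_real (exp (- \<epsilon> * (norm \<xi>)\<^sup>2 / 2)) * wave_time_ft t \<tau> (norm \<xi>)"
proof -
  let ?g = "\<lambda>w :: real \<times> (real^'d). of_real (wave_src \<epsilon> t x w) * cis (\<tau> * fst w + \<xi> \<bullet> snd w)"
  have int: "integrable (lborel \<Otimes>\<^sub>M lborel) ?g"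
    using integrable_ft[OF integrable_wave_src[OF \<epsilon> t], of x "(\<tau>, \<xi>)"] by (simp add: lborel_prod)
  have "ft (wave_src \<epsilon> t x) (\<tau>, \<xi>) = (\<integral>w. ?g w \<partial>(lborel \<Otimes>\<^sub>M lborel))"
    by (simp add: ft_def lborel_prod)
  also have "\<dots> = (\<integral>s. \<integral>y. ?g (s, y) \<partial>lborel \<partial>lborel)"
    by (rule lborel_pair.integral_fst'[OF int, symmetric])
  also have "\<dots> = (\<integral>s. cis (\<xi> \<bullet> x) * of_real (exp (- \<epsilon> * (norm \<xi>)\<^sup>2 / 2)) *
      (indicator {0..t} s *\<^sub>R (cis (\<tau> * s) * of_real (sin ((t - s) * norm \<xi>) / norm \<xi>))) \<partial>lborel)"
  proof (intro Bochner_Integration.integral_cong refl)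
    fix s
    show "(\<integral>y. ?g (s, y) \<partial>lborel) = cis (\<xi> \<bullet> x) * of_real (exp (- \<epsilon> * (norm \<xi>)\<^sup>2 / 2)) *
      (indicator {0..t} s *\<^sub>R (cis (\<tau> * s) * of_real (sin ((t - s) * norm \<xi>) / norm \<xi>)))"
    proof (cases "0 \<le> s \<and> s \<le> t")
      case True
      hence "(\<integral>y. ?g (s, y) \<partial>lborel) = (\<integral>y. cis (\<tau> * s) * (of_real (moll_wave_kernel \<epsilon> (t - s) (x - y)) * cis (\<xi> \<bullet> y)) \<partial>lborel)"
        by (intro Bochner_Integration.integral_cong refl) (simp add: wave_src_def cis_mult[symmetric] mult_ac)
      thus ?thesis using True moll_wave_kernel_shift_ft[OF \<epsilon> _ \<xi>, of "t - s" x] by (simp add: wave_ft_def mult_ac)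
    qed (auto simp: wave_src_def)
  qed
  finally show ?thesis unfolding wave_time_ft_def by (simp only: integral_mult_right_zero)
qed

section \<open>Existence and comparison of Wiener integrals\<close>

lemma (in prob_space) integral_abs_le_sqrt:
  fixes Z :: "'a \<Rightarrow> real"
  assumes [measurable]: "Z \<in> borel_measurable M" and Z2: "integrable M (\<lambda>\<omega>. (Z \<omega>)\<^sup>2)"
  shows "integrable M Z" "(\<integral>\<omega>. \<bar>Z \<omega>\<bar> \<partial>M) \<le> sqrt (\<integral>\<omega>. (Z \<omega>)\<^sup>2 \<partial>M)"
proof -
  show i: "integrable M Z" using square_integrable_imp_integrable[OF _ Z2] by simp
  have "0 \<le> variance (\<lambda>\<omega>. \<bar>Z \<omega>\<bar>)" by (rule variance_positive)
  also have "\<dots> = (\<integral>\<omega>. \<bar>Z \<omega>\<bar>\<^sup>2 \<partial>M) - (\<integral>\<omega>. \<bar>Z \<omega>\<bar> \<partial>M)\<^sup>2"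
    using i Z2 by (intro variance_eq) auto
  finally show "(\<integral>\<omega>. \<bar>Z \<omega>\<bar> \<partial>M) \<le> sqrt (\<integral>\<omega>. (Z \<omega>)\<^sup>2 \<partial>M)" by (intro real_le_rsqrt) simp
qed

text \<open>Along a subsequence consecutive L2 distances are at most 2^-k, so the L1 norms of the
  increments are summable and the subsequence converges almost everywhere. Fatou's lemma then bounds
  the L2 distance of the whole sequence to this limit.\<close>

lemma (in prob_space) L2_complete:
  fixes X :: "nat \<Rightarrow> 'a \<Rightarrow> real"
  assumes Xm [measurable]: "\<And>n. X n \<in> borel_measurable M" and X2: "\<And>n. integrable M (\<lambda>\<omega>. (X n \<omega>)\<^sup>2)"
    and cauchy: "\<And>e. e > 0 \<Longrightarrow> \<exists>N. \<forall>m\<ge>N. \<forall>n\<ge>N. (\<integral>\<omega>. (X m \<omega> - X n \<omega>)\<^sup>2 \<partial>M) < e"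
  obtains Y where "Y \<in> borel_measurable M" "integrable M (\<lambda>\<omega>. (Y \<omega>)\<^sup>2)" "(\<lambda>n. \<integral>\<omega>. (Y \<omega> - X n \<omega>)\<^sup>2 \<partial>M) \<longlonglongrightarrow> 0"
proof -
  have D2: "integrable M (\<lambda>\<omega>. (X m \<omega> - X n \<omega>)\<^sup>2)" for m n
    unfolding power2_diff using X2 integrable_mult_of_squares[OF Xm Xm X2 X2, of m n]
    by (intro Bochner_Integration.integrable_diff Bochner_Integration.integrable_add) (auto simp: mult.assoc)
  have "\<forall>k. \<exists>N. \<forall>m\<ge>N. \<forall>n\<ge>N. (\<integral>\<omega>. (X m \<omega> - X n \<omega>)\<^sup>2 \<partial>M) < (1/4) ^ k"
    by (intro allI, rule cauchy) simp
  hence "\<exists>N. \<forall>k. \<forall>m\<ge>N k. \<forall>n\<ge>N k. (\<integral>\<omega>. (X m \<omega> - X n \<omega>)\<^sup>2 \<partial>M) < (1/4) ^ k"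
    by (rule choice)
  then obtain N where N: "\<And>k m n. m \<ge> N k \<Longrightarrow> n \<ge> N k \<Longrightarrow> (\<integral>\<omega>. (X m \<omega> - X n \<omega>)\<^sup>2 \<partial>M) < (1/4) ^ k"
    by blast
  \<comment> \<open>Partial sums guarantee that r j lies beyond N k for all k \<le> j.\<close>
  define r where "r k = (\<Sum>i\<le>k. N i) + k" for k
  have rN: "N k \<le> r j" if "k \<le> j" for k j
    using that member_le_sum[of k "{..j}" N] by (simp add: r_def)
  have rk: "k \<le> r k" for k by (simp add: r_def)
  let ?D = "\<lambda>k \<omega>. X (r (Suc k)) \<omega> - X (r k) \<omega>"
  have Dk: "(\<integral>\<omega>. \<bar>?D k \<omega>\<bar> \<partial>M) \<le> (1/2) ^ k" for k
  proof -
    have "(\<integral>\<omega>. \<bar>?D k \<omega>\<bar> \<partial>M) \<le> sqrt (\<integral>\<omega>. (?D k \<omega>)\<^sup>2 \<partial>M)"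
      by (rule integral_abs_le_sqrt(2)[OF _ D2]) measurable
    also have "\<dots> \<le> sqrt ((1/4) ^ k)"
      by (intro real_sqrt_le_mono less_imp_le[OF N] rN) simp_all
    also have "(1/4 :: real) ^ k = ((1/2) ^ k)\<^sup>2" by (simp add: power2_eq_square flip: power_mult_distrib)
    finally show ?thesis by simp
  qed
  have Di: "integrable M (?D k)" for k by (rule integral_abs_le_sqrt(1)[OF _ D2]) simp
  have "(\<integral>\<^sup>+\<omega>. (\<Sum>k. ennreal \<bar>?D k \<omega>\<bar>) \<partial>M) = (\<Sum>k. \<integral>\<^sup>+\<omega>. ennreal \<bar>?D k \<omega>\<bar> \<partial>M)"
    by (rule nn_integral_suminf) simp
  also have "\<dots> = (\<Sum>k. ennreal (\<integral>\<omega>. \<bar>?D k \<omega>\<bar> \<partial>M))"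
    using Di by (subst nn_integral_eq_integral) auto
  also have "\<dots> \<le> (\<Sum>k. ennreal ((1/2) ^ k))" using Dk by (intro suminf_le ennreal_leI) auto
  also have "\<dots> = ennreal (\<Sum>k. (1/2) ^ k)" by (intro suminf_ennreal2 summable_geometric) auto
  also have "\<dots> < \<infinity>" by simp
  finally have "(\<integral>\<^sup>+\<omega>. (\<Sum>k. ennreal \<bar>?D k \<omega>\<bar>) \<partial>M) \<noteq> \<infinity>" by simp
  hence "AE \<omega> in M. (\<Sum>k. ennreal \<bar>?D k \<omega>\<bar>) \<noteq> \<infinity>" by (intro nn_integral_PInf_AE) auto
  hence conv: "AE \<omega> in M. convergent (\<lambda>k. X (r k) \<omega>)"
  proof eventually_elim
    case (elim \<omega>)
    have "summable (\<lambda>k. \<bar>?D k \<omega>\<bar>)" using elim by (intro summable_suminf_not_top) (auto simp: top_unique)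
    hence "summable (\<lambda>k. ?D k \<omega>)" by (rule summable_rabs_cancel)
    hence "convergent (\<lambda>n. \<Sum>k<n. ?D k \<omega>)" by (simp add: summable_iff_convergent)
    hence "convergent (\<lambda>n. X (r n) \<omega> - X (r 0) \<omega>)"
      unfolding sum_lessThan_telescope[of "\<lambda>k. X (r k) \<omega>"] .
    from convergent_add[OF this convergent_const[of "X (r 0) \<omega>"]] show ?case by simp
  qed
  define Y where "Y \<omega> = lim (\<lambda>k. X (r k) \<omega>)" for \<omega>
  have Ym [measurable]: "Y \<in> borel_measurable M" unfolding Y_def by measurable
  have Ylim: "AE \<omega> in M. (\<lambda>k. X (r k) \<omega>) \<longlonglongrightarrow> Y \<omega>"
    using conv by eventually_elim (simp add: Y_def convergent_LIMSEQ_iff)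
  have fatou: "(\<integral>\<^sup>+\<omega>. ennreal ((Y \<omega> - X n \<omega>)\<^sup>2) \<partial>M) \<le> ennreal ((1/4) ^ k)" if "n \<ge> N k" for n k
  proof -
    have "(\<integral>\<^sup>+\<omega>. ennreal ((Y \<omega> - X n \<omega>)\<^sup>2) \<partial>M) = (\<integral>\<^sup>+\<omega>. liminf (\<lambda>j. ennreal ((X (r j) \<omega> - X n \<omega>)\<^sup>2)) \<partial>M)"
    proof (rule nn_integral_cong_AE, use Ylim in eventually_elim)
      case (elim \<omega>)
      have "(\<lambda>j. ennreal ((X (r j) \<omega> - X n \<omega>)\<^sup>2)) \<longlonglongrightarrow> ennreal ((Y \<omega> - X n \<omega>)\<^sup>2)"
        by (intro tendsto_intros elim tendsto_ennrealI)
      thus ?case by (intro lim_imp_Liminf[symmetric]) simp_all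
    qed
    also have "\<dots> \<le> liminf (\<lambda>j. \<integral>\<^sup>+\<omega>. ennreal ((X (r j) \<omega> - X n \<omega>)\<^sup>2) \<partial>M)"
      by (rule nn_integral_liminf) simp
    also have "\<dots> \<le> ennreal ((1/4) ^ k)"
    proof (rule Liminf_le)
      show "\<forall>\<^sub>F j in sequentially. (\<integral>\<^sup>+\<omega>. ennreal ((X (r j) \<omega> - X n \<omega>)\<^sup>2) \<partial>M) \<le> ennreal ((1/4) ^ k)"
        using eventually_ge_at_top[of k]
      proof eventually_elim
        case (elim j)
        have "(\<integral>\<^sup>+\<omega>. ennreal ((X (r j) \<omega> - X n \<omega>)\<^sup>2) \<partial>M) = ennreal (\<integral>\<omega>. (X (r j) \<omega> - X n \<omega>)\<^sup>2 \<partial>M)"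
          by (intro nn_integral_eq_integral D2) simp
        also have "\<dots> \<le> ennreal ((1/4) ^ k)"
          by (intro ennreal_leI less_imp_le N that rN elim)
        finally show ?case .
      qed
    qed simp
    finally show ?thesis .
  qed
  have YX2: "integrable M (\<lambda>\<omega>. (Y \<omega> - X n \<omega>)\<^sup>2)" if "n \<ge> N 0" for n
    using fatou[OF that] by (intro integrableI_bounded) (auto simp: order_le_less_trans)
  have Y2: "integrable M (\<lambda>\<omega>. (Y \<omega>)\<^sup>2)"
  proof -
    have "integrable M (\<lambda>\<omega>. 2 * (Y \<omega> - X (N 0) \<omega>)\<^sup>2 + 2 * (X (N 0) \<omega>)\<^sup>2)"
      using YX2[of "N 0"] X2 by simp
    moreover have "(Y \<omega>)\<^sup>2 \<le> 2 * (Y \<omega> - X (N 0) \<omega>)\<^sup>2 + 2 * (X (N 0) \<omega>)\<^sup>2" for \<omega>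
      using zero_le_power2[of "Y \<omega> - 2 * X (N 0) \<omega>"] by (simp add: power2_eq_square algebra_simps)
    ultimately show ?thesis by (rule_tac Bochner_Integration.integrable_bound) auto
  qed
  have "(\<lambda>n. \<integral>\<omega>. (Y \<omega> - X n \<omega>)\<^sup>2 \<partial>M) \<longlonglongrightarrow> 0"
  proof (rule LIMSEQ_I)
    fix e :: real assume e: "e > 0"
    obtain k where k: "(1/4 :: real) ^ k < e" using e real_arch_pow_inv[of e "1/4"] by auto
    show "\<exists>n0. \<forall>n\<ge>n0. norm ((\<integral>\<omega>. (Y \<omega> - X n \<omega>)\<^sup>2 \<partial>M) - 0) < e"
    proof (intro exI allI impI)
      fix n assume n: "n \<ge> max (N 0) (N k)"
      have "ennreal (\<integral>\<omega>. (Y \<omega> - X n \<omega>)\<^sup>2 \<partial>M) = (\<integral>\<^sup>+\<omega>. ennreal ((Y \<omega> - X n \<omega>)\<^sup>2) \<partial>M)"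
        by (rule nn_integral_eq_integral[symmetric]) (use YX2 n in auto)
      also have "\<dots> \<le> ennreal ((1/4) ^ k)" using n by (intro fatou) auto
      finally have "(\<integral>\<omega>. (Y \<omega> - X n \<omega>)\<^sup>2 \<partial>M) \<le> (1/4) ^ k" by (simp add: ennreal_le_iff)
      thus "norm ((\<integral>\<omega>. (Y \<omega> - X n \<omega>)\<^sup>2 \<partial>M) - 0) < e" using k by simp
    qed
  qed
  thus thesis using that Ym Y2 by blast
qed

lemma sq_diff_le3: "(a - d)\<^sup>2 \<le> 3 * ((a - b)\<^sup>2 + (b - c)\<^sup>2 + (c - d)\<^sup>2)" for a b c d :: real
proof -
  have "0 \<le> ((a - b) - (b - c))\<^sup>2 + ((b - c) - (c - d))\<^sup>2 + ((a - b) - (c - d))\<^sup>2" by simp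
  thus ?thesis by (simp add: power2_eq_square algebra_simps)
qed

lemma integrable_sq_diff:
  fixes f g :: "'a \<Rightarrow> real"
  assumes "f \<in> borel_measurable M" "g \<in> borel_measurable M" "integrable M (\<lambda>x. (f x)\<^sup>2)" "integrable M (\<lambda>x. (g x)\<^sup>2)"
  shows "integrable M (\<lambda>x. (f x - g x)\<^sup>2)"
  unfolding power2_diff using integrable_mult_of_squares[OF assms] assms
  by (intro Bochner_Integration.integrable_diff Bochner_Integration.integrable_add) (auto simp: mult.assoc)

locale noise =
  fixes M :: "'w measure" and H0 :: real and H :: "real^'d" and W :: "real \<Rightarrow> real^'d \<Rightarrow> 'w \<Rightarrow> real"
  assumes W: "frac_noise M H0 H W" and H: "\<And>i. 0 < H $ i" "\<And>i. H $ i < 1" and H0: "0 < H0" "H0 \<le> 1"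
begin

sublocale prob_space M using W by (simp add: frac_noise_def)

abbreviation mu :: "(real \<times> (real^'d)) measure" where "mu \<equiv> noise_spec H0 H"

lemmas rep_meas = field_rep_rv_measurable[OF W H H0]
  and rep_sq = field_rep_rv_square_integrable[OF W H H0]
  and rep_iso = field_rep_isometry[OF W H H0]

lemma elem_int_diff:
  assumes "valid_elem E" "valid_elem E'"
  shows "elem_int W E \<in> borel_measurable M" "integrable M (\<lambda>\<omega>. (elem_int W E \<omega>)\<^sup>2)" "elem_ft E \<in> borel_measurable borel"
    "has_bochner_integral mu (\<lambda>z. (norm (elem_ft E z - elem_ft E' z))\<^sup>2) (\<integral>\<omega>. (elem_int W E \<omega> - elem_int W E' \<omega>)\<^sup>2 \<partial>M)"
  using rep_meas[OF field_rep_elem_int[OF assms(1)]] rep_sq[OF field_rep_elem_int[OF assms(1)]]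
    field_rep_measurable[OF field_rep_elem_int[OF assms(1), of W]]
    rep_iso[OF field_rep_diff[OF field_rep_elem_int[OF assms(1)] field_rep_elem_int[OF assms(2)]]]
  by auto

lemma elem_ft_tendsto:
  assumes f: "integrable lborel f" and E: "\<And>n. valid_elem (E n)"
    and lim: "(\<lambda>n. \<integral>\<^sup>+ z. ennreal \<bar>f z - elem_fun (E n) z\<bar> \<partial>lborel) \<longlonglongrightarrow> 0"
  shows "(\<lambda>n. elem_ft (E n) z) \<longlonglongrightarrow> ft f z"
proof -
  have i: "integrable lborel (\<lambda>z. \<bar>f z - elem_fun (E n) z\<bar>)" for n
    by (intro integrable_abs Bochner_Integration.integrable_diff f integrable_elem_fun E)
  have "(\<integral>\<^sup>+ z. ennreal \<bar>f z - elem_fun (E n) z\<bar> \<partial>lborel) = ennreal (\<integral>z. \<bar>f z - elem_fun (E n) z\<bar> \<partial>lborel)" for n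
    by (rule nn_integral_eq_integral[OF i]) simp
  with lim have "(\<lambda>n. ennreal (\<integral>z. \<bar>f z - elem_fun (E n) z\<bar> \<partial>lborel)) \<longlonglongrightarrow> ennreal 0" by simp
  hence l: "(\<lambda>n. \<integral>z. \<bar>f z - elem_fun (E n) z\<bar> \<partial>lborel) \<longlonglongrightarrow> 0"
    by (subst (asm) tendsto_ennreal_iff) auto
  have "(\<lambda>n. ft f z - elem_ft (E n) z) \<longlonglongrightarrow> 0"
    by (rule Lim_null_comparison[OF always_eventually l])
       (use norm_ft_diff_le[OF f integrable_elem_fun[OF E]] in \<open>simp add: ft_elem_fun[OF E]\<close>)
  from tendsto_diff[OF tendsto_const[of "ft f z"] this] show ?thesis by simp
qed

text \<open>The isometry is only needed up to the constant 3 coming from the squared triangle inequality.\<close>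
lemma wiener_integral_lower:
  assumes "wiener_integral M W f U" "wiener_integral M W g V"
    and f: "integrable lborel f" and g: "integrable lborel g"
  shows "(\<integral>\<^sup>+ z. ennreal ((norm (ft f z - ft g z))\<^sup>2) \<partial>mu) \<le> ennreal (3 * (\<integral>\<omega>. (U \<omega> - V \<omega>)\<^sup>2 \<partial>M))"
proof -
  from assms(1) obtain E where U: "U \<in> borel_measurable M" "integrable M (\<lambda>\<omega>. (U \<omega>)\<^sup>2)" and
      E: "\<And>n. valid_elem (E n)" "(\<lambda>n. \<integral>\<^sup>+ z. ennreal \<bar>f z - elem_fun (E n) z\<bar> \<partial>lborel) \<longlonglongrightarrow> 0"
      "(\<lambda>n. \<integral>\<omega>. (U \<omega> - elem_int W (E n) \<omega>)\<^sup>2 \<partial>M) \<longlonglongrightarrow> 0" by (auto simp: wiener_integral_def)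
  from assms(2) obtain E' where V: "V \<in> borel_measurable M" "integrable M (\<lambda>\<omega>. (V \<omega>)\<^sup>2)" and
      E': "\<And>n. valid_elem (E' n)" "(\<lambda>n. \<integral>\<^sup>+ z. ennreal \<bar>g z - elem_fun (E' n) z\<bar> \<partial>lborel) \<longlonglongrightarrow> 0"
      "(\<lambda>n. \<integral>\<omega>. (V \<omega> - elem_int W (E' n) \<omega>)\<^sup>2 \<partial>M) \<longlonglongrightarrow> 0" by (auto simp: wiener_integral_def)
  let ?X = "\<lambda>n. elem_int W (E n)" and ?Y = "\<lambda>n. elem_int W (E' n)"
  note eE = elem_int_diff[OF E(1) E'(1)] and eE' = elem_int_diff[OF E'(1) E(1)]
  have b: "(\<integral>\<omega>. (?X n \<omega> - ?Y n \<omega>)\<^sup>2 \<partial>M) \<le> 3 * ((\<integral>\<omega>. (U \<omega> - ?X n \<omega>)\<^sup>2 \<partial>M) + (\<integral>\<omega>. (U \<omega> - V \<omega>)\<^sup>2 \<partial>M) + (\<integral>\<omega>. (V \<omega> - ?Y n \<omega>)\<^sup>2 \<partial>M))" for n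
  proof -
    have i: "integrable M (\<lambda>\<omega>. (U \<omega> - ?X n \<omega>)\<^sup>2)" "integrable M (\<lambda>\<omega>. (U \<omega> - V \<omega>)\<^sup>2)" "integrable M (\<lambda>\<omega>. (V \<omega> - ?Y n \<omega>)\<^sup>2)"
      by (intro integrable_sq_diff U V eE eE')+
    have "(\<integral>\<omega>. (?X n \<omega> - ?Y n \<omega>)\<^sup>2 \<partial>M) \<le> (\<integral>\<omega>. 3 * ((U \<omega> - ?X n \<omega>)\<^sup>2 + (U \<omega> - V \<omega>)\<^sup>2 + (V \<omega> - ?Y n \<omega>)\<^sup>2) \<partial>M)"
    proof (rule integral_mono)
      show "integrable M (\<lambda>\<omega>. (?X n \<omega> - ?Y n \<omega>)\<^sup>2)" by (intro integrable_sq_diff eE eE')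
      show "integrable M (\<lambda>\<omega>. 3 * ((U \<omega> - ?X n \<omega>)\<^sup>2 + (U \<omega> - V \<omega>)\<^sup>2 + (V \<omega> - ?Y n \<omega>)\<^sup>2))" using i by simp
      show "(?X n \<omega> - ?Y n \<omega>)\<^sup>2 \<le> 3 * ((U \<omega> - ?X n \<omega>)\<^sup>2 + (U \<omega> - V \<omega>)\<^sup>2 + (V \<omega> - ?Y n \<omega>)\<^sup>2)" for \<omega>
        using sq_diff_le3[of "?X n \<omega>" "?Y n \<omega>" "U \<omega>" "V \<omega>"] by (simp add: power2_commute[of "?X n \<omega>" "U \<omega>"])
    qed
    also have "\<dots> = 3 * ((\<integral>\<omega>. (U \<omega> - ?X n \<omega>)\<^sup>2 \<partial>M) + (\<integral>\<omega>. (U \<omega> - V \<omega>)\<^sup>2 \<partial>M) + (\<integral>\<omega>. (V \<omega> - ?Y n \<omega>)\<^sup>2 \<partial>M))"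
      using i by simp
    finally show ?thesis .
  qed
  \<comment> \<open>The approximating sequences of the given Wiener integrals come without a common
    majorant, so only Fatou's lemma applies to their pointwise converging transforms.\<close>
  have "(\<integral>\<^sup>+ z. ennreal ((norm (ft f z - ft g z))\<^sup>2) \<partial>mu) = (\<integral>\<^sup>+ z. liminf (\<lambda>n. ennreal ((norm (elem_ft (E n) z - elem_ft (E' n) z))\<^sup>2)) \<partial>mu)"
  proof (intro nn_integral_cong)
    fix z
    have "(\<lambda>n. ennreal ((norm (elem_ft (E n) z - elem_ft (E' n) z))\<^sup>2)) \<longlonglongrightarrow> ennreal ((norm (ft f z - ft g z))\<^sup>2)"
      by (intro tendsto_ennrealI tendsto_intros elem_ft_tendsto f g E E')
    thus "ennreal ((norm (ft f z - ft g z))\<^sup>2) = liminf (\<lambda>n. ennreal ((norm (elem_ft (E n) z - elem_ft (E' n) z))\<^sup>2))"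
      by (intro lim_imp_Liminf[symmetric]) simp_all
  qed
  also have "\<dots> \<le> liminf (\<lambda>n. \<integral>\<^sup>+ z. ennreal ((norm (elem_ft (E n) z - elem_ft (E' n) z))\<^sup>2) \<partial>mu)"
    by (rule nn_integral_liminf) (use eE(3) eE'(3) in measurable)
  also have "\<dots> = liminf (\<lambda>n. ennreal (\<integral>\<omega>. (?X n \<omega> - ?Y n \<omega>)\<^sup>2 \<partial>M))"
    using eE(4) by (subst nn_integral_eq_integral) (auto simp: has_bochner_integral_iff)
  also have "\<dots> \<le> liminf (\<lambda>n. ennreal (3 * ((\<integral>\<omega>. (U \<omega> - ?X n \<omega>)\<^sup>2 \<partial>M) + (\<integral>\<omega>. (U \<omega> - V \<omega>)\<^sup>2 \<partial>M) + (\<integral>\<omega>. (V \<omega> - ?Y n \<omega>)\<^sup>2 \<partial>M))))"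
    by (intro Liminf_mono always_eventually allI ennreal_leI b)
  also have "\<dots> = ennreal (3 * (0 + (\<integral>\<omega>. (U \<omega> - V \<omega>)\<^sup>2 \<partial>M) + 0))"
    by (intro lim_imp_Liminf tendsto_ennrealI tendsto_intros E E') simp
  finally show ?thesis by simp
qed

text \<open>The transforms converge pointwise under the integrable envelope, hence in L2 of the
  spectral measure. The isometry makes the elementary integrals Cauchy over M, and completeness
  provides the limit.\<close>

lemma wiener_integral_exists:
  assumes f: "integrable lborel f" and E: "\<And>n. valid_elem (E n)"
    and lim: "(\<lambda>n. \<integral>\<^sup>+ z. ennreal \<bar>f z - elem_fun (E n) z\<bar> \<partial>lborel) \<longlonglongrightarrow> 0"
    and K: "\<And>n z. (norm (elem_ft (E n) z))\<^sup>2 \<le> K * noise_env z"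
  obtains U where "wiener_integral M W f U" "(\<lambda>n. \<integral>\<omega>. (U \<omega> - elem_int W (E n) \<omega>)\<^sup>2 \<partial>M) \<longlonglongrightarrow> 0"
proof -
  let ?X = "\<lambda>n. elem_int W (E n)"
  note e = elem_int_diff[OF E E]
  have cauchy: "\<exists>N. \<forall>m\<ge>N. \<forall>n\<ge>N. (\<integral>\<omega>. (?X m \<omega> - ?X n \<omega>)\<^sup>2 \<partial>M) < ee" if ee: "ee > 0" for ee
  proof -
    have fm [measurable]: "ft f \<in> borel_measurable borel"
      by (rule borel_measurable_LIMSEQ_metric[OF e(3) elem_ft_tendsto[OF f E lim]])
    have em [measurable]: "elem_ft (E n) \<in> borel_measurable borel" for n by (rule e(3))
    have bd: "(norm (elem_ft (E n) z - ft f z))\<^sup>2 \<le> 4 * K * noise_env z" for n z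
    proof -
      \<comment> \<open>The envelope survives the pointwise limit; bounding a squared difference by
        twice the sum of squares then gives the factor 4.\<close>
      have fz: "(norm (ft f z))\<^sup>2 \<le> K * noise_env z"
        by (rule Lim_bounded[OF tendsto_power[OF tendsto_norm[OF elem_ft_tendsto[OF f E lim]]]]) (use K in auto)
      have "(norm (elem_ft (E n) z - ft f z))\<^sup>2 \<le> (norm (elem_ft (E n) z) + norm (ft f z))\<^sup>2"
        by (intro power_mono norm_triangle_ineq4) simp
      also have "\<dots> \<le> 2 * (norm (elem_ft (E n) z))\<^sup>2 + 2 * (norm (ft f z))\<^sup>2"
        using zero_le_power2[of "norm (elem_ft (E n) z) - norm (ft f z)"] by (simp add: power2_eq_square algebra_simps)
      also have "\<dots> \<le> 4 * K * noise_env z" using fz K[of n z] by simp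
      finally show ?thesis .
    qed
    have "(\<lambda>n. \<integral>z. (norm (elem_ft (E n) z - ft f z))\<^sup>2 \<partial>mu) \<longlonglongrightarrow> (\<integral>z. 0 \<partial>mu)"
    proof (rule integral_dominated_convergence[where w = "\<lambda>z. 4 * K * noise_env z"])
      show "integrable mu (\<lambda>z. 4 * K * noise_env z)" by (intro integrable_mult_right integrable_noise_env H H0)
      show "AE z in mu. (\<lambda>n. (norm (elem_ft (E n) z - ft f z))\<^sup>2) \<longlonglongrightarrow> 0"
      proof (intro AE_I2)
        fix z
        have "(\<lambda>n. (norm (elem_ft (E n) z - ft f z))\<^sup>2) \<longlonglongrightarrow> (norm (ft f z - ft f z))\<^sup>2"
          by (intro tendsto_intros elem_ft_tendsto f E lim)
        thus "(\<lambda>n. (norm (elem_ft (E n) z - ft f z))\<^sup>2) \<longlonglongrightarrow> 0" by simp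
      qed
    qed (use bd in auto)
    hence l: "(\<lambda>n. \<integral>z. (norm (elem_ft (E n) z - ft f z))\<^sup>2 \<partial>mu) \<longlonglongrightarrow> 0" by simp
    have "\<forall>\<^sub>F n in sequentially. (\<integral>z. (norm (elem_ft (E n) z - ft f z))\<^sup>2 \<partial>mu) < ee / 4"
      by (rule order_tendstoD(2)[OF l]) (use ee in simp)
    then obtain N where N: "\<And>n. n \<ge> N \<Longrightarrow> (\<integral>z. (norm (elem_ft (E n) z - ft f z))\<^sup>2 \<partial>mu) < ee / 4"
      by (auto simp: eventually_sequentially)
    have i: "integrable mu (\<lambda>z. (norm (elem_ft (E n) z - ft f z))\<^sup>2)" for n
    proof (rule Bochner_Integration.integrable_bound)
      show "integrable mu (\<lambda>z. 4 * K * noise_env z)" by (intro integrable_mult_right integrable_noise_env H H0)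
      show "AE z in mu. norm ((norm (elem_ft (E n) z - ft f z))\<^sup>2) \<le> norm (4 * K * noise_env z)"
        by (intro AE_I2) (use bd in \<open>simp add: order_trans[OF _ abs_ge_self]\<close>)
    qed simp
    show ?thesis
    proof (intro exI allI impI)
      fix m n assume mn: "m \<ge> N" "n \<ge> N"
      have "(\<integral>\<omega>. (?X m \<omega> - ?X n \<omega>)\<^sup>2 \<partial>M) = (\<integral>z. (norm (elem_ft (E m) z - elem_ft (E n) z))\<^sup>2 \<partial>mu)"
        using e(4) by (simp add: has_bochner_integral_iff)
      also have "\<dots> \<le> (\<integral>z. 2 * (norm (elem_ft (E m) z - ft f z))\<^sup>2 + 2 * (norm (elem_ft (E n) z - ft f z))\<^sup>2 \<partial>mu)"
      proof (rule integral_mono)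
        show "integrable mu (\<lambda>z. (norm (elem_ft (E m) z - elem_ft (E n) z))\<^sup>2)" using e(4) by (simp add: has_bochner_integral_iff)
        show "integrable mu (\<lambda>z. 2 * (norm (elem_ft (E m) z - ft f z))\<^sup>2 + 2 * (norm (elem_ft (E n) z - ft f z))\<^sup>2)" using i by simp
        fix z
        have "(norm (elem_ft (E m) z - elem_ft (E n) z))\<^sup>2 \<le> (norm (elem_ft (E m) z - ft f z) + norm (elem_ft (E n) z - ft f z))\<^sup>2"
          using norm_triangle_ineq4[of "elem_ft (E m) z - ft f z" "elem_ft (E n) z - ft f z"] by (intro power_mono) auto
        also have "\<dots> \<le> 2 * (norm (elem_ft (E m) z - ft f z))\<^sup>2 + 2 * (norm (elem_ft (E n) z - ft f z))\<^sup>2"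
          using zero_le_power2[of "norm (elem_ft (E m) z - ft f z) - norm (elem_ft (E n) z - ft f z)"] by (simp add: power2_eq_square algebra_simps)
        finally show "(norm (elem_ft (E m) z - elem_ft (E n) z))\<^sup>2 \<le> 2 * (norm (elem_ft (E m) z - ft f z))\<^sup>2 + 2 * (norm (elem_ft (E n) z - ft f z))\<^sup>2" .
      qed
      also have "\<dots> = 2 * (\<integral>z. (norm (elem_ft (E m) z - ft f z))\<^sup>2 \<partial>mu) + 2 * (\<integral>z. (norm (elem_ft (E n) z - ft f z))\<^sup>2 \<partial>mu)"
        using i by simp
      also have "\<dots> < ee" using N[OF mn(1)] N[OF mn(2)] by simp
      finally show "(\<integral>\<omega>. (?X m \<omega> - ?X n \<omega>)\<^sup>2 \<partial>M) < ee" .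
    qed
  qed
  obtain U where U: "U \<in> borel_measurable M" "integrable M (\<lambda>\<omega>. (U \<omega>)\<^sup>2)" "(\<lambda>n. \<integral>\<omega>. (U \<omega> - ?X n \<omega>)\<^sup>2 \<partial>M) \<longlonglongrightarrow> 0"
    using L2_complete[of ?X] e(1,2) cauchy by blast
  have "wiener_integral M W f U"
    unfolding wiener_integral_def using U E lim by blast
  thus thesis using that U(3) by blast
qed

text \<open>The counterpart of \<open>wiener_integral_lower\<close>. Passing to the limit in this
  direction takes dominated convergence, so both integrals are tied to approximating sequences below
  the envelope.\<close>

lemma wiener_integral_upper:
  assumes f: "integrable lborel f" and E: "\<And>n. valid_elem (E n)"
    and lim: "(\<lambda>n. \<integral>\<^sup>+ z. ennreal \<bar>f z - elem_fun (E n) z\<bar> \<partial>lborel) \<longlonglongrightarrow> 0"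
    and K: "\<And>n z. (norm (elem_ft (E n) z))\<^sup>2 \<le> K * noise_env z"
    and U: "wiener_integral M W f U" "(\<lambda>n. \<integral>\<omega>. (U \<omega> - elem_int W (E n) \<omega>)\<^sup>2 \<partial>M) \<longlonglongrightarrow> 0"
    and f': "integrable lborel f'" and E': "\<And>n. valid_elem (E' n)"
    and lim': "(\<lambda>n. \<integral>\<^sup>+ z. ennreal \<bar>f' z - elem_fun (E' n) z\<bar> \<partial>lborel) \<longlonglongrightarrow> 0"
    and K': "\<And>n z. (norm (elem_ft (E' n) z))\<^sup>2 \<le> K' * noise_env z"
    and U': "wiener_integral M W f' U'" "(\<lambda>n. \<integral>\<omega>. (U' \<omega> - elem_int W (E' n) \<omega>)\<^sup>2 \<partial>M) \<longlonglongrightarrow> 0"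
  shows "ennreal (\<integral>\<omega>. (U \<omega> - U' \<omega>)\<^sup>2 \<partial>M) \<le> 3 * (\<integral>\<^sup>+ z. ennreal ((norm (ft f z - ft f' z))\<^sup>2) \<partial>mu)"
proof -
  let ?X = "\<lambda>n. elem_int W (E n)" and ?Y = "\<lambda>n. elem_int W (E' n)"
  note e = elem_int_diff[OF E E'] and e' = elem_int_diff[OF E' E]
  have Um: "U \<in> borel_measurable M" "integrable M (\<lambda>\<omega>. (U \<omega>)\<^sup>2)" and Um': "U' \<in> borel_measurable M" "integrable M (\<lambda>\<omega>. (U' \<omega>)\<^sup>2)"
    using U(1) U'(1) by (auto simp: wiener_integral_def)
  have em [measurable]: "elem_ft (E n) \<in> borel_measurable borel" "elem_ft (E' n) \<in> borel_measurable borel" for n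
    by (rule e(3) e'(3))+
  have fm [measurable]: "ft f \<in> borel_measurable borel" "ft f' \<in> borel_measurable borel"
    by (rule borel_measurable_LIMSEQ_metric[OF em(1) elem_ft_tendsto[OF f E lim]]
         borel_measurable_LIMSEQ_metric[OF em(2) elem_ft_tendsto[OF f' E' lim']])+
  have bd: "(norm (elem_ft (E n) z - elem_ft (E' n) z))\<^sup>2 \<le> (2 * K + 2 * K') * noise_env z" for n z
  proof -
    have "(norm (elem_ft (E n) z - elem_ft (E' n) z))\<^sup>2 \<le> (norm (elem_ft (E n) z) + norm (elem_ft (E' n) z))\<^sup>2"
      by (intro power_mono norm_triangle_ineq4) simp
    also have "\<dots> \<le> 2 * (norm (elem_ft (E n) z))\<^sup>2 + 2 * (norm (elem_ft (E' n) z))\<^sup>2"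
      using zero_le_power2[of "norm (elem_ft (E n) z) - norm (elem_ft (E' n) z)"] by (simp add: power2_eq_square algebra_simps)
    also have "\<dots> \<le> (2 * K + 2 * K') * noise_env z" using K[of n z] K'[of n z] by (simp add: algebra_simps)
    finally show ?thesis .
  qed
  have iw: "integrable mu (\<lambda>z. (2 * K + 2 * K') * noise_env z)" by (intro integrable_mult_right integrable_noise_env H H0)
  have lz: "(\<lambda>n. (norm (elem_ft (E n) z - elem_ft (E' n) z))\<^sup>2) \<longlonglongrightarrow> (norm (ft f z - ft f' z))\<^sup>2" for z
    by (intro tendsto_intros elem_ft_tendsto f E lim f' E' lim')
  have "(\<lambda>n. \<integral>z. (norm (elem_ft (E n) z - elem_ft (E' n) z))\<^sup>2 \<partial>mu) \<longlonglongrightarrow> (\<integral>z. (norm (ft f z - ft f' z))\<^sup>2 \<partial>mu)"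
    by (rule integral_dominated_convergence[OF _ _ iw]) (use bd lz in auto)
  moreover have "(\<integral>z. (norm (elem_ft (E n) z - elem_ft (E' n) z))\<^sup>2 \<partial>mu) = (\<integral>\<omega>. (?X n \<omega> - ?Y n \<omega>)\<^sup>2 \<partial>M)" for n
    using e(4) by (simp add: has_bochner_integral_iff)
  ultimately have XY: "(\<lambda>n. \<integral>\<omega>. (?X n \<omega> - ?Y n \<omega>)\<^sup>2 \<partial>M) \<longlonglongrightarrow> (\<integral>z. (norm (ft f z - ft f' z))\<^sup>2 \<partial>mu)" by simp
  have ifz: "integrable mu (\<lambda>z. (norm (ft f z - ft f' z))\<^sup>2)"
    by (rule integrable_dominated_convergence[OF _ _ iw, where s = "\<lambda>n z. (norm (elem_ft (E n) z - elem_ft (E' n) z))\<^sup>2"]) (use bd lz in auto)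
  have "(\<integral>\<omega>. (U \<omega> - U' \<omega>)\<^sup>2 \<partial>M) \<le> 3 * (0 + (\<integral>z. (norm (ft f z - ft f' z))\<^sup>2 \<partial>mu) + 0)"
  proof (rule LIMSEQ_le_const)
    show "(\<lambda>n. 3 * ((\<integral>\<omega>. (U \<omega> - ?X n \<omega>)\<^sup>2 \<partial>M) + (\<integral>\<omega>. (?X n \<omega> - ?Y n \<omega>)\<^sup>2 \<partial>M) + (\<integral>\<omega>. (U' \<omega> - ?Y n \<omega>)\<^sup>2 \<partial>M)))
       \<longlonglongrightarrow> 3 * (0 + (\<integral>z. (norm (ft f z - ft f' z))\<^sup>2 \<partial>mu) + 0)"
      by (intro tendsto_intros U U' XY)
    have "(\<integral>\<omega>. (U \<omega> - U' \<omega>)\<^sup>2 \<partial>M) \<le> 3 * ((\<integral>\<omega>. (U \<omega> - ?X n \<omega>)\<^sup>2 \<partial>M) + (\<integral>\<omega>. (?X n \<omega> - ?Y n \<omega>)\<^sup>2 \<partial>M) + (\<integral>\<omega>. (U' \<omega> - ?Y n \<omega>)\<^sup>2 \<partial>M))" for n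
    proof -
      have i: "integrable M (\<lambda>\<omega>. (U \<omega> - ?X n \<omega>)\<^sup>2)" "integrable M (\<lambda>\<omega>. (?X n \<omega> - ?Y n \<omega>)\<^sup>2)" "integrable M (\<lambda>\<omega>. (U' \<omega> - ?Y n \<omega>)\<^sup>2)"
        by (intro integrable_sq_diff Um Um' e e')+
      have "(\<integral>\<omega>. (U \<omega> - U' \<omega>)\<^sup>2 \<partial>M) \<le> (\<integral>\<omega>. 3 * ((U \<omega> - ?X n \<omega>)\<^sup>2 + (?X n \<omega> - ?Y n \<omega>)\<^sup>2 + (U' \<omega> - ?Y n \<omega>)\<^sup>2) \<partial>M)"
      proof (rule integral_mono)
        show "integrable M (\<lambda>\<omega>. (U \<omega> - U' \<omega>)\<^sup>2)" by (intro integrable_sq_diff Um Um')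
        show "integrable M (\<lambda>\<omega>. 3 * ((U \<omega> - ?X n \<omega>)\<^sup>2 + (?X n \<omega> - ?Y n \<omega>)\<^sup>2 + (U' \<omega> - ?Y n \<omega>)\<^sup>2))" using i by simp
        show "(U \<omega> - U' \<omega>)\<^sup>2 \<le> 3 * ((U \<omega> - ?X n \<omega>)\<^sup>2 + (?X n \<omega> - ?Y n \<omega>)\<^sup>2 + (U' \<omega> - ?Y n \<omega>)\<^sup>2)" for \<omega>
          using sq_diff_le3[of "U \<omega>" "U' \<omega>" "?X n \<omega>" "?Y n \<omega>"] by (simp add: power2_commute[of "U' \<omega>" "?Y n \<omega>"])
      qed
      thus ?thesis using i by simp
    qed
    thus "\<exists>N. \<forall>n\<ge>N. (\<integral>\<omega>. (U \<omega> - U' \<omega>)\<^sup>2 \<partial>M) \<le> 3 * ((\<integral>\<omega>. (U \<omega> - ?X n \<omega>)\<^sup>2 \<partial>M) + (\<integral>\<omega>. (?X n \<omega> - ?Y n \<omega>)\<^sup>2 \<partial>M) + (\<integral>\<omega>. (U' \<omega> - ?Y n \<omega>)\<^sup>2 \<partial>M))"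
      by blast
  qed
  hence "ennreal (\<integral>\<omega>. (U \<omega> - U' \<omega>)\<^sup>2 \<partial>M) \<le> ennreal (3 * (\<integral>z. (norm (ft f z - ft f' z))\<^sup>2 \<partial>mu))" by (simp add: ennreal_leI)
  also have "\<dots> = 3 * (\<integral>\<^sup>+ z. ennreal ((norm (ft f z - ft f' z))\<^sup>2) \<partial>mu)"
    using ifz by (subst nn_integral_eq_integral) (auto simp: ennreal_mult)
  finally show ?thesis .
qed

end

section \<open>Spectral criterion for solvability\<close>

lemma wave_time_ft_measurable [measurable (raw)]:
  assumes [measurable]: "f \<in> borel_measurable M" "g \<in> borel_measurable M"
  shows "(\<lambda>x. wave_time_ft t (f x) (g x)) \<in> borel_measurable M"
  unfolding wave_time_ft_def cis_conv_exp by measurable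

text \<open>The squared transform of the integrand formally taken at \<epsilon> = 0. Solvability
  will be equivalent to its integrability against the spectral measure for all t \<ge> 0.\<close>

definition wave_energy :: "real \<Rightarrow> real \<times> (real^'d) \<Rightarrow> real" where
  "wave_energy t = (\<lambda>(\<tau>, \<xi>). (norm (wave_time_ft t \<tau> (norm \<xi>)))\<^sup>2)"

lemma wave_energy_measurable [measurable]: "wave_energy t \<in> borel_measurable borel"
  unfolding wave_energy_def borel_prod[symmetric] by measurable

lemma wave_energy_nonneg: "0 \<le> wave_energy t z"
  by (simp add: wave_energy_def case_prod_beta')

definition mollifier :: "real \<Rightarrow> real \<times> (real^'d) \<Rightarrow> real" where
  "mollifier \<epsilon> z = exp (- \<epsilon> * (norm (snd z))\<^sup>2 / 2)"

lemma mollifier_measurable [measurable]: "mollifier \<epsilon> \<in> borel_measurable borel"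
  unfolding mollifier_def borel_prod[symmetric] by measurable

lemma mollifier_le_1: "0 \<le> \<epsilon> \<Longrightarrow> mollifier \<epsilon> z \<le> 1"
  by (simp add: mollifier_def)

lemma mollifier_pos: "0 < mollifier \<epsilon> z"
  by (simp add: mollifier_def)

lemma mollifier_mono: "\<epsilon> \<le> \<epsilon>' \<Longrightarrow> mollifier \<epsilon>' z \<le> mollifier \<epsilon> z"
  by (simp add: mollifier_def mult_right_mono)

lemma tendsto_mollifier: "e \<longlonglongrightarrow> 0 \<Longrightarrow> (\<lambda>n. mollifier (e n) z) \<longlonglongrightarrow> 1"
proof -
  assume e: "e \<longlonglongrightarrow> 0"
  have "(\<lambda>n. exp (- e n * (norm (snd z))\<^sup>2 / 2)) \<longlonglongrightarrow> exp (- 0 * (norm (snd z))\<^sup>2 / 2)"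
    by (intro tendsto_intros e) simp
  thus ?thesis by (simp add: mollifier_def)
qed

lemma norm_ft_wave_src_diff:
  fixes x :: "real^'d"
  assumes "\<epsilon> > 0" "\<epsilon>' > 0" "t \<ge> 0" "snd z \<noteq> 0"
  shows "(norm (ft (wave_src \<epsilon> t x) z - ft (wave_src \<epsilon>' t x) z))\<^sup>2 = (mollifier \<epsilon> z - mollifier \<epsilon>' z)\<^sup>2 * wave_energy t z"
proof -
  obtain \<tau> \<xi> where z: "z = (\<tau>, \<xi>)" by (cases z)
  have "ft (wave_src \<epsilon> t x) z - ft (wave_src \<epsilon>' t x) z =
      cis (\<xi> \<bullet> x) * of_real (mollifier \<epsilon> z - mollifier \<epsilon>' z) * wave_time_ft t \<tau> (norm \<xi>)"
    using assms by (simp add: z ft_wave_src mollifier_def algebra_simps)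
  thus ?thesis by (simp add: norm_mult power_mult_distrib wave_energy_def z flip: of_real_diff)
qed

lemma norm_ft_wave_src:
  fixes x :: "real^'d"
  assumes "\<epsilon> > 0" "t \<ge> 0" "snd z \<noteq> 0"
  shows "(norm (ft (wave_src \<epsilon> t x) z))\<^sup>2 = (mollifier \<epsilon> z)\<^sup>2 * wave_energy t z"
  using assms by (cases z) (simp add: ft_wave_src norm_mult power_mult_distrib wave_energy_def mollifier_def)

context noise
begin

text \<open>Valid also for H0 = 1: the atom then sits at \<tau> = 0, while the spatial factor still
  has a density.\<close>

lemma AE_mu_nonzero: "AE z in mu. snd z \<noteq> 0"
proof -
  interpret P: pair_sigma_finite "spec H0" "space_spec H" unfolding pair_sigma_finite_def by simp
  have "AE \<xi> in space_spec H. \<xi> \<noteq> 0"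
    unfolding space_spec_def by (subst AE_density) (use AE_lborel_singleton[of "0 :: real^'d"] in auto)
  show ?thesis unfolding noise_spec_def
  proof (rule P.AE_pair_measure)
    show "{z \<in> space (spec H0 \<Otimes>\<^sub>M space_spec H). snd z \<noteq> 0} \<in> sets (spec H0 \<Otimes>\<^sub>M space_spec H)"
      by measurable
  qed (use \<open>AE \<xi> in space_spec H. \<xi> \<noteq> 0\<close> in auto)
qed

text \<open>Fix one small e by the Cauchy property with tolerance 1 and let the other mollification
  tend to 0. Fatou's lemma bounds the energy weighted with (mollifier - 1)^2, a weight bounded below
  at high frequencies.\<close>

lemma solvable_imp_high_freq_finite:
  assumes solv: "wave_solvable M W"
  shows "\<exists>R. (\<integral>\<^sup>+ z. ennreal (wave_energy 1 z) * indicator {z. R \<le> norm (snd z)} z \<partial>mu) < \<infinity>"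
proof -
  let ?f = "\<lambda>\<epsilon>. wave_src \<epsilon> 1 (0 :: real^'d)"
  obtain U where U: "\<And>\<epsilon>. \<epsilon> > 0 \<Longrightarrow> wiener_integral M W (?f \<epsilon>) (U \<epsilon>)"
     "\<And>\<delta>. \<delta> > 0 \<Longrightarrow> \<exists>\<eta>>0. \<forall>\<epsilon>1 \<epsilon>2. 0 < \<epsilon>1 \<longrightarrow> \<epsilon>1 < \<eta> \<longrightarrow> 0 < \<epsilon>2 \<longrightarrow> \<epsilon>2 < \<eta> \<longrightarrow> (\<integral>\<omega>. (U \<epsilon>1 \<omega> - U \<epsilon>2 \<omega>)\<^sup>2 \<partial>M) < \<delta>"
    using solv[unfolded wave_solvable_def, rule_format, of 1 0] unfolding wave_src_def by auto
  obtain \<eta> where \<eta>: "\<eta> > 0" "\<And>\<epsilon>1 \<epsilon>2. 0 < \<epsilon>1 \<Longrightarrow> \<epsilon>1 < \<eta> \<Longrightarrow> 0 < \<epsilon>2 \<Longrightarrow> \<epsilon>2 < \<eta> \<Longrightarrow> (\<integral>\<omega>. (U \<epsilon>1 \<omega> - U \<epsilon>2 \<omega>)\<^sup>2 \<partial>M) < 1"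
    using U(2)[of 1] by auto
  define e where "e = \<eta> / 2"
  define en where "en n = e / real (Suc n)" for n
  have e: "0 < e" "e < \<eta>" using \<eta> by (auto simp: e_def)
  have en: "0 < en n" "en n < \<eta>" for n
  proof -
    show "0 < en n" using e by (simp add: en_def)
    have "e / real (Suc n) \<le> e / 1" using e by (intro divide_left_mono) auto
    thus "en n < \<eta>" using e by (simp add: en_def)
  qed
  have en0: "en \<longlonglongrightarrow> 0"
    using tendsto_mult[OF tendsto_const[of e] LIMSEQ_inverse_real_of_nat] by (simp add: en_def[abs_def] divide_inverse)
  have "(\<integral>\<^sup>+ z. ennreal ((mollifier e z - 1)\<^sup>2 * wave_energy 1 z) \<partial>mu) =
     (\<integral>\<^sup>+ z. liminf (\<lambda>n. ennreal ((norm (ft (?f e) z - ft (?f (en n)) z))\<^sup>2)) \<partial>mu)"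
  proof (rule nn_integral_cong_AE, use AE_mu_nonzero in eventually_elim)
    case (elim z)
    have "(\<lambda>n. ennreal ((mollifier e z - mollifier (en n) z)\<^sup>2 * wave_energy 1 z)) \<longlonglongrightarrow> ennreal ((mollifier e z - 1)\<^sup>2 * wave_energy 1 z)"
      by (intro tendsto_ennrealI tendsto_intros tendsto_mollifier en0)
    moreover have "(norm (ft (?f e) z - ft (?f (en n)) z))\<^sup>2 = (mollifier e z - mollifier (en n) z)\<^sup>2 * wave_energy 1 z" for n
      using elim e en by (intro norm_ft_wave_src_diff) auto
    ultimately show ?case by (intro lim_imp_Liminf[symmetric]) simp_all
  qed
  also have "\<dots> \<le> liminf (\<lambda>n. \<integral>\<^sup>+ z. ennreal ((norm (ft (?f e) z - ft (?f (en n)) z))\<^sup>2) \<partial>mu)"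
  proof (rule nn_integral_liminf)
    fix n
    have "ft (?f \<epsilon>) \<in> borel_measurable borel" if "\<epsilon> > 0" for \<epsilon>
      by (rule borel_measurable_LIMSEQ_metric[OF elem_int_diff(3)[OF valid_grid_elem valid_grid_elem]
            elem_ft_tendsto[OF integrable_wave_src valid_grid_elem grid_elem_L1]]) (use that in auto)
    from this[OF e(1)] this[OF en(1)[of n]]
    show "(\<lambda>z. ennreal ((norm (ft (?f e) z - ft (?f (en n)) z))\<^sup>2)) \<in> borel_measurable mu" by measurable
  qed
  also have "\<dots> \<le> liminf (\<lambda>n. ennreal (3 * (\<integral>\<omega>. (U e \<omega> - U (en n) \<omega>)\<^sup>2 \<partial>M)))"
    by (intro Liminf_mono always_eventually allI wiener_integral_lower U integrable_wave_src e en) auto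
  also have "\<dots> \<le> ennreal 3"
  proof (rule Liminf_le)
    show "\<forall>\<^sub>F n in sequentially. ennreal (3 * (\<integral>\<omega>. (U e \<omega> - U (en n) \<omega>)\<^sup>2 \<partial>M)) \<le> ennreal 3"
      using \<eta>(2)[OF e en] by (intro always_eventually allI ennreal_leI) (simp add: less_imp_le)
  qed simp
  finally have fin: "(\<integral>\<^sup>+ z. ennreal ((mollifier e z - 1)\<^sup>2 * wave_energy 1 z) \<partial>mu) \<le> ennreal 3" .
  \<comment> \<open>For |\<xi>| \<ge> R the exponent e * |\<xi>|^2 / 2 is at least 1, so the
    mollifier is at most exp (-1) \<le> 1 / 2 and the weight at least 1 / 4.\<close>
  define R where "R = sqrt (2 / e)"
  have "(\<integral>\<^sup>+ z. ennreal (wave_energy 1 z) * indicator {z. R \<le> norm (snd z)} z \<partial>mu) \<le>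
      (\<integral>\<^sup>+ z. 4 * ennreal ((mollifier e z - 1)\<^sup>2 * wave_energy 1 z) \<partial>mu)"
  proof (rule nn_integral_mono)
    fix z :: "real \<times> (real^'d)"
    show "ennreal (wave_energy 1 z) * indicator {z. R \<le> norm (snd z)} z \<le> 4 * ennreal ((mollifier e z - 1)\<^sup>2 * wave_energy 1 z)"
    proof (cases "R \<le> norm (snd z)")
      case True
      have "R\<^sup>2 \<le> (norm (snd z))\<^sup>2" using True e by (intro power_mono) (auto simp: R_def)
      hence "1 \<le> e * (norm (snd z))\<^sup>2 / 2" using e by (simp add: R_def field_simps)
      hence "mollifier e z \<le> exp (-1)" by (simp add: mollifier_def)
      also have "exp (-1 :: real) \<le> 1 / 2" using exp_neg_le_inverse[of 1] by simp
      finally have "1 / 2 \<le> 1 - mollifier e z" by simp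
      hence "(1 / 2)\<^sup>2 \<le> (1 - mollifier e z)\<^sup>2" by (intro power_mono) auto
      hence "1 * wave_energy 1 z \<le> (4 * (mollifier e z - 1)\<^sup>2) * wave_energy 1 z"
        by (intro mult_right_mono wave_energy_nonneg) (simp add: power2_commute power_divide)
      hence "ennreal (wave_energy 1 z) \<le> ennreal (4 * ((mollifier e z - 1)\<^sup>2 * wave_energy 1 z))"
        by (intro ennreal_leI) (simp add: mult.assoc)
      also have "\<dots> = 4 * ennreal ((mollifier e z - 1)\<^sup>2 * wave_energy 1 z)"
        by (subst ennreal_mult) (auto simp: wave_energy_nonneg)
      finally show ?thesis using True by simp
    qed simp
  qed
  also have "\<dots> = 4 * (\<integral>\<^sup>+ z. ennreal ((mollifier e z - 1)\<^sup>2 * wave_energy 1 z) \<partial>mu)"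
    by (rule nn_integral_cmult) measurable
  also have "\<dots> \<le> 4 * ennreal 3" by (intro mult_left_mono fin) simp
  also have "\<dots> < \<infinity>" by (simp add: ennreal_mult_less_top)
  finally show ?thesis by blast
qed

text \<open>The integrand mollified at \<epsilon> = 1 has a transform below the envelope, and for
  |\<xi>| < 1 the square of its mollifier is at least exp (-1), so dividing it out costs a
  constant.\<close>

lemma low_freq_finite:
  assumes t: "t \<ge> 0"
  shows "(\<integral>\<^sup>+ z. ennreal (wave_energy t z) * indicator {z. norm (snd z) < 1} z \<partial>mu) < \<infinity>"
proof -
  let ?f = "wave_src 1 t (0 :: real^'d)"
  obtain K where K: "K \<ge> 0" "\<And>n z. (norm (elem_ft (grid_elem n t ?f) z))\<^sup>2 \<le> K * noise_env z"
    using elem_ft_grid_bound[of 1 t 0] t by auto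
  have b: "(norm (ft ?f z))\<^sup>2 \<le> K * noise_env z" for z
    by (rule Lim_bounded[OF tendsto_power[OF tendsto_norm[OF elem_ft_tendsto[OF integrable_wave_src valid_grid_elem grid_elem_L1]]]])
       (use K t in auto)
  have "(\<integral>\<^sup>+ z. ennreal (wave_energy t z) * indicator {z. norm (snd z) < 1} z \<partial>mu) \<le> (\<integral>\<^sup>+ z. ennreal (exp 1 * K * noise_env z) \<partial>mu)"
  proof (rule nn_integral_mono_AE, use AE_mu_nonzero in eventually_elim)
    case (elim z)
    show ?case
    proof (cases "norm (snd z) < 1")
      case True
      have "(norm (snd z))\<^sup>2 \<le> 1" using True by (simp add: power_le_one)
      hence "exp (-1) \<le> (mollifier 1 z)\<^sup>2" by (simp add: mollifier_def power2_eq_square flip: exp_add)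
      hence "exp (-1) * wave_energy t z \<le> (mollifier 1 z)\<^sup>2 * wave_energy t z"
        by (intro mult_right_mono wave_energy_nonneg)
      also have "\<dots> \<le> K * noise_env z" using b[of z] norm_ft_wave_src[of 1 t z 0] t elim by simp
      finally have "exp 1 * (exp (-1) * wave_energy t z) \<le> exp 1 * (K * noise_env z)" by (intro mult_left_mono) auto
      moreover have "exp 1 * exp (-1 :: real) = 1" by (simp flip: exp_add)
      ultimately have "wave_energy t z \<le> exp 1 * K * noise_env z" by (simp only: mult.assoc[symmetric] mult_1)
      thus ?thesis using True by (simp add: ennreal_leI)
    qed simp
  qed
  also have "\<dots> < \<infinity>"
  proof -
    have "integrable mu (\<lambda>z. exp 1 * K * noise_env z)" by (intro integrable_mult_right integrable_noise_env H H0)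
    moreover have "0 \<le> noise_env z" for z :: "real \<times> (real^'d)"
      by (simp add: noise_env_def case_prod_beta' prod_nonneg)
    hence "0 \<le> exp 1 * K * noise_env z" for z :: "real \<times> (real^'d)" using K(1) by simp
    ultimately show ?thesis by (subst nn_integral_eq_integral) auto
  qed
  finally show ?thesis .
qed

text \<open>Wiener integrals are chosen for all \<epsilon> along the grid approximations, so that
  \<open>wiener_integral_upper\<close> compares any two of them. Dominated convergence with the
  unmollified energy as majorant makes their distance small.\<close>

lemma finite_imp_solvable:
  assumes fin: "\<And>t. t \<ge> 0 \<Longrightarrow> (\<integral>\<^sup>+ z. ennreal (wave_energy t z) \<partial>mu) < \<infinity>"
  shows "wave_solvable M W"
  unfolding wave_solvable_def
proof (intro allI impI)
  fix t :: real and x :: "real^'d" assume t: "0 \<le> t"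
  let ?f = "\<lambda>\<epsilon>. wave_src \<epsilon> t x"
  let ?E = "\<lambda>\<epsilon> n. grid_elem n t (?f \<epsilon>)"
  have "\<exists>K. \<forall>n z. (norm (elem_ft (?E \<epsilon> n) z))\<^sup>2 \<le> K * noise_env z" if "\<epsilon> > 0" for \<epsilon>
    using elem_ft_grid_bound[OF that t, of x] by metis
  hence "\<forall>\<epsilon>. \<exists>K. \<epsilon> > 0 \<longrightarrow> (\<forall>n z. (norm (elem_ft (?E \<epsilon> n) z))\<^sup>2 \<le> K * noise_env z)" by blast
  from choice[OF this] obtain K where K: "\<And>\<epsilon> n z. \<epsilon> > 0 \<Longrightarrow> (norm (elem_ft (?E \<epsilon> n) z))\<^sup>2 \<le> K \<epsilon> * noise_env z" by blast
  have "\<forall>\<epsilon>. \<exists>U. \<epsilon> > 0 \<longrightarrow> wiener_integral M W (?f \<epsilon>) U \<and> (\<lambda>n. \<integral>\<omega>. (U \<omega> - elem_int W (?E \<epsilon> n) \<omega>)\<^sup>2 \<partial>M) \<longlonglongrightarrow> 0"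
  proof
    fix \<epsilon>
    show "\<exists>U. \<epsilon> > 0 \<longrightarrow> wiener_integral M W (?f \<epsilon>) U \<and> (\<lambda>n. \<integral>\<omega>. (U \<omega> - elem_int W (?E \<epsilon> n) \<omega>)\<^sup>2 \<partial>M) \<longlonglongrightarrow> 0"
    proof (cases "\<epsilon> > 0")
      case \<epsilon>: True
      obtain U where "wiener_integral M W (?f \<epsilon>) U" "(\<lambda>n. \<integral>\<omega>. (U \<omega> - elem_int W (?E \<epsilon> n) \<omega>)\<^sup>2 \<partial>M) \<longlonglongrightarrow> 0"
        by (rule wiener_integral_exists[OF integrable_wave_src[OF \<epsilon> t] valid_grid_elem grid_elem_L1[OF \<epsilon> t] K[OF \<epsilon>]])
      thus ?thesis by blast
    qed simp
  qed
  from choice[OF this] obtain U where U: "\<And>\<epsilon>. \<epsilon> > 0 \<Longrightarrow> wiener_integral M W (?f \<epsilon>) (U \<epsilon>)"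
     "\<And>\<epsilon>. \<epsilon> > 0 \<Longrightarrow> (\<lambda>n. \<integral>\<omega>. (U \<epsilon> \<omega> - elem_int W (?E \<epsilon> n) \<omega>)\<^sup>2 \<partial>M) \<longlonglongrightarrow> 0" by blast
  \<comment> \<open>The squared spectral distance to the formal limit at \<epsilon> = 0. It is
    monotone in \<epsilon>, so convergence along 1 / (n + 1) controls all small \<epsilon>.\<close>
  define \<psi> where "\<psi> \<epsilon> = (\<integral>z. (1 - mollifier \<epsilon> z)\<^sup>2 * wave_energy t z \<partial>mu)" for \<epsilon>
  have we: "integrable mu (wave_energy t)"
    by (rule integrableI_nonneg[OF _ _ fin[OF t]]) (simp_all add: wave_energy_nonneg)
  have m2: "(1 - mollifier \<epsilon> z)\<^sup>2 \<le> 1" if "\<epsilon> > 0" for \<epsilon> and z :: "real \<times> (real^'d)"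
    using mollifier_le_1[of \<epsilon> z] mollifier_pos[of \<epsilon> z] that by (simp add: power_le_one)
  have mb: "(1 - mollifier \<epsilon> z)\<^sup>2 * wave_energy t z \<le> wave_energy t z" if "\<epsilon> > 0" for \<epsilon> and z :: "real \<times> (real^'d)"
    using mult_right_mono[OF m2[OF that] wave_energy_nonneg[of t z]] by simp
  have i\<psi>: "integrable mu (\<lambda>z. (1 - mollifier \<epsilon> z)\<^sup>2 * wave_energy t z)" if "\<epsilon> > 0" for \<epsilon>
    by (rule Bochner_Integration.integrable_bound[OF we])
       (use mb[OF that] in \<open>simp_all add: abs_mult abs_of_nonneg[OF wave_energy_nonneg]\<close>)
  have \<psi>_mono: "\<psi> \<epsilon> \<le> \<psi> \<epsilon>'" if "0 < \<epsilon>" "\<epsilon> \<le> \<epsilon>'" for \<epsilon> \<epsilon>'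
    unfolding \<psi>_def using that mollifier_mono[OF that(2)] mollifier_le_1[OF less_imp_le[OF that(1)]]
    by (intro integral_mono i\<psi> mult_right_mono power_mono wave_energy_nonneg) simp_all
  have "(\<lambda>n. \<psi> (1 / real (Suc n))) \<longlonglongrightarrow> (\<integral>z. 0 \<partial>mu)"
    unfolding \<psi>_def
  proof (rule integral_dominated_convergence[OF _ _ we])
    show "AE z in mu. (\<lambda>n. (1 - mollifier (1 / real (Suc n)) z)\<^sup>2 * wave_energy t z) \<longlonglongrightarrow> 0"
    proof (rule AE_I2)
      fix z :: "real \<times> (real^'d)"
      have "(\<lambda>n. 1 / real (Suc n)) \<longlonglongrightarrow> 0" using LIMSEQ_inverse_real_of_nat by (simp add: inverse_eq_divide)
      hence "(\<lambda>n. (1 - mollifier (1 / real (Suc n)) z)\<^sup>2 * wave_energy t z) \<longlonglongrightarrow> (1 - 1)\<^sup>2 * wave_energy t z"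
        by (intro tendsto_intros tendsto_mollifier)
      thus "(\<lambda>n. (1 - mollifier (1 / real (Suc n)) z)\<^sup>2 * wave_energy t z) \<longlonglongrightarrow> 0" by simp
    qed
    show "AE z in mu. norm ((1 - mollifier (1 / real (Suc n)) z)\<^sup>2 * wave_energy t z) \<le> wave_energy t z" for n
      using mb[of "1 / real (Suc n)"] by (simp add: abs_mult abs_of_nonneg[OF wave_energy_nonneg])
  qed auto
  hence \<psi>0: "(\<lambda>n. \<psi> (1 / real (Suc n))) \<longlonglongrightarrow> 0" by simp
  have UU: "(\<integral>\<omega>. (U \<epsilon>1 \<omega> - U \<epsilon>2 \<omega>)\<^sup>2 \<partial>M) \<le> 3 * (\<psi> \<epsilon>1 + \<psi> \<epsilon>2)" if \<epsilon>: "\<epsilon>1 > 0" "\<epsilon>2 > 0" for \<epsilon>1 \<epsilon>2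
  proof -
    have "ennreal (\<integral>\<omega>. (U \<epsilon>1 \<omega> - U \<epsilon>2 \<omega>)\<^sup>2 \<partial>M) \<le> 3 * (\<integral>\<^sup>+ z. ennreal ((norm (ft (?f \<epsilon>1) z - ft (?f \<epsilon>2) z))\<^sup>2) \<partial>mu)"
      by (rule wiener_integral_upper[OF integrable_wave_src[OF \<epsilon>(1) t] valid_grid_elem grid_elem_L1[OF \<epsilon>(1) t] K[OF \<epsilon>(1)] U(1,2)[OF \<epsilon>(1)]
        integrable_wave_src[OF \<epsilon>(2) t] valid_grid_elem grid_elem_L1[OF \<epsilon>(2) t] K[OF \<epsilon>(2)] U(1,2)[OF \<epsilon>(2)]])
    also have "(\<integral>\<^sup>+ z. ennreal ((norm (ft (?f \<epsilon>1) z - ft (?f \<epsilon>2) z))\<^sup>2) \<partial>mu) \<le>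
       (\<integral>\<^sup>+ z. ennreal ((1 - mollifier \<epsilon>1 z)\<^sup>2 * wave_energy t z + (1 - mollifier \<epsilon>2 z)\<^sup>2 * wave_energy t z) \<partial>mu)"
    proof (rule nn_integral_mono_AE, use AE_mu_nonzero in eventually_elim)
      case (elim z)
      let ?a = "1 - mollifier \<epsilon>1 z" and ?b = "1 - mollifier \<epsilon>2 z"
      have ab: "0 \<le> ?a" "0 \<le> ?b" using mollifier_le_1[of \<epsilon>1 z] mollifier_le_1[of \<epsilon>2 z] \<epsilon> by simp_all
      have "(mollifier \<epsilon>1 z - mollifier \<epsilon>2 z)\<^sup>2 = (?a - ?b)\<^sup>2" by (simp add: power2_commute)
      also have "\<dots> \<le> ?a\<^sup>2 + ?b\<^sup>2"
      proof -
        have "(a - b)\<^sup>2 \<le> a\<^sup>2 + b\<^sup>2" if "0 \<le> a" "0 \<le> b" for a b :: real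
          using mult_nonneg_nonneg[OF that] by (simp add: power2_diff)
        thus ?thesis using ab by blast
      qed
      finally have "(mollifier \<epsilon>1 z - mollifier \<epsilon>2 z)\<^sup>2 * wave_energy t z \<le> (?a\<^sup>2 + ?b\<^sup>2) * wave_energy t z"
        by (intro mult_right_mono wave_energy_nonneg)
      thus ?case using norm_ft_wave_src_diff[OF \<epsilon> t elim, of x] by (intro ennreal_leI) (simp add: distrib_right)
    qed
    also have "\<dots> = ennreal (\<psi> \<epsilon>1 + \<psi> \<epsilon>2)"
      unfolding \<psi>_def using i\<psi>[OF \<epsilon>(1)] i\<psi>[OF \<epsilon>(2)]
      by (subst nn_integral_eq_integral)
         (auto intro!: AE_I2 add_nonneg_nonneg mult_nonneg_nonneg wave_energy_nonneg)
    finally have "ennreal (\<integral>\<omega>. (U \<epsilon>1 \<omega> - U \<epsilon>2 \<omega>)\<^sup>2 \<partial>M) \<le> 3 * ennreal (\<psi> \<epsilon>1 + \<psi> \<epsilon>2)" by (simp add: mult_left_mono)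
    also have "\<dots> = ennreal (3 * (\<psi> \<epsilon>1 + \<psi> \<epsilon>2))"
      by (subst ennreal_mult) (auto simp: \<psi>_def wave_energy_nonneg intro!: add_nonneg_nonneg integral_nonneg_AE)
    finally show ?thesis
      by (subst (asm) ennreal_le_iff) (auto simp: \<psi>_def wave_energy_nonneg intro!: add_nonneg_nonneg integral_nonneg_AE)
  qed
  show "\<exists>U. (\<forall>\<epsilon>>0. wiener_integral M W (\<lambda>(s, y). if 0 \<le> s \<and> s \<le> t then moll_wave_kernel \<epsilon> (t - s) (x - y) else 0) (U \<epsilon>)) \<and>
     (\<forall>\<delta>>0. \<exists>\<eta>>0. \<forall>\<epsilon>1 \<epsilon>2. 0 < \<epsilon>1 \<longrightarrow> \<epsilon>1 < \<eta> \<longrightarrow> 0 < \<epsilon>2 \<longrightarrow> \<epsilon>2 < \<eta> \<longrightarrow> (\<integral>\<omega>. (U \<epsilon>1 \<omega> - U \<epsilon>2 \<omega>)\<^sup>2 \<partial>M) < \<delta>)"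
  proof (intro exI[of _ U] conjI allI impI)
    fix \<epsilon> :: real assume "0 < \<epsilon>"
    thus "wiener_integral M W (\<lambda>(s, y). if 0 \<le> s \<and> s \<le> t then moll_wave_kernel \<epsilon> (t - s) (x - y) else 0) (U \<epsilon>)"
      using U(1) by (simp add: wave_src_def)
  next
    fix \<delta> :: real assume \<delta>: "0 < \<delta>"
    have "\<forall>\<^sub>F n in sequentially. \<psi> (1 / real (Suc n)) < \<delta> / 6"
      by (rule order_tendstoD(2)[OF \<psi>0]) (use \<delta> in simp)
    \<comment> \<open>The bound \<open>UU\<close> is three times a sum of two values of \<psi>,
      which accounts for the 6.\<close>
    then obtain n where n: "\<psi> (1 / real (Suc n)) < \<delta> / 6" by (auto simp: eventually_sequentially)
    show "\<exists>\<eta>>0. \<forall>\<epsilon>1 \<epsilon>2. 0 < \<epsilon>1 \<longrightarrow> \<epsilon>1 < \<eta> \<longrightarrow> 0 < \<epsilon>2 \<longrightarrow> \<epsilon>2 < \<eta> \<longrightarrow> (\<integral>\<omega>. (U \<epsilon>1 \<omega> - U \<epsilon>2 \<omega>)\<^sup>2 \<partial>M) < \<delta>"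
    proof (intro exI[of _ "1 / real (Suc n)"] conjI allI impI)
      fix \<epsilon>1 \<epsilon>2 assume a: "0 < \<epsilon>1" "\<epsilon>1 < 1 / real (Suc n)" "0 < \<epsilon>2" "\<epsilon>2 < 1 / real (Suc n)"
      have "\<psi> \<epsilon>1 \<le> \<psi> (1 / real (Suc n))" "\<psi> \<epsilon>2 \<le> \<psi> (1 / real (Suc n))" using a by (intro \<psi>_mono; simp)+
      hence "3 * (\<psi> \<epsilon>1 + \<psi> \<epsilon>2) < \<delta>" using n by simp
      thus "(\<integral>\<omega>. (U \<epsilon>1 \<omega> - U \<epsilon>2 \<omega>)\<^sup>2 \<partial>M) < \<delta>" using UU[OF a(1,3)] by simp
    qed simp
  qed
qed

end

section \<open>Radial reduction and power thresholds\<close>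

text \<open>The degree of homogeneity of the spatial spectral measure on balls: 1 per coordinate
  from Lebesgue measure and 1 - 2 * H_i from the density.\<close>

definition radial_exp :: "real^'d \<Rightarrow> real" where
  "radial_exp H = (\<Sum>i\<in>UNIV. 2 - 2 * H $ i)"

lemma spec_density_scale: "r > 0 \<Longrightarrow> spec_density a (r * \<tau>) = r powr (1 - 2 * a) * spec_density a \<tau>"
  by (simp add: spec_density_def abs_mult powr_mult)

lemma nn_integral_lborel_scale:
  fixes f :: "real^'d \<Rightarrow> ennreal"
  assumes r: "r > 0" and [measurable]: "f \<in> borel_measurable borel"
  shows "(\<integral>\<^sup>+ x. f x \<partial>lborel) = ennreal (r ^ CARD('d)) * (\<integral>\<^sup>+ x. f (r *\<^sub>R x) \<partial>lborel)"
proof -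
  have "(\<integral>\<^sup>+ x. f x \<partial>lborel) = (\<integral>\<^sup>+ x. f x \<partial>density (distr lborel borel (\<lambda>x. 0 + r *\<^sub>R x)) (\<lambda>_. ennreal (\<bar>r\<bar> ^ DIM(real^'d))))"
    using r by (subst lborel_affine[of r 0]) auto
  thus ?thesis using r by (simp add: nn_integral_density nn_integral_distr nn_integral_cmult)
qed

lemma emeasure_space_spec_cball_scale:
  fixes H :: "real^'d"
  assumes H: "\<And>i. 0 < H $ i" "\<And>i. H $ i < 1" and r: "r > 0"
  shows "emeasure (space_spec H) {\<xi>. norm \<xi> \<le> r} = ennreal (r powr radial_exp H) * emeasure (space_spec H) {\<xi>. norm \<xi> \<le> 1}"
proof -
  let ?w = "\<lambda>\<xi> :: real^'d. \<Prod>i\<in>UNIV. ennreal (spec_density (H $ i) (\<xi> $ i))"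
  have nn: "spec_density (H $ i) \<tau> \<ge> 0" for i \<tau> using spec_density_nonneg H by blast
  have e: "emeasure (space_spec H) {\<xi>. norm \<xi> \<le> c} = (\<integral>\<^sup>+ \<xi>. ?w \<xi> * indicator {\<xi>. norm \<xi> \<le> c} \<xi> \<partial>lborel)" for c
    unfolding space_spec_def by (rule emeasure_density) measurable
  have p: "r ^ CARD('d) * (\<Prod>i\<in>(UNIV::'d set). r powr (1 - 2 * H $ i)) = r powr radial_exp H"
  proof -
    have "r ^ CARD('d) * (\<Prod>i\<in>(UNIV::'d set). r powr (1 - 2 * H $ i)) = (\<Prod>i\<in>(UNIV::'d set). r * r powr (1 - 2 * H $ i))"
      by (simp add: prod.distrib)
    also have "\<dots> = (\<Prod>i\<in>(UNIV::'d set). r powr (2 - 2 * H $ i))"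
    proof (intro prod.cong refl)
      fix i
      have "r * r powr (1 - 2 * H $ i) = r powr (1 + (1 - 2 * H $ i))" using r by (simp add: powr_mult_base)
      also have "1 + (1 - 2 * H $ i) = 2 - 2 * H $ i" by simp
      finally show "r * r powr (1 - 2 * H $ i) = r powr (2 - 2 * H $ i)" .
    qed
    also have "\<dots> = r powr radial_exp H" using r unfolding radial_exp_def by (subst powr_sum) auto
    finally show ?thesis .
  qed
  have s: "?w (r *\<^sub>R \<xi>) = ennreal (\<Prod>i\<in>(UNIV::'d set). r powr (1 - 2 * H $ i)) * ?w \<xi>" for \<xi>
    using r nn by (simp add: spec_density_scale ennreal_mult prod.distrib prod_ennreal)
  have "emeasure (space_spec H) {\<xi>. norm \<xi> \<le> r} = ennreal (r ^ CARD('d)) * (\<integral>\<^sup>+ \<xi>. ?w (r *\<^sub>R \<xi>) * indicator {\<xi>. norm \<xi> \<le> r} (r *\<^sub>R \<xi>) \<partial>lborel)"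
    unfolding e by (rule nn_integral_lborel_scale[OF r]) measurable
  also have "(\<integral>\<^sup>+ \<xi>. ?w (r *\<^sub>R \<xi>) * indicator {\<xi>. norm \<xi> \<le> r} (r *\<^sub>R \<xi>) \<partial>lborel) =
     (\<integral>\<^sup>+ \<xi>. ennreal (\<Prod>i\<in>(UNIV::'d set). r powr (1 - 2 * H $ i)) * (?w \<xi> * indicator {\<xi>. norm \<xi> \<le> 1} \<xi>) \<partial>lborel)"
    unfolding s using r by (intro nn_integral_cong) (auto simp: indicator_def mult.assoc)
  also have "\<dots> = ennreal (\<Prod>i\<in>(UNIV::'d set). r powr (1 - 2 * H $ i)) * emeasure (space_spec H) {\<xi>. norm \<xi> \<le> 1}"
    unfolding e by (rule nn_integral_cmult) measurable
  finally show ?thesis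
    using r by (simp add: mult.assoc[symmetric] ennreal_mult[symmetric] prod_nonneg p)
qed

text \<open>On the unit ball every |\<xi>_i| is at most 1, so the indicator lies below the product
  of 2 / (1 + \<xi>_i^2), whose integral factors.\<close>

lemma emeasure_space_spec_unit_finite:
  fixes H :: "real^'d"
  assumes H: "\<And>i. 0 < H $ i" "\<And>i. H $ i < 1"
  shows "emeasure (space_spec H) {\<xi>. norm \<xi> \<le> 1} < \<infinity>"
proof -
  have "emeasure (space_spec H) {\<xi>. norm \<xi> \<le> 1} = (\<integral>\<^sup>+ \<xi>. indicator {\<xi>. norm \<xi> \<le> 1} \<xi> \<partial>space_spec H)"
    by (subst nn_integral_indicator) auto
  also have "\<dots> \<le> (\<integral>\<^sup>+ \<xi>. (\<Prod>i\<in>UNIV. ennreal (2 * (1 / (1 + (\<xi> $ i)\<^sup>2)))) \<partial>space_spec H)"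
  proof (rule nn_integral_mono)
    fix \<xi> :: "real^'d"
    show "indicator {\<xi>. norm \<xi> \<le> 1} \<xi> \<le> (\<Prod>i\<in>UNIV. ennreal (2 * (1 / (1 + (\<xi> $ i)\<^sup>2))))"
    proof (cases "norm \<xi> \<le> 1")
      case True
      have "1 \<le> 2 * (1 / (1 + (\<xi> $ i)\<^sup>2))" for i
      proof -
        have "\<bar>\<xi> $ i\<bar> \<le> 1" using component_le_norm_cart[of \<xi> i] True by simp
        hence "(\<xi> $ i)\<^sup>2 \<le> 1" by (simp add: abs_square_le_1)
        thus ?thesis by (simp add: field_simps add_pos_nonneg)
      qed
      hence "1 \<le> (\<Prod>i\<in>(UNIV::'d set). 2 * (1 / (1 + (\<xi> $ i)\<^sup>2)))" by (intro prod_ge_1) auto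
      thus ?thesis using True by (subst prod_ennreal) (auto simp flip: ennreal_1 intro!: ennreal_leI)
    qed simp
  qed
  also have "\<dots> = (\<Prod>i\<in>UNIV. \<integral>\<^sup>+ u. ennreal (2 * (1 / (1 + u\<^sup>2))) \<partial>spec (H $ i))"
    using H by (intro nn_integral_space_spec_prod) (auto simp: less_imp_neq)
  also have "\<dots> < \<infinity>"
  proof -
    have "(\<integral>\<^sup>+ u. ennreal (2 * (1 / (1 + u\<^sup>2))) \<partial>spec (H $ i)) < \<infinity>" for i
      using integrable_mult_right[OF integrable_spec_over_square[of "H $ i"], of 2] H[of i]
      by (subst nn_integral_eq_integral) (auto simp: less_imp_le)
    thus ?thesis by (simp add: less_top[symmetric] ennreal_prod_eq_top)
  qed
  finally show ?thesis .
qed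

lemma emeasure_spec_pos:
  assumes a: "0 < a" "a < 1"
  shows "emeasure (spec a) {1..2} \<noteq> 0"
proof
  assume "emeasure (spec a) {1..2} = 0"
  hence "(\<integral>\<^sup>+ \<tau>. ennreal (spec_density a \<tau>) * indicator {1..2} \<tau> \<partial>lborel) = 0"
    using a by (simp add: spec_eq_density emeasure_density)
  hence "AE \<tau> in lborel. ennreal (spec_density a \<tau>) * indicator {1..2} \<tau> = 0"
    by (subst (asm) nn_integral_0_iff_AE) auto
  hence "AE \<tau> in lborel. \<tau> \<notin> {1..2::real}"
  proof eventually_elim
    case (elim \<tau>)
    thus ?case using spec_const_pos[OF a] by (auto simp: spec_density_def indicator_def split: if_splits)
  qed
  hence "emeasure lborel {1..2::real} = 0"
    by (subst (asm) AE_iff_measurable[where N = "{1..2}"]) auto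
  thus False by simp
qed

text \<open>If the unit ball were null, scaling would make every ball null and hence the whole
  space, contrary to the positive mass of the cube with sides {1..2}.\<close>

lemma emeasure_space_spec_unit_pos:
  fixes H :: "real^'d"
  assumes H: "\<And>i. 0 < H $ i" "\<And>i. H $ i < 1"
  shows "emeasure (space_spec H) {\<xi>. norm \<xi> \<le> 1} \<noteq> 0"
proof
  assume z: "emeasure (space_spec H) {\<xi>. norm \<xi> \<le> 1} = 0"
  have "emeasure (space_spec H) (\<Union>n. {\<xi>. norm \<xi> \<le> real (Suc n)}) = 0"
  proof (rule emeasure_UN_eq_0)
    show "emeasure (space_spec H) {\<xi>. norm \<xi> \<le> real (Suc n)} = 0" for n
      using z by (subst emeasure_space_spec_cball_scale[OF H]) auto
    show "range (\<lambda>n. {\<xi> :: real^'d. norm \<xi> \<le> real (Suc n)}) \<subseteq> sets (space_spec H)" by auto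
  qed
  moreover have "(\<Union>n. {\<xi> :: real^'d. norm \<xi> \<le> real (Suc n)}) = UNIV"
  proof -
    have "\<exists>n. norm \<xi> \<le> real (Suc n)" for \<xi> :: "real^'d"
      by (rule exI[of _ "nat \<lceil>norm \<xi>\<rceil>"]) linarith
    thus ?thesis by auto
  qed
  ultimately have "emeasure (space_spec H) UNIV = 0" by simp
  moreover have "(\<Prod>i\<in>UNIV. emeasure (spec (H $ i)) {1..2}) = (\<integral>\<^sup>+ \<xi>. (\<Prod>i\<in>UNIV. indicator {1..2} (\<xi> $ i)) \<partial>space_spec H)"
    using H by (subst nn_integral_space_spec_prod) (auto simp: less_imp_neq)
  moreover have "(\<integral>\<^sup>+ \<xi>. (\<Prod>i\<in>UNIV. indicator {1..2} (\<xi> $ i)) \<partial>space_spec H) \<le> (\<integral>\<^sup>+ \<xi>. 1 \<partial>space_spec H)"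
  proof (rule nn_integral_mono)
    fix \<xi> :: "real^'d"
    show "(\<Prod>i\<in>UNIV. indicator {1..2} (\<xi> $ i)) \<le> (1::ennreal)" by (intro prod_le_1) (auto simp: indicator_def)
  qed
  ultimately have "(\<Prod>i\<in>UNIV. emeasure (spec (H $ i)) {1..2}) = 0" by simp
  thus False using emeasure_spec_pos H by auto
qed

lemma nn_integral_powr_from_0:
  assumes "p > -1" "r \<ge> 0"
  shows "(\<integral>\<^sup>+ u. ennreal (u powr p) * indicator {0..r} u \<partial>lborel) = ennreal (r powr (p + 1) / (p + 1))"
  by (rule nn_integral_has_integral_lebesgue'[OF _ has_integral_powr_from_0[OF assms]]) simp

text \<open>The image measure under the norm is determined by the half-lines \<open>{..r}\<close>,
  hence by the masses of balls; these are V * r powr \<open>radial_exp H\<close> by scaling, for r >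
  0.\<close>

lemma space_spec_radial:
  fixes H :: "real^'d"
  assumes H: "\<And>i. 0 < H $ i" "\<And>i. H $ i < 1"
  obtains c where "c > 0" "\<And>f. f \<in> borel_measurable borel \<Longrightarrow>
     (\<integral>\<^sup>+ \<xi>. f (norm \<xi>) \<partial>space_spec H) = (\<integral>\<^sup>+ r. ennreal (c * r powr (radial_exp H - 1)) * indicator {0..} r * f r \<partial>lborel)"
proof -
  let ?\<kappa> = "radial_exp H"
  have \<kappa>: "?\<kappa> > 0" unfolding radial_exp_def using H by (intro sum_pos) auto
  obtain V where V: "emeasure (space_spec H) {\<xi>. norm \<xi> \<le> 1} = ennreal V" "V > 0"
    using emeasure_space_spec_unit_finite[OF H] emeasure_space_spec_unit_pos[OF H]
    by (cases "emeasure (space_spec H) {\<xi>. norm \<xi> \<le> 1}") (auto simp: less_le)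
  \<comment> \<open>The constant arises by differentiating V * r powr \<kappa>.\<close>
  define c where "c = V * ?\<kappa>"
  let ?h = "\<lambda>r. ennreal (c * r powr (?\<kappa> - 1)) * indicator {0..} r"
    have nb: "emeasure (distr (space_spec H) borel norm) {..r} = (if r < 0 then 0 else ennreal (V * r powr ?\<kappa>))" for r
    proof -
      have e: "emeasure (distr (space_spec H) borel norm) {..r} = emeasure (space_spec H) {\<xi>. norm \<xi> \<le> r}"
        by (subst emeasure_distr) (auto simp: vimage_def)
      consider "r < 0" | "r = 0" | "r > 0" by linarith
      thus ?thesis
      proof cases
        case 1
        hence "{\<xi> :: real^'d. norm \<xi> \<le> r} = {}" by (auto simp: not_le intro: less_le_trans[OF _ norm_ge_zero])
        thus ?thesis using 1 unfolding e by simp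
      next
        case 2
        have "emeasure (space_spec H) {0} = 0"
          unfolding space_spec_def by (subst emeasure_density) (auto simp: nn_integral_0_iff_AE indicator_def intro: AE_mp[OF AE_lborel_singleton[of "0 :: real^'d"]])
        thus ?thesis using 2 unfolding e by simp
      next
        case 3
        thus ?thesis unfolding e emeasure_space_spec_cball_scale[OF H 3] V(1) using V(2)
          by (simp add: ennreal_mult[symmetric] mult.commute)
      qed
    qed
  have "distr (space_spec H) borel norm = density lborel ?h"
  proof (rule measure_eqI_generator_eq[where E = "range atMost" and \<Omega> = UNIV and A = "\<lambda>n. {..real n}"])
    show "Int_stable (range atMost :: real set set)" by (auto simp: Int_stable_def)
    fix X :: "real set" assume "X \<in> range atMost"
    then obtain r where X: "X = {..r}" by auto
    have "emeasure (density lborel ?h) {..r} = (\<integral>\<^sup>+ u. ennreal c * (ennreal (u powr (?\<kappa> - 1)) * indicator {0..r} u) \<partial>lborel)"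
      using V(2) \<kappa> by (subst emeasure_density) (auto intro!: nn_integral_cong simp: c_def ennreal_mult indicator_def)
    also have "\<dots> = ennreal c * (\<integral>\<^sup>+ u. ennreal (u powr (?\<kappa> - 1)) * indicator {0..r} u \<partial>lborel)"
      by (rule nn_integral_cmult) measurable
    also have "\<dots> = (if r < 0 then 0 else ennreal (V * r powr ?\<kappa>))"
    proof (cases "r < 0")
      case False
      thus ?thesis using \<kappa> V(2) by (subst nn_integral_powr_from_0) (auto simp: c_def ennreal_mult[symmetric])
    qed simp
    finally show "emeasure (distr (space_spec H) borel norm) X = emeasure (density lborel ?h) X"
      using nb X by simp
  next
    show "sets (distr (space_spec H) borel norm) = sigma_sets UNIV (range atMost)" "sets (density lborel ?h) = sigma_sets UNIV (range atMost)"
      by (simp_all add: borel_eq_atMost)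
    show "(\<Union>n. {..real n}) = UNIV" using real_arch_simple by auto
    fix n :: nat
    show "emeasure (distr (space_spec H) borel norm) {..real n} \<noteq> \<infinity>"
      by (simp add: nb)
  qed auto
  hence D: "density lborel ?h = distr (space_spec H) borel norm" by simp
  show ?thesis
  proof (rule that[of c])
    show "c > 0" using V(2) \<kappa> by (simp add: c_def)
    fix f :: "real \<Rightarrow> ennreal" assume [measurable]: "f \<in> borel_measurable borel"
    have "(\<integral>\<^sup>+ \<xi>. f (norm \<xi>) \<partial>space_spec H) = (\<integral>\<^sup>+ r. f r \<partial>distr (space_spec H) borel norm)"
      by (subst nn_integral_distr) auto
    also have "\<dots> = (\<integral>\<^sup>+ r. ?h r * f r \<partial>lborel)"
      unfolding D[symmetric] by (subst nn_integral_density) auto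
    finally show "(\<integral>\<^sup>+ \<xi>. f (norm \<xi>) \<partial>space_spec H) = (\<integral>\<^sup>+ r. ?h r * f r \<partial>lborel)" .
  qed
qed

section \<open>Energy in time at a fixed radius\<close>

lemma wave_time_ft_eq:
  assumes t: "t \<ge> 0" and r: "r \<noteq> 0"
  shows "wave_time_ft t \<tau> r = (cis (t * r) * interval_ft 0 t (\<tau> - r) - cis (- (t * r)) * interval_ft 0 t (\<tau> + r)) / (2 * \<i> * of_real r)"
proof -
  have "has_bochner_integral lborel (\<lambda>s. (cis (t * r) * (indicator {0<..t} s *\<^sub>R cis ((\<tau> - r) * s)) -
      cis (- (t * r)) * (indicator {0<..t} s *\<^sub>R cis ((\<tau> + r) * s))) / (2 * \<i> * of_real r))
     ((cis (t * r) * interval_ft 0 t (\<tau> - r) - cis (- (t * r)) * interval_ft 0 t (\<tau> + r)) / (2 * \<i> * of_real r))"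
    by (intro has_bochner_integral_divide_zero has_bochner_integral_diff has_bochner_integral_mult_right has_bochner_integral_interval_ft t)
  moreover have "wave_time_ft t \<tau> r = (\<integral>s. (cis (t * r) * (indicator {0<..t} s *\<^sub>R cis ((\<tau> - r) * s)) -
      cis (- (t * r)) * (indicator {0<..t} s *\<^sub>R cis ((\<tau> + r) * s))) / (2 * \<i> * of_real r) \<partial>lborel)"
    unfolding wave_time_ft_def
  proof (rule integral_cong_AE)
    show "AE s in lborel. indicator {0..t} s *\<^sub>R (cis (\<tau> * s) * of_real (sin ((t - s) * r) / r)) =
      (cis (t * r) * (indicator {0<..t} s *\<^sub>R cis ((\<tau> - r) * s)) -
      cis (- (t * r)) * (indicator {0<..t} s *\<^sub>R cis ((\<tau> + r) * s))) / (2 * \<i> * of_real r)"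
      using AE_lborel_singleton[of 0]
    proof eventually_elim
      case (elim s)
      \<comment> \<open>Splitting the sine into exponentials separates the two resonances, at \<tau>
        = r and \<tau> = -r.\<close>
      have s: "of_real (sin x) = (cis x - cis (- x)) / (2 * \<i>)" for x
        by (simp add: complex_eq_iff Re_divide Im_divide)
      have e: "cis (\<tau> * s) * (cis ((t - s) * r) - cis (- ((t - s) * r))) =
          cis (t * r) * cis ((\<tau> - r) * s) - cis (- (t * r)) * cis ((\<tau> + r) * s)"
        unfolding right_diff_distrib cis_mult by (simp add: algebra_simps)
      have "cis (\<tau> * s) * of_real (sin ((t - s) * r) / r) =
         (cis (t * r) * cis ((\<tau> - r) * s) - cis (- (t * r)) * cis ((\<tau> + r) * s)) / (2 * \<i> * of_real r)"
        unfolding of_real_divide s e[symmetric] by (simp only: times_divide_eq_right divide_divide_eq_left)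
      thus ?case using elim by (auto simp: indicator_def)
    qed
  qed (auto simp: cis_conv_exp)
  ultimately show ?thesis by (simp add: has_bochner_integral_iff)
qed

lemma norm_wave_time_ft_upper:
  assumes t: "t \<ge> 0" and r: "r > 0"
  shows "(norm (wave_time_ft t \<tau> r))\<^sup>2 \<le> (t\<^sup>2 + 4) / (2 * r\<^sup>2) * (1 / (1 + (\<tau> - r)\<^sup>2) + 1 / (1 + (\<tau> + r)\<^sup>2))"
proof -
  let ?a = "norm (interval_ft 0 t (\<tau> - r))" and ?b = "norm (interval_ft 0 t (\<tau> + r))"
  have "norm (wave_time_ft t \<tau> r) \<le> (?a + ?b) / (2 * r)"
    unfolding wave_time_ft_eq[OF t less_imp_neq[OF r, symmetric]] norm_divide
    using r norm_triangle_ineq4[of "cis (t * r) * interval_ft 0 t (\<tau> - r)" "cis (- (t * r)) * interval_ft 0 t (\<tau> + r)"]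
    by (simp add: norm_mult divide_right_mono)
  hence "(norm (wave_time_ft t \<tau> r))\<^sup>2 \<le> ((?a + ?b) / (2 * r))\<^sup>2" by (intro power_mono) auto
  also have "\<dots> = (?a + ?b)\<^sup>2 / (4 * r\<^sup>2)" by (simp add: power_divide power_mult_distrib)
  also have "\<dots> \<le> (2 * ?a\<^sup>2 + 2 * ?b\<^sup>2) / (4 * r\<^sup>2)"
    using zero_le_power2[of "?a - ?b"] by (intro divide_right_mono) (auto simp: power2_eq_square algebra_simps)
  also have "\<dots> \<le> (2 * ((t\<^sup>2 + 4) / (1 + (\<tau> - r)\<^sup>2)) + 2 * ((t\<^sup>2 + 4) / (1 + (\<tau> + r)\<^sup>2))) / (4 * r\<^sup>2)"
    using norm_sq_interval_ft_le[of 0 t "\<tau> - r"] norm_sq_interval_ft_le[of 0 t "\<tau> + r"]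
    by (intro divide_right_mono add_mono mult_left_mono) auto
  also have "\<dots> = (t\<^sup>2 + 4) / (2 * r\<^sup>2) * (1 / (1 + (\<tau> - r)\<^sup>2) + 1 / (1 + (\<tau> + r)\<^sup>2))"
  proof -
    have "(2 * (A / B) + 2 * (A / D)) / (4 * E) = A / (2 * E) * (1 / B + 1 / D)" for A B D E :: real
      by (simp add: add_divide_distrib distrib_left mult_ac)
    thus ?thesis .
  qed
  finally show ?thesis .
qed

text \<open>Split at |\<tau>| = |s| / 2. Outside, the density is nonincreasing in |\<tau>| because a
  \<ge> 1/2, hence at most a multiple of |s| powr (1 - 2 * a). Inside, |\<tau> - s| \<ge> |s| / 2,
  and the substitution \<tau> = s * u gives the smaller order |s| powr (- 2 * a).\<close>

lemma spec_resonance_upper: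
  assumes a: "1 / 2 \<le> a" "a < 1"
  obtains C where "C > 0" "\<And>s. 1 \<le> \<bar>s\<bar> \<Longrightarrow> (\<integral>\<^sup>+ \<tau>. ennreal (1 / (1 + (\<tau> - s)\<^sup>2)) \<partial>spec a) \<le> ennreal (C * \<bar>s\<bar> powr (1 - 2 * a))"
proof -
  let ?p = "1 - 2 * a"
  define A where "A = (\<integral>u. 1 / (1 + (u::real)\<^sup>2) \<partial>lborel)"
  define J where "J = (\<integral>u. \<bar>u\<bar> powr ?p / (1 + u\<^sup>2) \<partial>lborel)"
  define S where "S = 2 * spec_const a"
  have S: "S > 0" using spec_const_pos[of a] a by (simp add: S_def)
  have A0: "0 \<le> A" and J0: "0 \<le> J" by (auto simp: A_def J_def)
  have iJ: "integrable lborel (\<lambda>u. \<bar>u\<bar> powr ?p / (1 + u\<^sup>2))"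
    by (rule integrable_powr_over_square) (use a in auto)
  show ?thesis
  \<comment> \<open>The power of 2 comes from the density at |s| / 2, and 8 = 4 * 2 from the square
    of |s| / 2 and the inserted factor 2 / (1 + (\<tau> / s)^2); adding 1 ensures
    positivity.\<close>
  proof (rule that[of "(2 powr (2 * a - 1) * A + 8 * J) / S + 1"])
    show "(2 powr (2 * a - 1) * A + 8 * J) / S + 1 > 0" using S A0 J0 by (intro add_nonneg_pos divide_nonneg_pos add_nonneg_nonneg) auto
    fix s :: real assume s: "1 \<le> \<bar>s\<bar>"
    let ?r = "\<bar>s\<bar>"
    have pw: "ennreal (spec_density a \<tau>) * ennreal (1 / (1 + (\<tau> - s)\<^sup>2)) \<le>
       ennreal (2 powr (2 * a - 1) * ?r powr ?p / S * (1 / (1 + (\<tau> - s)\<^sup>2))) +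
       ennreal (8 * ?r powr (?p - 2) / S) * ennreal (\<bar>\<tau> / s\<bar> powr ?p / (1 + (\<tau> / s)\<^sup>2))" for \<tau>
    proof -
      have "spec_density a \<tau> * (1 / (1 + (\<tau> - s)\<^sup>2)) \<le> 2 powr (2 * a - 1) * ?r powr ?p / S * (1 / (1 + (\<tau> - s)\<^sup>2)) +
         8 * ?r powr (?p - 2) / S * (\<bar>\<tau> / s\<bar> powr ?p / (1 + (\<tau> / s)\<^sup>2))"
      proof (cases "?r / 2 \<le> \<bar>\<tau>\<bar>")
        case True
        have "\<bar>\<tau>\<bar> powr ?p \<le> (?r / 2) powr ?p" using True a s by (intro powr_mono2') auto
        also have "\<dots> = 2 powr (2 * a - 1) * ?r powr ?p"
        proof -
          have "2 powr (2 * a - 1) = 1 / 2 powr ?p" using powr_minus_divide[of 2 ?p] by simp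
          thus ?thesis by (simp add: powr_divide)
        qed
        finally have "spec_density a \<tau> * (1 / (1 + (\<tau> - s)\<^sup>2)) \<le> 2 powr (2 * a - 1) * ?r powr ?p / S * (1 / (1 + (\<tau> - s)\<^sup>2))"
          using S unfolding spec_density_def S_def[symmetric] by (intro mult_right_mono divide_right_mono) auto
        moreover have "0 \<le> 8 * ?r powr (?p - 2) / S * (\<bar>\<tau> / s\<bar> powr ?p / (1 + (\<tau> / s)\<^sup>2))"
          using S by (intro mult_nonneg_nonneg divide_nonneg_nonneg) auto
        ultimately show ?thesis by simp
      next
        case False
        have "?r / 2 \<le> \<bar>\<tau> - s\<bar>" using False by linarith
        hence "(?r / 2)\<^sup>2 \<le> (\<tau> - s)\<^sup>2" using power_mono[of "?r / 2" "\<bar>\<tau> - s\<bar>" 2] by simp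
        hence "1 / (1 + (\<tau> - s)\<^sup>2) \<le> 1 / (?r / 2)\<^sup>2"
          using s by (intro divide_left_mono) (auto intro!: mult_pos_pos add_pos_nonneg)
        also have "\<dots> = 4 / s\<^sup>2" by (simp add: power_divide)
        finally have 1: "1 / (1 + (\<tau> - s)\<^sup>2) \<le> 4 / s\<^sup>2" .
        have "\<bar>\<tau> / s\<bar> \<le> 1" using False s by (simp add: divide_le_eq)
        hence "(\<tau> / s)\<^sup>2 \<le> 1" by (simp add: abs_square_le_1)
        \<comment> \<open>Inserting this factor extends the inner integral to the whole line, where
          it becomes J.\<close>
        hence 2: "1 \<le> 2 / (1 + (\<tau> / s)\<^sup>2)" by (simp add: field_simps add_pos_nonneg)
        have r2: "?r powr (?p - 2) = ?r powr ?p / s\<^sup>2" by (subst powr_diff) (use s in simp)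
        have 3: "?r powr ?p * \<bar>\<tau> / s\<bar> powr ?p = \<bar>\<tau>\<bar> powr ?p" using s by (simp add: abs_divide flip: powr_mult)
        have "spec_density a \<tau> * (1 / (1 + (\<tau> - s)\<^sup>2)) \<le> \<bar>\<tau>\<bar> powr ?p / S * (4 / s\<^sup>2)"
          using S 1 unfolding spec_density_def S_def[symmetric] by (intro mult_left_mono) auto
        also have "\<dots> = (4 * ?r powr ?p / s\<^sup>2 / S * \<bar>\<tau> / s\<bar> powr ?p) * 1"
          unfolding 3[symmetric] by (simp add: mult_ac)
        also have "\<dots> \<le> (4 * ?r powr ?p / s\<^sup>2 / S * \<bar>\<tau> / s\<bar> powr ?p) * (2 / (1 + (\<tau> / s)\<^sup>2))"
          using S by (intro mult_left_mono 2 mult_nonneg_nonneg divide_nonneg_nonneg) auto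
        also have "\<dots> = 8 * ?r powr (?p - 2) / S * (\<bar>\<tau> / s\<bar> powr ?p / (1 + (\<tau> / s)\<^sup>2))"
          unfolding r2 by simp
        finally show ?thesis using S by (simp add: add_increasing)
      qed
      hence "ennreal (spec_density a \<tau> * (1 / (1 + (\<tau> - s)\<^sup>2))) \<le> ennreal (2 powr (2 * a - 1) * ?r powr ?p / S * (1 / (1 + (\<tau> - s)\<^sup>2)) +
         8 * ?r powr (?p - 2) / S * (\<bar>\<tau> / s\<bar> powr ?p / (1 + (\<tau> / s)\<^sup>2)))" by (rule ennreal_leI)
      thus ?thesis using S spec_density_nonneg[of a \<tau>] a
        by (subst (asm) ennreal_plus) (auto simp: ennreal_mult[symmetric] ennreal_mult''[symmetric])
    qed
    have "(\<integral>\<^sup>+ \<tau>. ennreal (1 / (1 + (\<tau> - s)\<^sup>2)) \<partial>spec a) = (\<integral>\<^sup>+ \<tau>. ennreal (spec_density a \<tau>) * ennreal (1 / (1 + (\<tau> - s)\<^sup>2)) \<partial>lborel)"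
      using a by (simp add: spec_eq_density nn_integral_density)
    also have "\<dots> \<le> (\<integral>\<^sup>+ \<tau>. ennreal (2 powr (2 * a - 1) * ?r powr ?p / S * (1 / (1 + (\<tau> - s)\<^sup>2))) +
       ennreal (8 * ?r powr (?p - 2) / S) * ennreal (\<bar>\<tau> / s\<bar> powr ?p / (1 + (\<tau> / s)\<^sup>2)) \<partial>lborel)"
      by (intro nn_integral_mono pw)
    also have "\<dots> = (\<integral>\<^sup>+ \<tau>. ennreal (2 powr (2 * a - 1) * ?r powr ?p / S * (1 / (1 + (\<tau> - s)\<^sup>2))) \<partial>lborel) +
       ennreal (8 * ?r powr (?p - 2) / S) * (\<integral>\<^sup>+ \<tau>. ennreal (\<bar>\<tau> / s\<bar> powr ?p / (1 + (\<tau> / s)\<^sup>2)) \<partial>lborel)"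
      by (subst nn_integral_add) (auto simp: nn_integral_cmult)
    also have "(\<integral>\<^sup>+ \<tau>. ennreal (2 powr (2 * a - 1) * ?r powr ?p / S * (1 / (1 + (\<tau> - s)\<^sup>2))) \<partial>lborel) = ennreal (2 powr (2 * a - 1) * ?r powr ?p / S * A)"
    proof -
      have i: "integrable lborel (\<lambda>\<tau>. 1 / (1 + (- s + 1 * \<tau>)\<^sup>2))"
        by (intro lborel_integrable_real_affine integrable_inverse_one_plus_square) simp
      have "A = (\<integral>\<tau>. 1 / (1 + (- s + 1 * \<tau>)\<^sup>2) \<partial>lborel)"
        unfolding A_def by (subst lborel_integral_real_affine[where c = 1 and t = "- s"]) auto
      hence "has_bochner_integral lborel (\<lambda>\<tau>. 1 / (1 + (\<tau> - s)\<^sup>2)) A" using i by (simp add: has_bochner_integral_iff)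
      hence "has_bochner_integral lborel (\<lambda>\<tau>. 2 powr (2 * a - 1) * ?r powr ?p / S * (1 / (1 + (\<tau> - s)\<^sup>2))) (2 powr (2 * a - 1) * ?r powr ?p / S * A)"
        by (rule has_bochner_integral_mult_right)
      thus ?thesis using S by (subst nn_integral_eq_integral) (auto simp: has_bochner_integral_iff)
    qed
    also have "(\<integral>\<^sup>+ \<tau>. ennreal (\<bar>\<tau> / s\<bar> powr ?p / (1 + (\<tau> / s)\<^sup>2)) \<partial>lborel) = ennreal (?r * J)"
    proof -
      have "(\<integral>\<^sup>+ \<tau>. ennreal (\<bar>\<tau> / s\<bar> powr ?p / (1 + (\<tau> / s)\<^sup>2)) \<partial>lborel) = ennreal ?r * (\<integral>\<^sup>+ u. ennreal (\<bar>(0 + s * u) / s\<bar> powr ?p / (1 + ((0 + s * u) / s)\<^sup>2)) \<partial>lborel)"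
        by (rule nn_integral_real_affine) (use s in auto)
      also have "\<dots> = ennreal ?r * (\<integral>\<^sup>+ u. ennreal (\<bar>u\<bar> powr ?p / (1 + u\<^sup>2)) \<partial>lborel)"
        using s by (auto intro!: arg_cong[where f = "\<lambda>x. ennreal ?r * x"] nn_integral_cong)
      also have "(\<integral>\<^sup>+ u. ennreal (\<bar>u\<bar> powr ?p / (1 + u\<^sup>2)) \<partial>lborel) = ennreal J"
        unfolding J_def by (rule nn_integral_eq_integral[OF iJ]) simp
      finally show ?thesis using J0 by (simp add: ennreal_mult)
    qed
    also have "ennreal (2 powr (2 * a - 1) * ?r powr ?p / S * A) + ennreal (8 * ?r powr (?p - 2) / S) * ennreal (?r * J)
       = ennreal (2 powr (2 * a - 1) * ?r powr ?p / S * A + 8 * ?r powr (?p - 2) / S * (?r * J))"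
      using S A0 J0 by (simp add: ennreal_mult[symmetric] ennreal_plus[symmetric] del: ennreal_plus)
    also have "\<dots> \<le> ennreal (((2 powr (2 * a - 1) * A + 8 * J) / S + 1) * ?r powr ?p)"
    proof (rule ennreal_leI)
      have "?r powr (?p - 2) * ?r = ?r powr (?p - 1)" using s powr_mult_base[of ?r "?p - 2"] by (simp add: mult.commute)
      also have "\<dots> \<le> ?r powr ?p" using s by (intro powr_mono) auto
      finally have "8 * J / S * (?r powr (?p - 2) * ?r) \<le> 8 * J / S * ?r powr ?p" using S J0 by (intro mult_left_mono) auto
      moreover have "0 \<le> ?r powr ?p" by simp
      ultimately show "2 powr (2 * a - 1) * ?r powr ?p / S * A + 8 * ?r powr (?p - 2) / S * (?r * J) \<le> ((2 powr (2 * a - 1) * A + 8 * J) / S + 1) * ?r powr ?p"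
        by (simp add: distrib_right distrib_left add_divide_distrib mult_ac add_increasing2)
    qed
    finally show "(\<integral>\<^sup>+ \<tau>. ennreal (1 / (1 + (\<tau> - s)\<^sup>2)) \<partial>spec a) \<le> ennreal (((2 powr (2 * a - 1) * A + 8 * J) / S + 1) * ?r powr ?p)" .
  qed
qed

lemma time_energy_upper:
  assumes a: "1 / 2 \<le> a" "a < 1" and t: "t \<ge> 0"
  obtains C where "C > 0" "\<And>r. 1 \<le> r \<Longrightarrow> (\<integral>\<^sup>+ \<tau>. ennreal ((norm (wave_time_ft t \<tau> r))\<^sup>2) \<partial>spec a) \<le> ennreal (C * r powr (- 1 - 2 * a))"
proof -
  obtain C where C: "C > 0" "\<And>s. 1 \<le> \<bar>s\<bar> \<Longrightarrow> (\<integral>\<^sup>+ \<tau>. ennreal (1 / (1 + (\<tau> - s)\<^sup>2)) \<partial>spec a) \<le> ennreal (C * \<bar>s\<bar> powr (1 - 2 * a))"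
    using spec_resonance_upper[OF a] by blast
  show ?thesis
  proof (rule that[of "(t\<^sup>2 + 4) * C"])
    show "(t\<^sup>2 + 4) * C > 0" using C by (intro mult_pos_pos) (auto simp: add_nonneg_pos)
    fix r :: real assume r: "1 \<le> r"
    have "(\<integral>\<^sup>+ \<tau>. ennreal ((norm (wave_time_ft t \<tau> r))\<^sup>2) \<partial>spec a) \<le>
       (\<integral>\<^sup>+ \<tau>. ennreal ((t\<^sup>2 + 4) / (2 * r\<^sup>2)) * (ennreal (1 / (1 + (\<tau> - r)\<^sup>2)) + ennreal (1 / (1 + (\<tau> - (- r))\<^sup>2))) \<partial>spec a)"
    proof (rule nn_integral_mono)
      fix \<tau>
      have "ennreal ((norm (wave_time_ft t \<tau> r))\<^sup>2) \<le> ennreal ((t\<^sup>2 + 4) / (2 * r\<^sup>2) * (1 / (1 + (\<tau> - r)\<^sup>2) + 1 / (1 + (\<tau> + r)\<^sup>2)))"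
        using r by (intro ennreal_leI norm_wave_time_ft_upper t) auto
      thus "ennreal ((norm (wave_time_ft t \<tau> r))\<^sup>2) \<le> ennreal ((t\<^sup>2 + 4) / (2 * r\<^sup>2)) * (ennreal (1 / (1 + (\<tau> - r)\<^sup>2)) + ennreal (1 / (1 + (\<tau> - (- r))\<^sup>2)))"
        by (subst ennreal_plus[symmetric]) (simp_all add: ennreal_mult'[symmetric] del: ennreal_plus)
    qed
    also have "\<dots> = ennreal ((t\<^sup>2 + 4) / (2 * r\<^sup>2)) * ((\<integral>\<^sup>+ \<tau>. ennreal (1 / (1 + (\<tau> - r)\<^sup>2)) \<partial>spec a) + (\<integral>\<^sup>+ \<tau>. ennreal (1 / (1 + (\<tau> - (- r))\<^sup>2)) \<partial>spec a))"
      by (subst nn_integral_cmult, measurable, subst nn_integral_add) auto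
    also have "\<dots> \<le> ennreal ((t\<^sup>2 + 4) / (2 * r\<^sup>2)) * (ennreal (C * r powr (1 - 2 * a)) + ennreal (C * r powr (1 - 2 * a)))"
      using C(2)[of r] C(2)[of "- r"] r by (intro mult_left_mono add_mono) auto
    also have "\<dots> = ennreal ((t\<^sup>2 + 4) / (2 * r\<^sup>2) * (C * r powr (1 - 2 * a) + C * r powr (1 - 2 * a)))"
    proof -
      have nn: "0 \<le> C * r powr (1 - 2 * a)" using C(1) by simp
      thus ?thesis unfolding ennreal_plus[OF nn nn, symmetric] by (intro ennreal_mult'[symmetric]) simp
    qed
    also have "(t\<^sup>2 + 4) / (2 * r\<^sup>2) * (C * r powr (1 - 2 * a) + C * r powr (1 - 2 * a)) = (t\<^sup>2 + 4) * C * (r powr (1 - 2 * a) / r\<^sup>2)"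
      using r by (simp add: field_simps)
    also have "r powr (1 - 2 * a) / r\<^sup>2 = r powr (- 1 - 2 * a)"
      using r powr_diff[of r "1 - 2 * a" 2] by (simp add: powr_numeral)
    finally show "(\<integral>\<^sup>+ \<tau>. ennreal ((norm (wave_time_ft t \<tau> r))\<^sup>2) \<partial>spec a) \<le> ennreal ((t\<^sup>2 + 4) * C * r powr (- 1 - 2 * a))" .
  qed
qed

text \<open>The real part is sin u / u, which by the mean value theorem is cos c with |c| \<le> 1,
  and cos c \<ge> 1 - c^2 / 2.\<close>

lemma norm_interval_ft_unit_ge:
  assumes "\<bar>u\<bar> \<le> 1"
  shows "norm (interval_ft 0 1 u) \<ge> 1 / 2"
proof (cases "u = 0")
  case False
  have "\<exists>c. \<bar>c\<bar> \<le> 1 \<and> sin u = u * cos c"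
  proof (cases "u > 0")
    case True
    from MVT2[OF True, of sin cos] obtain c where "0 < c" "c < u" "sin u - sin 0 = (u - 0) * cos c" by auto
    thus ?thesis using assms by (intro exI[of _ c]) auto
  next
    case n: False
    with False have "u < 0" by simp
    from MVT2[OF this, of sin cos] obtain c where "u < c" "c < 0" "sin 0 - sin u = (0 - u) * cos c" by auto
    thus ?thesis using assms by (intro exI[of _ c]) auto
  qed
  then obtain c where c: "\<bar>c\<bar> \<le> 1" "sin u = u * cos c" by blast
  have "c\<^sup>2 \<le> 1" using c(1) by (simp add: abs_square_le_1)
  hence "cos c \<ge> 1 / 2" using one_minus_cos_le[of c] by simp
  also have "cos c = Re (interval_ft 0 1 u)"
    using False c(2) by (simp add: interval_ft_def Re_divide power2_eq_square)
  also have "\<dots> \<le> norm (interval_ft 0 1 u)" by (rule complex_Re_le_cmod)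
  finally show ?thesis .
qed (simp add: interval_ft_def)

text \<open>On the window |\<tau> - r| \<le> 1 the resonant term is at least 1/2. For r \<ge> 5 one
  has |\<tau> + r| \<ge> 8, so the other term is at most 1/4 and cannot cancel it. The energy is at
  least 1 / (64 * r^2) on a window of length 2, which gives the 32; the density is estimated from
  |\<tau>| \<le> 2 * r.\<close>

lemma time_energy_lower:
  assumes a: "1 / 2 \<le> a" "a < 1"
  obtains c where "c > 0" "\<And>r. 5 \<le> r \<Longrightarrow> ennreal (c * r powr (- 1 - 2 * a)) \<le> (\<integral>\<^sup>+ \<tau>. ennreal ((norm (wave_time_ft 1 \<tau> r))\<^sup>2) \<partial>spec a)"
proof -
  define S where "S = 2 * spec_const a"
  have S: "S > 0" using spec_const_pos[of a] a by (simp add: S_def)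
  show ?thesis
  proof (rule that[of "2 powr (1 - 2 * a) / (32 * S)"])
    show "2 powr (1 - 2 * a) / (32 * S) > 0" using S by simp
    fix r :: real assume r: "5 \<le> r"
    have lo: "1 / (64 * r\<^sup>2) \<le> (norm (wave_time_ft 1 \<tau> r))\<^sup>2" if "\<tau> \<in> {r - 1..r + 1}" for \<tau>
    proof -
      let ?A = "interval_ft 0 1 (\<tau> - r)" and ?B = "interval_ft 0 1 (\<tau> + r)"
      have A: "norm ?A \<ge> 1 / 2" using that by (intro norm_interval_ft_unit_ge) auto
      have "norm ?B * \<bar>\<tau> + r\<bar> \<le> 2" by (rule norm_interval_ft_le_inverse)
      moreover have "norm ?B * 8 \<le> norm ?B * \<bar>\<tau> + r\<bar>" using that r by (intro mult_left_mono) auto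
      ultimately have B: "norm ?B \<le> 1 / 4" by simp
      have "norm (cis (1 * r) * ?A - cis (- (1 * r)) * ?B) \<ge> norm ?A - norm ?B"
        using norm_triangle_ineq2[of "cis (1 * r) * ?A" "cis (- (1 * r)) * ?B"] by (simp add: norm_mult)
      hence "(1 / 4) / (2 * r) \<le> norm (cis (1 * r) * ?A - cis (- (1 * r)) * ?B) / (2 * r)"
        using A B r by (intro divide_right_mono) auto
      also have "\<dots> = norm (wave_time_ft 1 \<tau> r)"
        using r by (simp add: wave_time_ft_eq norm_divide norm_mult)
      finally have "((1 / 4) / (2 * r))\<^sup>2 \<le> (norm (wave_time_ft 1 \<tau> r))\<^sup>2" using r by (intro power_mono) auto
      thus ?thesis by (simp add: power_divide power_mult_distrib)
    qed
    have de: "2 powr (1 - 2 * a) * r powr (1 - 2 * a) / S \<le> spec_density a \<tau>" if "\<tau> \<in> {r - 1..r + 1}" for \<tau>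
    proof -
      have "(2 * r) powr (1 - 2 * a) \<le> \<bar>\<tau>\<bar> powr (1 - 2 * a)" using that r a by (intro powr_mono2') auto
      thus ?thesis using S r by (simp add: spec_density_def S_def[symmetric] powr_mult divide_right_mono)
    qed
    have "ennreal (2 powr (1 - 2 * a) / (32 * S) * r powr (- 1 - 2 * a)) =
        ennreal (2 powr (1 - 2 * a) * r powr (1 - 2 * a) / S * (1 / (64 * r\<^sup>2))) * emeasure lborel {r - 1..r + 1}"
    proof -
      have "r powr (- 1 - 2 * a) = r powr (1 - 2 * a) / r\<^sup>2"
        using r powr_diff[of r "1 - 2 * a" 2] by (simp add: powr_numeral)
      hence "2 powr (1 - 2 * a) / (32 * S) * r powr (- 1 - 2 * a) = 2 powr (1 - 2 * a) * r powr (1 - 2 * a) / S * (1 / (64 * r\<^sup>2)) * 2"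
        by (simp add: mult_ac)
      moreover have "emeasure lborel {r - 1..r + 1} = ennreal 2" by simp
      ultimately show ?thesis by (simp only:) (intro ennreal_mult'', simp)
    qed
    also have "\<dots> = (\<integral>\<^sup>+ \<tau>. ennreal (2 powr (1 - 2 * a) * r powr (1 - 2 * a) / S * (1 / (64 * r\<^sup>2))) * indicator {r - 1..r + 1} \<tau> \<partial>lborel)"
      by (subst nn_integral_cmult_indicator) auto
    also have "\<dots> \<le> (\<integral>\<^sup>+ \<tau>. ennreal (spec_density a \<tau>) * ennreal ((norm (wave_time_ft 1 \<tau> r))\<^sup>2) \<partial>lborel)"
    proof (rule nn_integral_mono)
      fix \<tau>
      show "ennreal (2 powr (1 - 2 * a) * r powr (1 - 2 * a) / S * (1 / (64 * r\<^sup>2))) * indicator {r - 1..r + 1} \<tau>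
        \<le> ennreal (spec_density a \<tau>) * ennreal ((norm (wave_time_ft 1 \<tau> r))\<^sup>2)"
      proof (cases "\<tau> \<in> {r - 1..r + 1}")
        case True
        have "2 powr (1 - 2 * a) * r powr (1 - 2 * a) / S * (1 / (64 * r\<^sup>2)) \<le> spec_density a \<tau> * (norm (wave_time_ft 1 \<tau> r))\<^sup>2"
          using S spec_density_nonneg[of a \<tau>] a by (intro mult_mono de[OF True] lo[OF True]) auto
        thus ?thesis using True spec_density_nonneg[of a \<tau>] a by (simp add: ennreal_mult[symmetric] ennreal_leI)
      qed simp
    qed
    also have "\<dots> = (\<integral>\<^sup>+ \<tau>. ennreal ((norm (wave_time_ft 1 \<tau> r))\<^sup>2) \<partial>spec a)"
      using a by (simp add: spec_eq_density nn_integral_density)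
    finally show "ennreal (2 powr (1 - 2 * a) / (32 * S) * r powr (- 1 - 2 * a)) \<le> (\<integral>\<^sup>+ \<tau>. ennreal ((norm (wave_time_ft 1 \<tau> r))\<^sup>2) \<partial>spec a)" .
  qed
qed

lemma time_energy_one:
  assumes t: "t \<ge> 0" and r: "r > 0"
  shows "(\<integral>\<^sup>+ \<tau>. ennreal ((norm (wave_time_ft t \<tau> r))\<^sup>2) \<partial>spec 1) = ennreal (((1 - cos (t * r)) / r\<^sup>2)\<^sup>2)"
proof -
  have "wave_time_ft t 0 r = of_real ((1 - cos (t * r)) / r\<^sup>2)"
    using r unfolding wave_time_ft_eq[OF t less_imp_neq[OF r, symmetric]]
    by (simp add: interval_ft_def complex_eq_iff Re_divide Im_divide power2_eq_square field_simps)
  hence "(norm (wave_time_ft t 0 r))\<^sup>2 = ((1 - cos (t * r)) / r\<^sup>2)\<^sup>2" by (simp only: norm_of_real power2_abs)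
  thus ?thesis by (simp add: spec_def nn_integral_return)
qed

section \<open>One-dimensional integrals at infinity\<close>

lemma nn_integral_powr_to_inf_finite:
  assumes "p < -1"
  shows "(\<integral>\<^sup>+ u. ennreal (u powr p) * indicator {1..} u \<partial>lborel) < \<infinity>"
  by (subst nn_integral_has_integral_lebesgue'[OF _ has_integral_powr_to_inf[OF assms zero_less_one]]) auto

lemma nn_integral_inverse_to_inf:
  assumes "R > 0"
  shows "(\<integral>\<^sup>+ u. ennreal (1 / u) * indicator {R..} u \<partial>lborel) = \<infinity>"
proof -
  let ?I = "\<integral>\<^sup>+ u. ennreal (1 / u) * indicator {R..} u \<partial>lborel"
  have le: "ennreal (real n) \<le> ?I" for n :: nat
  proof -
    \<comment> \<open>Chosen so that the logarithm increases by exactly n between R and this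
      endpoint.\<close>
    let ?b = "R * exp (real n)"
    have b: "R \<le> ?b" using assms by simp
    have "(\<integral>\<^sup>+ u. ennreal (1 / u) * indicator {R..?b} u \<partial>lborel) = ennreal (ln ?b - ln R)"
    proof (rule nn_integral_FTC_Icc[OF _ _ _ b])
      fix u assume "u \<in> {R..?b}"
      hence "0 < u" using assms by simp
      thus "DERIV ln u :> 1 / u" "0 \<le> 1 / u" by (auto intro: DERIV_ln_divide)
    qed simp
    also have "ln ?b - ln R = real n" using assms by (simp add: ln_mult)
    finally have "ennreal (real n) = (\<integral>\<^sup>+ u. ennreal (1 / u) * indicator {R..?b} u \<partial>lborel)" by simp
    also have "\<dots> \<le> (\<integral>\<^sup>+ u. ennreal (1 / u) * indicator {R..} u \<partial>lborel)"
      by (intro nn_integral_mono mult_left_mono) (auto simp: indicator_def)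
    finally show ?thesis .
  qed
  show ?thesis
  proof (cases ?I)
    case (real x)
    obtain n :: nat where "x < real n" using reals_Archimedean2 by blast
    moreover have "ennreal (real n) \<le> ennreal x" using le[of n] unfolding real(2) .
    ultimately show ?thesis using real(1) by (simp add: ennreal_le_iff)
  qed simp
qed

text \<open>The oscillating factor is averaged out by adding the integral shifted by half a period.\<close>
lemma nn_integral_oscillating_to_inf:
  assumes R: "R > 0"
  shows "(\<integral>\<^sup>+ u. ennreal ((1 - cos u)\<^sup>2 / u) * indicator {R..} u \<partial>lborel) = \<infinity>"
proof -
  let ?f = "\<lambda>u. ennreal ((1 - cos u)\<^sup>2 / u) * indicator {R..} u"
  let ?I = "\<integral>\<^sup>+ u. ?f u \<partial>lborel"
  have "?I = (\<integral>\<^sup>+ u. ?f (pi + 1 * u) \<partial>lborel)"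
    by (subst nn_integral_real_affine[where c = 1 and t = pi]) auto
  hence "?I + ?I = (\<integral>\<^sup>+ u. ?f u + ?f (pi + 1 * u) \<partial>lborel)" by (subst nn_integral_add) auto
  \<comment> \<open>The argument simplifies to u + pi. The shift by pi changes the sign of the
    cosine, and (1 - cos u)^2 + (1 + cos u)^2 \<ge> 1 leaves a plain harmonic integrand.\<close>
  also have "\<dots> \<ge> (\<integral>\<^sup>+ u. ennreal (1 / (- pi + 1 * (pi + 1 * (u + pi)))) * indicator {R + pi..} (u + pi) \<partial>lborel)"
  proof (rule nn_integral_mono)
    fix u :: real
    show "ennreal (1 / (- pi + 1 * (pi + 1 * (u + pi)))) * indicator {R + pi..} (u + pi) \<le> ?f u + ?f (pi + 1 * u)"
    proof (cases "R \<le> u")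
      case True
      have u: "u > 0" using True R by simp
      moreover have "u + pi > 0" using u pi_gt_zero by linarith
      ultimately have u: "u > 0" "u + pi > 0" by auto
      have "1 / (u + pi) \<le> ((1 - cos u)\<^sup>2 + (1 + cos u)\<^sup>2) / (u + pi)"
        using u by (intro divide_right_mono) (auto simp: power2_eq_square algebra_simps add_increasing)
      also have "\<dots> \<le> (1 - cos u)\<^sup>2 / u + (1 + cos u)\<^sup>2 / (u + pi)"
        unfolding add_divide_distrib using u by (intro add_mono divide_left_mono) auto
      finally have "ennreal (1 / (u + pi)) \<le> ennreal ((1 - cos u)\<^sup>2 / u + (1 + cos u)\<^sup>2 / (u + pi))" by (rule ennreal_leI)
      moreover have "R \<le> pi + u" using True pi_gt_zero by linarith
      ultimately show ?thesis using True u by (simp add: ennreal_plus add.commute indicator_def)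
    qed simp
  qed
  also have "(\<integral>\<^sup>+ u. ennreal (1 / (- pi + 1 * (pi + 1 * (u + pi)))) * indicator {R + pi..} (u + pi) \<partial>lborel) =
     (\<integral>\<^sup>+ u. ennreal (1 / u) * indicator {R + pi..} u \<partial>lborel)"
    by (subst nn_integral_real_affine[where c = 1 and t = pi]) (auto simp: add.commute)
  also have "\<dots> = \<infinity>" using R by (intro nn_integral_inverse_to_inf) (simp add: add_pos_pos)
  finally show ?thesis by (simp add: top_unique)
qed

lemma high_freq_set [measurable]: "{z :: real \<times> (real^'d). R \<le> norm (snd z)} \<in> sets borel"
  by (intro borel_closed closed_Collect_le continuous_intros)

lemma low_freq_set [measurable]: "{z :: real \<times> (real^'d). norm (snd z) < R} \<in> sets borel"
  by (intro borel_open open_Collect_less continuous_intros)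

section \<open>Comparison of the energy with powers of the radius\<close>

context noise
begin

lemma energy_radial:
  obtains c where "c > 0" "\<And>t R. (\<integral>\<^sup>+ z. ennreal (wave_energy t z) * indicator {z. R \<le> norm (snd z)} z \<partial>mu) =
    (\<integral>\<^sup>+ r. ennreal (c * r powr (radial_exp H - 1)) * indicator {0..} r * (indicator {R..} r * (\<integral>\<^sup>+ \<tau>. ennreal ((norm (wave_time_ft t \<tau> r))\<^sup>2) \<partial>spec H0)) \<partial>lborel)"
proof -
  interpret S: sigma_finite_measure "spec H0" by simp
  obtain c where c: "c > 0" "\<And>f. f \<in> borel_measurable borel \<Longrightarrow>
     (\<integral>\<^sup>+ \<xi>. f (norm \<xi>) \<partial>space_spec H) = (\<integral>\<^sup>+ r. ennreal (c * r powr (radial_exp H - 1)) * indicator {0..} r * f r \<partial>lborel)"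
    using space_spec_radial[OF H] by blast
  show ?thesis
  proof (rule that[OF c(1)])
    fix t R
    let ?f = "\<lambda>r. indicator {R..} r * (\<integral>\<^sup>+ \<tau>. ennreal ((norm (wave_time_ft t \<tau> r))\<^sup>2) \<partial>spec H0)"
    have "(\<integral>\<^sup>+ z. ennreal (wave_energy t z) * indicator {z. R \<le> norm (snd z)} z \<partial>mu) =
      (\<integral>\<^sup>+ \<xi>. \<integral>\<^sup>+ \<tau>. ennreal (wave_energy t (\<tau>, \<xi>)) * indicator {z. R \<le> norm (snd z)} (\<tau>, \<xi>) \<partial>spec H0 \<partial>space_spec H)"
      by (rule nn_integral_noise_spec) measurable
    also have "\<dots> = (\<integral>\<^sup>+ \<xi>. ?f (norm \<xi>) \<partial>space_spec H)"
    proof (rule nn_integral_cong)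
      fix \<xi> :: "real^'d"
      have "(\<integral>\<^sup>+ \<tau>. ennreal (wave_energy t (\<tau>, \<xi>)) * indicator {z. R \<le> norm (snd z)} (\<tau>, \<xi>) \<partial>spec H0) =
         (\<integral>\<^sup>+ \<tau>. indicator {R..} (norm \<xi>) * ennreal ((norm (wave_time_ft t \<tau> (norm \<xi>)))\<^sup>2) \<partial>spec H0)"
        by (intro nn_integral_cong) (auto simp: wave_energy_def indicator_def)
      also have "\<dots> = ?f (norm \<xi>)" by (rule nn_integral_cmult) measurable
      finally show "(\<integral>\<^sup>+ \<tau>. ennreal (wave_energy t (\<tau>, \<xi>)) * indicator {z. R \<le> norm (snd z)} (\<tau>, \<xi>) \<partial>spec H0) = ?f (norm \<xi>)" .
    qed
    also have "\<dots> = (\<integral>\<^sup>+ r. ennreal (c * r powr (radial_exp H - 1)) * indicator {0..} r * ?f r \<partial>lborel)"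
      by (rule c(2)) measurable
    finally show "(\<integral>\<^sup>+ z. ennreal (wave_energy t z) * indicator {z. R \<le> norm (snd z)} z \<partial>mu) =
       (\<integral>\<^sup>+ r. ennreal (c * r powr (radial_exp H - 1)) * indicator {0..} r * ?f r \<partial>lborel)" .
  qed
qed

lemma high_freq_mono:
  assumes "R \<le> R'"
  shows "(\<integral>\<^sup>+ z. ennreal (wave_energy t z) * indicator {z. R' \<le> norm (snd z)} z \<partial>mu) \<le>
    (\<integral>\<^sup>+ z. ennreal (wave_energy t z) * indicator {z. R \<le> norm (snd z)} z \<partial>mu)"
  using assms by (intro nn_integral_mono mult_left_mono) (auto simp: indicator_def)

text \<open>If the time energy has order r powr q, the radial integrand at infinity is r powr
  (\<open>radial_exp H\<close> + q - 1), integrable exactly when \<open>radial_exp H\<close> + q <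
  0. The lower hypothesis asks for divergence instead of a pointwise bound because for H0 = 1 the
  energy oscillates and vanishes at arbitrarily large r.\<close>

lemma solvable_iff:
  assumes up: "\<And>t. t \<ge> 0 \<Longrightarrow> \<exists>C\<ge>0. \<forall>r\<ge>1. (\<integral>\<^sup>+ \<tau>. ennreal ((norm (wave_time_ft t \<tau> r))\<^sup>2) \<partial>spec H0) \<le> ennreal (C * r powr q)"
    and low: "\<And>R c. R \<ge> 1 \<Longrightarrow> c > 0 \<Longrightarrow> 0 \<le> radial_exp H + q \<Longrightarrow>
       (\<integral>\<^sup>+ r. ennreal (c * r powr (radial_exp H - 1)) * indicator {0..} r * (indicator {R..} r * (\<integral>\<^sup>+ \<tau>. ennreal ((norm (wave_time_ft 1 \<tau> r))\<^sup>2) \<partial>spec H0)) \<partial>lborel) = \<infinity>"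
  shows "wave_solvable M W \<longleftrightarrow> radial_exp H + q < 0"
proof
  obtain c where c: "c > 0" "\<And>t R. (\<integral>\<^sup>+ z. ennreal (wave_energy t z) * indicator {z. R \<le> norm (snd z)} z \<partial>mu) =
    (\<integral>\<^sup>+ r. ennreal (c * r powr (radial_exp H - 1)) * indicator {0..} r * (indicator {R..} r * (\<integral>\<^sup>+ \<tau>. ennreal ((norm (wave_time_ft t \<tau> r))\<^sup>2) \<partial>spec H0)) \<partial>lborel)"
    using energy_radial by blast
  {
    assume "wave_solvable M W"
    then obtain R where "(\<integral>\<^sup>+ z. ennreal (wave_energy 1 z) * indicator {z. R \<le> norm (snd z)} z \<partial>mu) < \<infinity>"
      using solvable_imp_high_freq_finite by blast
    hence "(\<integral>\<^sup>+ z. ennreal (wave_energy 1 z) * indicator {z. max 1 R \<le> norm (snd z)} z \<partial>mu) < \<infinity>"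
      using high_freq_mono[of R "max 1 R" 1] by (auto intro: le_less_trans)
    thus "radial_exp H + q < 0" using low[of "max 1 R" c] c(1) unfolding c(2) by (cases "radial_exp H + q < 0") auto
  }
  assume neg: "radial_exp H + q < 0"
  show "wave_solvable M W"
  proof (rule finite_imp_solvable)
    fix t :: real assume t: "t \<ge> 0"
    obtain C where C: "C \<ge> 0" "\<And>r. r \<ge> 1 \<Longrightarrow> (\<integral>\<^sup>+ \<tau>. ennreal ((norm (wave_time_ft t \<tau> r))\<^sup>2) \<partial>spec H0) \<le> ennreal (C * r powr q)"
      using up[OF t] by blast
    have hi: "(\<integral>\<^sup>+ z. ennreal (wave_energy t z) * indicator {z. 1 \<le> norm (snd z)} z \<partial>mu) < \<infinity>"
    proof -
      have "(\<integral>\<^sup>+ z. ennreal (wave_energy t z) * indicator {z. 1 \<le> norm (snd z)} z \<partial>mu) \<le>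
        (\<integral>\<^sup>+ r. ennreal (c * C) * (ennreal (r powr (radial_exp H + q - 1)) * indicator {1..} r) \<partial>lborel)"
        unfolding c(2)
      proof (rule nn_integral_mono)
        fix r :: real
        let ?N = "\<integral>\<^sup>+ \<tau>. ennreal ((norm (wave_time_ft t \<tau> r))\<^sup>2) \<partial>spec H0"
        show "ennreal (c * r powr (radial_exp H - 1)) * indicator {0..} r * (indicator {1..} r * ?N) \<le>
          ennreal (c * C) * (ennreal (r powr (radial_exp H + q - 1)) * indicator {1..} r)"
        proof (cases "r \<ge> 1")
          case True
          have e: "r powr (radial_exp H - 1) * r powr q = r powr (radial_exp H + q - 1)"
            by (simp add: powr_add[symmetric] algebra_simps)
          have "ennreal (c * r powr (radial_exp H - 1)) * ?N \<le> ennreal (c * r powr (radial_exp H - 1)) * ennreal (C * r powr q)"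
            by (intro mult_left_mono C(2) True) simp
          also have "\<dots> = ennreal (c * C * r powr (radial_exp H + q - 1))"
            using c(1) C(1) by (simp add: ennreal_mult[symmetric] e[symmetric] mult_ac)
          also have "\<dots> = ennreal (c * C) * ennreal (r powr (radial_exp H + q - 1))"
            using c(1) C(1) by (simp add: ennreal_mult)
          finally show ?thesis using True by simp
        qed simp
      qed
      also have "\<dots> = ennreal (c * C) * (\<integral>\<^sup>+ r. ennreal (r powr (radial_exp H + q - 1)) * indicator {1..} r \<partial>lborel)"
        by (rule nn_integral_cmult) measurable
      also have "\<dots> < \<infinity>"
        using nn_integral_powr_to_inf_finite[of "radial_exp H + q - 1"] neg by (simp add: ennreal_mult_less_top)
      finally show ?thesis .
    qed
    have "(\<integral>\<^sup>+ z. ennreal (wave_energy t z) \<partial>mu) =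
       (\<integral>\<^sup>+ z. ennreal (wave_energy t z) * indicator {z. norm (snd z) < 1} z + ennreal (wave_energy t z) * indicator {z. 1 \<le> norm (snd z)} z \<partial>mu)"
      by (intro nn_integral_cong) (auto simp: indicator_def)
    also have "\<dots> = (\<integral>\<^sup>+ z. ennreal (wave_energy t z) * indicator {z. norm (snd z) < 1} z \<partial>mu) + (\<integral>\<^sup>+ z. ennreal (wave_energy t z) * indicator {z. 1 \<le> norm (snd z)} z \<partial>mu)"
      by (rule nn_integral_add) measurable
    also have "\<dots> < \<infinity>" using hi low_freq_finite[OF t] by simp
    finally show "(\<integral>\<^sup>+ z. ennreal (wave_energy t z) \<partial>mu) < \<infinity>" .
  qed
qed

lemma solvable_iff_less_one:
  assumes a: "1 / 2 \<le> H0" "H0 < 1"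
  shows "wave_solvable M W \<longleftrightarrow> radial_exp H < 1 + 2 * H0"
proof -
  have "wave_solvable M W \<longleftrightarrow> radial_exp H + (- 1 - 2 * H0) < 0"
  proof (rule solvable_iff)
    fix t :: real assume "t \<ge> 0"
    thus "\<exists>C\<ge>0. \<forall>r\<ge>1. (\<integral>\<^sup>+ \<tau>. ennreal ((norm (wave_time_ft t \<tau> r))\<^sup>2) \<partial>spec H0) \<le> ennreal (C * r powr (- 1 - 2 * H0))"
      using time_energy_upper[OF a, of t] by (metis less_imp_le)
  next
    fix R c :: real assume R: "R \<ge> 1" and c: "c > 0" and p: "0 \<le> radial_exp H + (- 1 - 2 * H0)"
    obtain b where b: "b > 0" "\<And>r. 5 \<le> r \<Longrightarrow> ennreal (b * r powr (- 1 - 2 * H0)) \<le> (\<integral>\<^sup>+ \<tau>. ennreal ((norm (wave_time_ft 1 \<tau> r))\<^sup>2) \<partial>spec H0)"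
      using time_energy_lower[OF a] by blast
    let ?N = "\<lambda>r. \<integral>\<^sup>+ \<tau>. ennreal ((norm (wave_time_ft 1 \<tau> r))\<^sup>2) \<partial>spec H0"
    \<comment> \<open>\<open>time_energy_lower\<close> is available from r = 5 on.\<close>
    let ?R = "max 5 R"
    have "\<infinity> = ennreal (c * b) * (\<integral>\<^sup>+ r. ennreal (1 / r) * indicator {?R..} r \<partial>lborel)"
      using b c by (simp add: nn_integral_inverse_to_inf ennreal_mult_eq_top_iff ennreal_top_mult)
    also have "\<dots> = (\<integral>\<^sup>+ r. ennreal (c * b) * (ennreal (1 / r) * indicator {?R..} r) \<partial>lborel)"
      by (rule nn_integral_cmult[symmetric]) measurable
    also have "\<dots> \<le> (\<integral>\<^sup>+ r. ennreal (c * r powr (radial_exp H - 1)) * indicator {0..} r * (indicator {R..} r * ?N r) \<partial>lborel)"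
    proof (rule nn_integral_mono)
      fix r :: real
      show "ennreal (c * b) * (ennreal (1 / r) * indicator {?R..} r) \<le> ennreal (c * r powr (radial_exp H - 1)) * indicator {0..} r * (indicator {R..} r * ?N r)"
      proof (cases "?R \<le> r")
        case True
        have r: "5 \<le> r" "R \<le> r" using True by auto
        have "1 / r = r powr (- 1)" using r by (simp add: powr_minus_divide)
        also have "\<dots> \<le> r powr (radial_exp H - 1 + (- 1 - 2 * H0))" using r p by (intro powr_mono) auto
        also have "\<dots> = r powr (radial_exp H - 1) * r powr (- 1 - 2 * H0)" by (rule powr_add)
        finally have "c * b * (1 / r) \<le> c * b * (r powr (radial_exp H - 1) * r powr (- 1 - 2 * H0))"
          using b c by (intro mult_left_mono) auto
        hence "ennreal (c * b * (1 / r)) \<le> ennreal ((c * r powr (radial_exp H - 1)) * (b * r powr (- 1 - 2 * H0)))"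
          by (intro ennreal_leI) (simp add: mult_ac)
        also have "\<dots> = ennreal (c * r powr (radial_exp H - 1)) * ennreal (b * r powr (- 1 - 2 * H0))"
          using b c by (intro ennreal_mult) auto
        also have "\<dots> \<le> ennreal (c * r powr (radial_exp H - 1)) * ?N r" by (intro mult_left_mono b r) simp
        finally have "ennreal (c * b) * ennreal (1 / r) \<le> ennreal (c * r powr (radial_exp H - 1)) * ?N r"
          using b c r by (subst ennreal_mult[symmetric]) auto
        thus ?thesis using True r by simp
      qed simp
    qed
    finally show "(\<integral>\<^sup>+ r. ennreal (c * r powr (radial_exp H - 1)) * indicator {0..} r * (indicator {R..} r * ?N r) \<partial>lborel) = \<infinity>"
      by (simp add: top_unique)
  qed
  thus ?thesis by linarith
qed

lemma solvable_iff_one: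
  assumes a: "H0 = 1"
  shows "wave_solvable M W \<longleftrightarrow> radial_exp H < 4"
proof -
  have "wave_solvable M W \<longleftrightarrow> radial_exp H + (- 4) < 0"
  proof (rule solvable_iff)
    fix t :: real assume t: "t \<ge> 0"
    show "\<exists>C\<ge>0. \<forall>r\<ge>1. (\<integral>\<^sup>+ \<tau>. ennreal ((norm (wave_time_ft t \<tau> r))\<^sup>2) \<partial>spec H0) \<le> ennreal (C * r powr (- 4))"
    proof (intro exI[of _ 4] conjI allI impI)
      fix r :: real assume r: "1 \<le> r"
      have "\<bar>1 - cos (t * r)\<bar> \<le> 2" using cos_ge_minus_one[of "t * r"] cos_le_one[of "t * r"] by linarith
      hence "(1 - cos (t * r))\<^sup>2 \<le> 2\<^sup>2" by (metis abs_le_square_iff abs_numeral)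
      hence "((1 - cos (t * r)) / r\<^sup>2)\<^sup>2 \<le> 4 / (r\<^sup>2)\<^sup>2" by (simp add: power_divide divide_right_mono)
      also have "\<dots> = 4 * r powr (- 4)" using r by (simp add: powr_minus_divide powr_numeral flip: power_mult)
      finally show "(\<integral>\<^sup>+ \<tau>. ennreal ((norm (wave_time_ft t \<tau> r))\<^sup>2) \<partial>spec H0) \<le> ennreal (4 * r powr (- 4))"
        using time_energy_one[OF t, of r] r by (simp add: a ennreal_leI)
    qed simp
  next
    fix R c :: real assume R: "R \<ge> 1" and c: "c > 0" and p: "0 \<le> radial_exp H + (- 4)"
    let ?N = "\<lambda>r. \<integral>\<^sup>+ \<tau>. ennreal ((norm (wave_time_ft 1 \<tau> r))\<^sup>2) \<partial>spec H0"
    have "\<infinity> = ennreal c * (\<integral>\<^sup>+ r. ennreal ((1 - cos r)\<^sup>2 / r) * indicator {R..} r \<partial>lborel)"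
      using c R by (simp add: nn_integral_oscillating_to_inf ennreal_mult_eq_top_iff ennreal_top_mult)
    also have "\<dots> = (\<integral>\<^sup>+ r. ennreal c * (ennreal ((1 - cos r)\<^sup>2 / r) * indicator {R..} r) \<partial>lborel)"
      by (rule nn_integral_cmult[symmetric]) measurable
    also have "\<dots> \<le> (\<integral>\<^sup>+ r. ennreal (c * r powr (radial_exp H - 1)) * indicator {0..} r * (indicator {R..} r * ?N r) \<partial>lborel)"
    proof (rule nn_integral_mono)
      fix r :: real
      show "ennreal c * (ennreal ((1 - cos r)\<^sup>2 / r) * indicator {R..} r) \<le> ennreal (c * r powr (radial_exp H - 1)) * indicator {0..} r * (indicator {R..} r * ?N r)"
      proof (cases "R \<le> r")
        case True
        have r: "1 \<le> r" "R \<le> r" using True R by auto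
        have N: "?N r = ennreal (((1 - cos r) / r\<^sup>2)\<^sup>2)" using time_energy_one[of 1 r] r by (simp add: a)
        \<comment> \<open>From \<open>radial_exp H\<close> \<ge> 4 the radial weight is at least
          r^3, so against r^-4 at least 1 / r remains.\<close>
        have "1 / r = r powr 3 / (r\<^sup>2)\<^sup>2" using r by (simp add: powr_numeral power_eq_if field_simps)
        also have "\<dots> \<le> r powr (radial_exp H - 1) / (r\<^sup>2)\<^sup>2" using r p by (intro divide_right_mono powr_mono) auto
        finally have "c * (1 - cos r)\<^sup>2 * (1 / r) \<le> c * (1 - cos r)\<^sup>2 * (r powr (radial_exp H - 1) / (r\<^sup>2)\<^sup>2)"
          using c by (intro mult_left_mono) auto
        hence "c * ((1 - cos r)\<^sup>2 / r) \<le> (c * r powr (radial_exp H - 1)) * ((1 - cos r) / r\<^sup>2)\<^sup>2"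
          by (simp add: power_divide mult_ac)
        hence "ennreal (c * ((1 - cos r)\<^sup>2 / r)) \<le> ennreal ((c * r powr (radial_exp H - 1)) * ((1 - cos r) / r\<^sup>2)\<^sup>2)" by (rule ennreal_leI)
        moreover have "ennreal (c * ((1 - cos r)\<^sup>2 / r)) = ennreal c * ennreal ((1 - cos r)\<^sup>2 / r)"
          using c by (intro ennreal_mult') simp
        moreover have "ennreal ((c * r powr (radial_exp H - 1)) * ((1 - cos r) / r\<^sup>2)\<^sup>2) =
            ennreal (c * r powr (radial_exp H - 1)) * ennreal (((1 - cos r) / r\<^sup>2)\<^sup>2)"
          using c by (intro ennreal_mult') simp
        ultimately show ?thesis using True r unfolding N by simp
      qed simp
    qed
    finally show "(\<integral>\<^sup>+ r. ennreal (c * r powr (radial_exp H - 1)) * indicator {0..} r * (indicator {R..} r * ?N r) \<partial>lborel) = \<infinity>"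
      by (simp add: top_unique)
  qed
  thus ?thesis by linarith
qed

end

lemma radial_exp_eq: "radial_exp (H :: real^'d) = 2 * real CARD('d) - 2 * (\<Sum>i\<in>UNIV. H $ i)"
  by (simp add: radial_exp_def sum_subtractf sum_distrib_left)

theorem theorem1p1:
  fixes M :: "'w measure" and W :: "real \<Rightarrow> real^'d \<Rightarrow> 'w \<Rightarrow> real"
    and H0 :: real and H :: "real^'d"
  assumes "1/2 \<le> H0" and "H0 \<le> 1"
    and "\<forall>i. 0 < H$i \<and> H$i < 1"
    and "frac_noise M H0 H W"
  shows "wave_solvable M W \<longleftrightarrow>
    (if H0 = 1/2 then (\<Sum>i\<in>UNIV. H$i) > real CARD('d) - 1
     else if H0 = 1 then (\<Sum>i\<in>UNIV. H$i) > real CARD('d) - 2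
     else (\<Sum>i\<in>UNIV. H$i) + H0 > real CARD('d) - 1/2)"
proof -
  interpret noise M H0 H W by standard (use assms in auto)
  consider "H0 = 1" | "H0 < 1" using assms(2) by linarith
  thus ?thesis
  proof cases
    case 1
    thus ?thesis using solvable_iff_one[OF 1] by (simp add: radial_exp_eq) linarith
  next
    case 2
    \<comment> \<open>One criterion, 2 * d - 2 * |H| < 1 + 2 * H0, covers both remaining regimes: at
      H0 = 1/2 it reads |H| > d - 1. Its formal value at H0 = 1 would be d - 3/2, so the threshold d
      - 2 of the other case is a genuine jump.\<close>
    show ?thesis unfolding solvable_iff_less_one[OF assms(1) 2] radial_exp_eq using 2 by auto
  qed
qed

end
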